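(* Let $\delta>0$, $0<\sigma\le 1$, and let $T:\mathcal S(\mathbb R^n)\to\mathcal S'(\mathbb R^n)$ be a bounded linear operator such that: (i) $T$ extends to a continuous operator from $L^2(\mathbb R^n)$ to itself; (ii) $T$ is associated to a kernel $K$ satisfying the $D_1$ condition (with parameters $\delta,\sigma$); (iii) for some $1<s_2<\infty$ and some $\beta$ with $n(1-\sigma)\left(1-\frac1{s_2}\right)\le\beta<n\left(1-\frac1{s_2}\right)$, both $T$ and its adjoint $T^*$ extend to continuous operators from $L^q(\mathbb R^n)$ to $L^{s_2}(\mathbb R^n)$, where $\frac1q=\frac1{s_2}+\frac{\beta}{n}$. Then $T$ is continuous from $L^\infty(\mathbb R^n)$ to $BMO(\mathbb R^n)$ (i.e. $T$ extends to a bounded linear operator from $L^\infty(\mathbb R^n)$ to $BMO(\mathbb R^n)$).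
   Context: A kernel $K(x,y)$ is a continuous function on $\{(x,y)\in\mathbb R^{2n}:x\neq y\}$. $T$ is associated to $K$ if $\langle Tf,g\rangle=\iint K(x,y)f(y)g(x)\,dy\,dx$ for all $f,g\in\mathcal S(\mathbb R^n)$ with disjoint supports. For $R>0$, $z\in\mathbb R^n$, $j\ge1$ an integer, let $C_j(z,R)=\{x\in\mathbb R^n: 2^jR<|x-z|\le 2^{j+1}R\}$. $K$ satisfies the $D_1$ condition (with parameters $\delta>0$, $0<\sigma\le 1$) if, with constants independent of $z,y,r,j$, for all $z\in\mathbb R^n$, $j\ge1$ and $|y-z|<r$: $$\int_{C_j(z,r)}|K(x,y)-K(x,z)|+|K(y,x)-K(z,x)|\,dx\lesssim 2^{-j\delta}\quad\text{if } r>1,$$ and, for every $0<\rho\le\sigma$, $$\int_{C_j(z,r^\rho)}|K(x,y)-K(x,z)|+|K(y,x)-K(z,x)|\,dx\lesssim |C_j(z,r^\rho)|^{\frac{\delta}{n}\left(\frac1\rho-\frac1\sigma\right)}2^{-\frac{j\delta}{\rho}}\quad\text{if } r<1.$$ *)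

theory Defs
  imports "HOL-Analysis.Analysis" "HOL-Probability.Essential_Supremum"
begin

section \<open>Schwartz functions and tempered distributions\<close>

definition partial_derivative ::
    "'n \<Rightarrow> (real^'n \<Rightarrow> complex) \<Rightarrow> real^'n \<Rightarrow> complex" where
  "partial_derivative i f x = frechet_derivative f (at x) (axis i 1)"

text \<open>A multi-index of order \<open>k\<close> is encoded as a list of \<open>k\<close> coordinate directions.\<close>

fun partial_derivatives ::
    "'n list \<Rightarrow> (real^'n \<Rightarrow> complex) \<Rightarrow> real^'n \<Rightarrow> complex" where
  "partial_derivatives [] f = f"
| "partial_derivatives (i # ds) f = partial_derivative i (partial_derivatives ds f)"

definition smooth :: "(real^'n \<Rightarrow> complex) \<Rightarrow> bool" where
  "smooth f \<longleftrightarrow> (\<forall>ds x. partial_derivatives ds f differentiable (at x))"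

definition schwartz :: "(real^'n \<Rightarrow> complex) set" where
  "schwartz = {f. smooth f \<and>
     (\<forall>N ds. bdd_above (range (\<lambda>x. (1 + norm x) ^ N * norm (partial_derivatives ds f x))))}"

definition schwartz_norm :: "nat \<Rightarrow> (real^'n \<Rightarrow> complex) \<Rightarrow> real" where
  "schwartz_norm N f =
     (\<Sum>ds | length ds \<le> N. SUP x. (1 + norm x) ^ N * norm (partial_derivatives ds f x))"

text \<open>
  Distributions are functionals whose values are only meaningful on \<open>schwartz\<close>.
  The norms \<open>schwartz_norm N\<close> increase with \<open>N\<close> and generate the topology of
  the Schwartz space, so a linear functional is continuous iff one of them dominates it.
\<close>

definition tempered :: "((real^'n \<Rightarrow> complex) \<Rightarrow> complex) set" where
  "tempered = {u.
     (\<forall>f\<in>schwartz. \<forall>g\<in>schwartz. \<forall>a b. u (\<lambda>x. a * f x + b * g x) = a * u f + b * u g) \<and>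
     (\<exists>N C. \<forall>f\<in>schwartz. norm (u f) \<le> C * schwartz_norm N f)}"

definition represents ::
    "(real^'n \<Rightarrow> complex) \<Rightarrow> ((real^'n \<Rightarrow> complex) \<Rightarrow> complex) \<Rightarrow> bool" where
  "represents h u \<longleftrightarrow>
     (\<forall>\<phi>\<in>schwartz. integrable lborel (\<lambda>x. h x * \<phi> x) \<and> u \<phi> = (LINT x|lborel. h x * \<phi> x))"

text \<open>
  \<open>T f \<phi>\<close> is the bilinear pairing of the distribution \<open>T f\<close> with the test function \<open>\<phi>\<close>.
  Tempered distributions carry the weak-* topology, so continuity of \<open>T\<close> says that each
  \<open>\<lambda>f. T f \<phi>\<close> is a continuous linear functional.
\<close>

type_synonym 'v operator = "('v \<Rightarrow> complex) \<Rightarrow> ('v \<Rightarrow> complex) \<Rightarrow> complex"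

definition schwartz_operator :: "(real^'n) operator \<Rightarrow> bool" where
  "schwartz_operator T \<longleftrightarrow>
     (\<forall>f\<in>schwartz. T f \<in> tempered) \<and> (\<forall>\<phi>\<in>schwartz. (\<lambda>f. T f \<phi>) \<in> tempered)"

text \<open>The adjoint with respect to the bilinear pairing; its kernel is \<open>K y x\<close>.\<close>

definition adjoint_operator :: "(real^'n) operator \<Rightarrow> (real^'n) operator" where
  "adjoint_operator T f \<phi> = T \<phi> f"


section \<open>Lebesgue spaces and BMO\<close>

text \<open>
  Elements are functions, not equivalence classes.
  A linear bounded map respects almost-everywhere equality automatically.
\<close>

definition Lp :: "real \<Rightarrow> (real^'n \<Rightarrow> complex) set" where
  "Lp p = {f \<in> borel_measurable lborel. integrable lborel (\<lambda>x. norm (f x) powr p)}"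

definition Lp_norm :: "real \<Rightarrow> (real^'n \<Rightarrow> complex) \<Rightarrow> real" where
  "Lp_norm p f = (LINT x|lborel. norm (f x) powr p) powr (1 / p)"

definition extends_Lp :: "real \<Rightarrow> real \<Rightarrow> (real^'n) operator \<Rightarrow> bool" where
  "extends_Lp p s T \<longleftrightarrow> (\<exists>U.
     (\<forall>f\<in>Lp p. U f \<in> Lp s) \<and>
     (\<forall>f\<in>Lp p. \<forall>g\<in>Lp p. \<forall>a b.
        AE x in lborel. U (\<lambda>x. a * f x + b * g x) x = a * U f x + b * U g x) \<and>
     (\<exists>C. \<forall>f\<in>Lp p. Lp_norm s (U f) \<le> C * Lp_norm p f) \<and>
     (\<forall>f\<in>schwartz. represents (U f) (T f)))"

definition Linf :: "(real^'n \<Rightarrow> complex) set" where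
  "Linf = {f \<in> borel_measurable lborel. esssup lborel (\<lambda>x. ereal (norm (f x))) < \<infinity>}"

definition Linf_norm :: "(real^'n \<Rightarrow> complex) \<Rightarrow> real" where
  "Linf_norm f = real_of_ereal (esssup lborel (\<lambda>x. ereal (norm (f x))))"

definition average :: "(real^'n) set \<Rightarrow> (real^'n \<Rightarrow> complex) \<Rightarrow> complex" where
  "average B f = (LINT x:B|lborel. f x) / of_real (measure lborel B)"

definition mean_oscillation :: "(real^'n) set \<Rightarrow> (real^'n \<Rightarrow> complex) \<Rightarrow> real" where
  "mean_oscillation B f = (LINT x:B|lborel. norm (f x - average B f)) / measure lborel B"

definition BMO :: "(real^'n \<Rightarrow> complex) set" where
  "BMO = {f \<in> borel_measurable lborel.
     (\<forall>z r. 0 < r \<longrightarrow> set_integrable lborel (ball z r) f) \<and>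
     bdd_above {mean_oscillation (ball z r) f | z r. 0 < r}}"

definition BMO_norm :: "(real^'n \<Rightarrow> complex) \<Rightarrow> real" where
  "BMO_norm f = Sup {mean_oscillation (ball z r) f | z r. 0 < r}"

text \<open>
  BMO is taken modulo constants, so linearity and agreement with \<open>T\<close> on
  Schwartz functions are required up to additive constants.
\<close>

definition extends_Linf_BMO :: "(real^'n) operator \<Rightarrow> bool" where
  "extends_Linf_BMO T \<longleftrightarrow> (\<exists>U.
     (\<forall>f\<in>Linf. U f \<in> BMO) \<and>
     (\<forall>f\<in>Linf. \<forall>g\<in>Linf. \<forall>a b. \<exists>c.
        AE x in lborel. U (\<lambda>x. a * f x + b * g x) x = a * U f x + b * U g x + c) \<and>
     (\<exists>C. \<forall>f\<in>Linf. BMO_norm (U f) \<le> C * Linf_norm f) \<and>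
     (\<forall>f\<in>schwartz. \<exists>c. represents (\<lambda>x. U f x + c) (T f)))"


section \<open>Kernels\<close>

definition is_kernel :: "(real^'n \<Rightarrow> real^'n \<Rightarrow> complex) \<Rightarrow> bool" where
  "is_kernel K \<longleftrightarrow> continuous_on {(x, y). x \<noteq> y} (\<lambda>(x, y). K x y)"

definition associated :: "(real^'n) operator \<Rightarrow> (real^'n \<Rightarrow> real^'n \<Rightarrow> complex) \<Rightarrow> bool" where
  "associated T K \<longleftrightarrow> (\<forall>f\<in>schwartz. \<forall>g\<in>schwartz.
     closure {x. f x \<noteq> 0} \<inter> closure {x. g x \<noteq> 0} = {} \<longrightarrow>
     integrable (lborel \<Otimes>\<^sub>M lborel) (\<lambda>(x, y). K x y * f y * g x) \<and>
     T f g = (LINT x|lborel. LINT y|lborel. K x y * f y * g x))"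

definition annulus :: "nat \<Rightarrow> real^'n \<Rightarrow> real \<Rightarrow> (real^'n) set" where
  "annulus j z R = {x. 2 ^ j * R < norm (x - z) \<and> norm (x - z) \<le> 2 ^ (j + 1) * R}"

text \<open>The constant in the second estimate may depend on \<open>\<rho>\<close>, but not on \<open>z\<close>, \<open>y\<close>, \<open>r\<close>, \<open>j\<close>.\<close>

definition D1 :: "real \<Rightarrow> real \<Rightarrow> (real^'n \<Rightarrow> real^'n \<Rightarrow> complex) \<Rightarrow> bool" where
  "D1 \<delta> \<sigma> K \<longleftrightarrow>
     (\<exists>C. \<forall>z y r. \<forall>j\<ge>1. norm (y - z) < r \<and> 1 < r \<longrightarrow>
        (\<integral>\<^sup>+x\<in>annulus j z r.
           ennreal (norm (K x y - K x z) + norm (K y x - K z x)) \<partial>lborel)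
        \<le> ennreal (C * 2 powr (- real j * \<delta>))) \<and>
     (\<forall>\<rho>. 0 < \<rho> \<and> \<rho> \<le> \<sigma> \<longrightarrow>
       (\<exists>C. \<forall>z y r. \<forall>j\<ge>1. norm (y - z) < r \<and> r < 1 \<longrightarrow>
        (\<integral>\<^sup>+x\<in>annulus j z (r powr \<rho>).
           ennreal (norm (K x y - K x z) + norm (K y x - K z x)) \<partial>lborel)
        \<le> ennreal (C * measure lborel (annulus j z (r powr \<rho>))
                          powr (\<delta> / CARD('n) * (1 / \<rho> - 1 / \<sigma>))
                     * 2 powr (- real j * \<delta> / \<rho>))))"

end

theory Submission
  imports Defs
begin

text \<open>
  Write \<open>U\<close> for the extension of \<open>T\<close> to \<open>L\<^sup>2\<close>.  For \<open>f\<close> in \<open>L\<^sup>\<infinity>\<close> the truncations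
  \<open>f\<^sub>m = f 1\<^bsub>B(0,m)\<^esub>\<close> are square integrable, and the extension to \<open>L\<^sup>\<infinity>\<close> is the almost everywhere
  limit of \<open>U f\<^sub>m\<close> minus its average over the unit ball (\<open>bmo_extension\<close>).  Two estimates make
  this work.

  Far from the support of a bounded function \<open>g\<close>, the image \<open>U g\<close> is the kernel integral
  \<open>\<integral> K(x,y) g(y) dy\<close> (\<open>far_action\<close>), so on a ball around \<open>z\<close> it differs from the constant
  \<open>\<integral> K(z,y) g(y) dy\<close> by at most \<open>sup |g|\<close> times a tail of \<open>\<integral> |K(x,y) - K(z,y)| dy\<close>.  The
  \<open>D\<^sub>1\<close> condition, summed over dyadic annuli, bounds these tails.  For radii \<open>R > 1\<close> the tail
  outside \<open>B(z, 2\<^sup>J R)\<close> moreover decays in \<open>J\<close>, which gives the convergence of the normalized truncations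
  (\<open>normalized_truncation_cauchy\<close>).

  The second estimate is the bound on the mean oscillation over \<open>B(z,r)\<close>, uniform in \<open>m\<close>
  (\<open>uniform_oscillation\<close>): split \<open>f\<^sub>m\<close> into a near and a far part.  For \<open>r \<ge> 1\<close> the near part lives
  on \<open>B(z,4r)\<close> and is controlled by the \<open>L\<^sup>2\<close> bound.  For \<open>r < 1\<close> the tail estimate only holds outside the
  larger ball \<open>B(z, 2 r\<^sup>\<rho>)\<close> with \<open>\<rho> \<le> \<sigma>\<close>, and there the bound of the adjoint from \<open>L\<^sup>q\<close> to
  \<open>L\<^bsup>s\<^sub>2\<^esup>\<close> is used: testing the image of the near part against its conjugate phase on \<open>B(z,r)\<close> and moving the
  operator to the other side gives at most \<open>|B(z,r)|\<^bsup>1/q\<^esup> |B(z,2r\<^sup>\<rho>)|\<^bsup>1-1/s\<^sub>2\<^esup>\<close>, up to constants.  This is of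
  order \<open>|B(z,r)|\<close> exactly for \<open>\<rho> = (1 - 1/q) / (1 - 1/s\<^sub>2)\<close>, and the lower bound on \<open>\<beta>\<close> says that this
  \<open>\<rho>\<close> is at most \<open>\<sigma>\<close>.

  Both the kernel formula and the adjoint identity are known on Schwartz functions only.  They pass
  to bounded functions by \<open>bp_functional_zero\<close>: the two sides are continuous under bounded
  pointwise convergence, smooth bumps approximate the indicators of boxes in this sense, and Dynkin's
  theorem leads from boxes to Borel sets.
\<close>

section \<open>Smooth bump functions on boxes\<close>

text \<open>
  The functions \<open>p(1/t) exp(-1/t)\<close> with a polynomial \<open>p\<close>, extended by zero.  Allowing all \<open>p\<close> makes
  the family closed under differentiation, so that no formula for higher derivatives is needed.
\<close>

definition exp_flat :: "real poly \<Rightarrow> real \<Rightarrow> real" where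
  "exp_flat p t = (if 0 < t then poly p (1 / t) * exp (- (1 / t)) else 0)"

text \<open>The chain rule for \<open>s = 1/t\<close> turns \<open>p(s) exp(-s)\<close> into \<open>s\<^sup>2 (p - p')(s) exp(-s)\<close>.\<close>

definition exp_flat_deriv :: "real poly \<Rightarrow> real poly" where
  "exp_flat_deriv p = [:0, 0, 1:] * (p - pderiv p)"

lemma poly_times_exp_tendsto_0: "((\<lambda>s::real. poly p s * exp (- s)) \<longlongrightarrow> 0) at_top"
proof -
  have "((\<lambda>s::real. (\<Sum>i\<le>degree p. coeff p i * (s ^ i / exp s))) \<longlongrightarrow> (\<Sum>i\<le>degree p. coeff p i * 0)) at_top"
    by (intro tendsto_intros tendsto_power_div_exp_0)
  then show ?thesis
    by (simp add: poly_altdef exp_minus field_simps sum_distrib_right sum_distrib_left)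
qed

text \<open>
  Only the origin is delicate: there the difference quotient from the right is \<open>s p(s) exp(-s)\<close>
  with \<open>s = 1/t\<close> tending to infinity.
\<close>

lemma exp_flat_has_derivative:
  "(exp_flat p has_real_derivative exp_flat (exp_flat_deriv p) t) (at t)"
proof -
  consider "t > 0" | "t < 0" | "t = 0" by linarith
  then show ?thesis
  proof cases
    case 1
    have "((\<lambda>t. poly p (1 / t) * exp (- (1 / t))) has_real_derivative exp_flat (exp_flat_deriv p) t) (at t)"
      using 1 unfolding exp_flat_def exp_flat_deriv_def
      by (auto intro!: derivative_eq_intros simp: field_simps power2_eq_square)
    then show ?thesis
      by (rule DERIV_cong_ev[THEN iffD1, rotated -1])
        (use 1 in \<open>auto simp: exp_flat_def eventually_at_topological intro!: eventually_mono[OF eventually_nhds_in_open[of "{0<..}"]]\<close>)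
  next
    case 2
    have "((\<lambda>t. 0) has_real_derivative exp_flat (exp_flat_deriv p) t) (at t)"
      using 2 by (simp add: exp_flat_def)
    then show ?thesis
      by (rule DERIV_cong_ev[THEN iffD1, rotated -1])
        (use 2 in \<open>auto simp: exp_flat_def intro!: eventually_mono[OF eventually_nhds_in_open[of "{..<0}"]]\<close>)
  next
    case 3
    have "((\<lambda>h. exp_flat p h / h) \<longlongrightarrow> 0) (at_right 0)"
    proof -
      have "((\<lambda>s. poly (pCons 0 p) s * exp (- s)) \<longlongrightarrow> 0) at_top"
        by (rule poly_times_exp_tendsto_0)
      then have "((\<lambda>h. poly (pCons 0 p) (inverse h) * exp (- inverse h)) \<longlongrightarrow> 0) (at_right (0::real))"
        by (rule filterlim_compose[OF _ filterlim_inverse_at_top_right])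
      then show ?thesis
        by (rule Lim_transform_eventually)
          (auto simp: eventually_at_right[OF zero_less_one] exp_flat_def field_simps intro!: exI[of _ 1])
    qed
    moreover have "((\<lambda>h. exp_flat p h / h) \<longlongrightarrow> 0) (at_left 0)"
      by (rule Lim_transform_eventually[OF tendsto_const])
        (auto simp: eventually_at_left[of "-1"] exp_flat_def intro!: exI[of _ "-1"])
    ultimately have "((\<lambda>h. exp_flat p h / h) \<longlongrightarrow> 0) (at 0)"
      by (simp add: filterlim_split_at)
    then show ?thesis
      using 3 by (simp add: has_field_derivative_iff exp_flat_def)
  qed
qed

text \<open>
  An algebra of functions of several variables that every partial derivative maps to itself.
  Smoothness of its members follows by induction on the multi-index, with no bookkeeping of
  product rules.
\<close>

inductive_set flat_algebra :: "(real^'n \<Rightarrow> complex) set" where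
  const: "(\<lambda>x. c) \<in> flat_algebra"
| flat: "(\<lambda>x. of_real (exp_flat p (c * x $ i + d))) \<in> flat_algebra"
| add: "f \<in> flat_algebra \<Longrightarrow> g \<in> flat_algebra \<Longrightarrow> (\<lambda>x. f x + g x) \<in> flat_algebra"
| mult: "f \<in> flat_algebra \<Longrightarrow> g \<in> flat_algebra \<Longrightarrow> (\<lambda>x. f x * g x) \<in> flat_algebra"

lemma flat_algebra_differentiable:
  fixes f :: "real^'n \<Rightarrow> complex"
  assumes "f \<in> flat_algebra"
  shows "f differentiable (at x) \<and> partial_derivative j f \<in> flat_algebra"
  using assms
proof (induction arbitrary: x)
  case (const c)
  have "partial_derivative j (\<lambda>x. c) = (\<lambda>x. 0)"
    by (simp add: partial_derivative_def fun_eq_iff)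
  then show ?case by (simp add: flat_algebra.const)
next
  case (flat p c i d)
  have D: "((\<lambda>x::real^'n. complex_of_real (exp_flat p (c * x $ i + d))) has_derivative
      (\<lambda>h. of_real (exp_flat (exp_flat_deriv p) (c * x $ i + d) * (c * h $ i)))) (at x)" for x
  proof -
    have "((\<lambda>x::real^'n. c * x $ i + d) has_derivative (\<lambda>h. c * h $ i)) (at x)"
      by (auto intro!: derivative_eq_intros bounded_linear_imp_has_derivative bounded_linear_vec_nth)
    from has_derivative_compose[OF this exp_flat_has_derivative[unfolded has_field_derivative_def]]
    show ?thesis
      by (intro bounded_linear.has_derivative[OF bounded_linear_of_real]) (auto simp: o_def)
  qed
  have "partial_derivative j (\<lambda>x. complex_of_real (exp_flat p (c * x $ i + d))) =
     (\<lambda>x. complex_of_real (if i = j then c else 0) * complex_of_real (exp_flat (exp_flat_deriv p) (c * x $ i + d)))"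
    by (auto simp: partial_derivative_def fun_eq_iff frechet_derivative_at[OF D, symmetric] axis_def)
  then show ?case
    using D by (auto simp: differentiable_def intro!: flat_algebra.intros)
next
  case (add f g)
  have "partial_derivative j (\<lambda>x. f x + g x) = (\<lambda>x. partial_derivative j f x + partial_derivative j g x)"
  proof
    fix x
    have "((\<lambda>x. f x + g x) has_derivative
       (\<lambda>h. frechet_derivative f (at x) h + frechet_derivative g (at x) h)) (at x)"
      using add by (intro has_derivative_add) (auto simp: frechet_derivative_works[symmetric])
    from frechet_derivative_at[OF this, symmetric]
    show "partial_derivative j (\<lambda>x. f x + g x) x = partial_derivative j f x + partial_derivative j g x"
      by (simp add: partial_derivative_def)
  qed
  then show ?case using add by (auto intro!: flat_algebra.intros)
next
  case (mult f g)
  have "partial_derivative j (\<lambda>x. f x * g x) =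
      (\<lambda>x. f x * partial_derivative j g x + partial_derivative j f x * g x)"
  proof
    fix x
    have "((\<lambda>x. f x * g x) has_derivative
       (\<lambda>h. f x * frechet_derivative g (at x) h + frechet_derivative f (at x) h * g x)) (at x)"
      using mult by (intro has_derivative_mult) (auto simp: frechet_derivative_works[symmetric])
    from frechet_derivative_at[OF this, symmetric]
    show "partial_derivative j (\<lambda>x. f x * g x) x = f x * partial_derivative j g x + partial_derivative j f x * g x"
      by (simp add: partial_derivative_def)
  qed
  then show ?case using mult by (auto intro!: flat_algebra.intros differentiable_mult)
qed

lemma flat_algebra_smooth: "f \<in> flat_algebra \<Longrightarrow> smooth f"
proof -
  assume "f \<in> flat_algebra"
  then have "partial_derivatives ds f \<in> flat_algebra" for ds
    by (induction ds) (auto simp: flat_algebra_differentiable)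
  then show ?thesis
    by (simp add: smooth_def flat_algebra_differentiable)
qed

lemma partial_derivatives_zero_outside:
  fixes f :: "real^'n \<Rightarrow> complex"
  assumes "closed A" and "\<And>x. x \<notin> A \<Longrightarrow> f x = 0" and "x \<notin> A"
  shows "partial_derivatives ds f x = 0"
  using \<open>x \<notin> A\<close>
proof (induction ds arbitrary: x)
  case Nil
  then show ?case using assms by simp
next
  case (Cons i ds)
  have "(partial_derivatives ds f has_derivative (\<lambda>h. 0)) (at x)"
  proof (rule has_derivative_transform_within_open[where f = "\<lambda>x. 0"])
    show "open (- A)" using assms(1) by (simp add: open_Compl)
  qed (use Cons in auto)
  then show ?case
    by (simp add: partial_derivative_def frechet_derivative_at[symmetric])
qed

lemma smooth_compact_support_schwartz:
  fixes f :: "real^'n \<Rightarrow> complex"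
  assumes "smooth f" and "compact A" and "\<And>x. x \<notin> A \<Longrightarrow> f x = 0"
  shows "f \<in> schwartz"
  unfolding schwartz_def
proof (safe intro!: assms(1))
  fix N ds
  let ?h = "\<lambda>x. (1 + norm x) ^ N * norm (partial_derivatives ds f x)"
  have "continuous_on A (partial_derivatives ds f)"
    using assms(1) by (intro continuous_at_imp_continuous_on ballI differentiable_imp_continuous_within)
      (auto simp: smooth_def)
  then have "compact (?h ` A)"
    by (intro compact_continuous_image assms(2) continuous_intros)
  then have "bdd_above (insert 0 (?h ` A))"
    by (simp add: bounded_imp_bdd_above compact_imp_bounded)
  moreover have "range ?h \<subseteq> insert 0 (?h ` A)"
    using partial_derivatives_zero_outside[of A f] assms compact_imp_closed by fastforce
  ultimately show "bdd_above (range ?h)"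
    by (rule bdd_above_mono)
qed

lemma schwartz_continuous: "f \<in> schwartz \<Longrightarrow> continuous_on UNIV f"
  unfolding schwartz_def smooth_def
  by (auto intro!: continuous_at_imp_continuous_on differentiable_imp_continuous_within
      dest: spec[of _ "[]"])

lemma schwartz_measurable: "f \<in> schwartz \<Longrightarrow> f \<in> borel_measurable lborel"
  using schwartz_continuous borel_measurable_continuous_onI by auto

lemma prod_flat_algebra:
  assumes "\<And>i. i \<in> I \<Longrightarrow> f i \<in> flat_algebra" "finite I"
  shows "(\<lambda>x. \<Prod>i\<in>I. f i x) \<in> flat_algebra"
  using assms(2,1) by (induction I) (auto intro: flat_algebra.intros)

text \<open>
  The inner factor \<open>k\<close> places the zeros at distance \<open>1/k\<close> from the faces, so that the support lies
  strictly inside the box; the outer factor makes both arguments tend to infinity at interior points,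
  where \<open>exp_flat 1\<close> tends to one.
\<close>

definition bump :: "real^'n \<Rightarrow> real^'n \<Rightarrow> nat \<Rightarrow> real^'n \<Rightarrow> complex" where
  "bump a b k x = (\<Prod>i\<in>UNIV. of_real (exp_flat 1 (real k * (real k * (x $ i - a $ i) - 1))) *
     of_real (exp_flat 1 (real k * (real k * (b $ i - x $ i) - 1))))"

lemma bump_flat_algebra:
  fixes a b :: "real^'n"
  shows "bump a b k \<in> flat_algebra"
proof -
  have 1: "(\<lambda>x::real^'n. complex_of_real (exp_flat 1 (real k * (real k * (x $ i - a $ i) - 1)))) \<in> flat_algebra" for i
    using flat_algebra.flat[of 1 "real k * real k" i "- real k * (real k * a $ i + 1)"]
    by (simp add: algebra_simps)
  have 2: "(\<lambda>x::real^'n. complex_of_real (exp_flat 1 (real k * (real k * (b $ i - x $ i) - 1)))) \<in> flat_algebra" for i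
    using flat_algebra.flat[of 1 "- real k * real k" i "real k * (real k * b $ i - 1)"]
    by (simp add: algebra_simps)
  have "(\<lambda>x. \<Prod>i\<in>UNIV. of_real (exp_flat 1 (real k * (real k * (x $ i - a $ i) - 1))) *
     of_real (exp_flat 1 (real k * (real k * (b $ i - x $ i) - 1)))) \<in> flat_algebra"
    by (intro prod_flat_algebra flat_algebra.mult 1 2) auto
  then show ?thesis by (simp add: bump_def[abs_def])
qed

lemma exp_flat_1_bounds: "0 \<le> exp_flat 1 t \<and> exp_flat 1 t \<le> 1"
  by (simp add: exp_flat_def)

lemma norm_bump_le_1: "norm (bump a b k x) \<le> 1"
  by (auto simp: bump_def norm_mult exp_flat_1_bounds simp flip: prod_norm intro!: prod_le_1 mult_le_one)

lemma bump_zero: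
  assumes "x \<notin> cbox (\<chi> i. a $ i + 1 / k) (\<chi> i. b $ i - 1 / k)"
  shows "bump a b k x = 0"
proof -
  obtain i where "x $ i < a $ i + 1 / k \<or> b $ i - 1 / k < x $ i"
    using assms by (auto simp: mem_box_cart not_le)
  then have "real k * (real k * (x $ i - a $ i) - 1) \<le> 0 \<or> real k * (real k * (b $ i - x $ i) - 1) \<le> 0"
  proof (cases "k = 0")
    case False
    then have "real k > 0" by simp
    then have "1 / real k > x $ i - a $ i \<longleftrightarrow> 1 > real k * (x $ i - a $ i)"
      "1 / real k > b $ i - x $ i \<longleftrightarrow> 1 > real k * (b $ i - x $ i)"
      by (auto simp: field_simps)
    with \<open>x $ i < a $ i + 1 / k \<or> b $ i - 1 / k < x $ i\<close> show ?thesis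
      by (auto simp: mult_le_0_iff)
  qed simp
  then have "of_real (exp_flat 1 (real k * (real k * (x $ i - a $ i) - 1))) *
     of_real (exp_flat 1 (real k * (real k * (b $ i - x $ i) - 1))) = (0::complex)"
    by (auto simp: exp_flat_def)
  then show ?thesis
    unfolding bump_def by (intro prod_zero) auto
qed

lemma bump_support:
  fixes a b :: "real^'n"
  shows "closure {x. bump a b (Suc k) x \<noteq> 0} \<subseteq> box a b"
proof -
  let ?Q = "cbox (\<chi> i. a $ i + 1 / real (Suc k)) (\<chi> i. b $ i - 1 / real (Suc k)) :: (real^'n) set"
  have "closure {x. bump a b (Suc k) x \<noteq> 0} \<subseteq> ?Q"
    using bump_zero[of _ a "Suc k" b] by (intro closure_minimal) auto
  also have "?Q \<subseteq> box a b"
  proof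
    fix x assume x: "x \<in> ?Q"
    have "a $ i < x $ i \<and> x $ i < b $ i" for i
    proof -
      have "a $ i + 1 / real (Suc k) \<le> x $ i \<and> x $ i \<le> b $ i - 1 / real (Suc k)"
        using x by (simp add: mem_box_cart)
      moreover have "0 < 1 / real (Suc k)" by simp
      ultimately show ?thesis by linarith
    qed
    then show "x \<in> box a b" by (simp add: mem_box_cart)
  qed
  finally show ?thesis .
qed

lemma bump_schwartz: "bump a b k \<in> schwartz"
  by (rule smooth_compact_support_schwartz[OF flat_algebra_smooth[OF bump_flat_algebra] compact_cbox])
    (rule bump_zero)

lemma bump_tendsto_indicator:
  fixes a b x :: "real^'n"
  shows "(\<lambda>k. bump a b (Suc k) x) \<longlonglongrightarrow> indicator (box a b) x"
proof (cases "x \<in> box a b")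
  case True
  have lim: "(\<lambda>k. exp_flat 1 (Suc k * (Suc k * s - 1))) \<longlonglongrightarrow> 1" if "s > 0" for s :: real
  proof -
    have "filterlim (\<lambda>k. real (Suc k) * (real (Suc k) * s - 1)) at_top sequentially"
      (is "filterlim ?u _ _")
    proof (rule filterlim_at_top_mult_at_top)
      show "filterlim (\<lambda>k. real (Suc k)) at_top sequentially"
        by (rule filterlim_compose[OF filterlim_real_sequentially filterlim_Suc])
      then have "filterlim (\<lambda>k. s * real (Suc k)) at_top sequentially"
        by (intro filterlim_tendsto_pos_mult_at_top[OF tendsto_const that])
      then show "filterlim (\<lambda>k. real (Suc k) * s - 1) at_top sequentially"
        using filterlim_tendsto_add_at_top[OF tendsto_const[of "-1"]] by (simp add: mult.commute)
    qed
    note u = this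
    have pos: "\<forall>\<^sub>F k in sequentially. ?u k > 0"
      using u by (simp only: filterlim_at_top_dense)
    have "(\<lambda>k. exp (- inverse (?u k))) \<longlonglongrightarrow> exp (- 0)"
      by (intro tendsto_exp tendsto_minus tendsto_inverse_0_at_top[OF u])
    then have "(\<lambda>k. exp (- inverse (?u k))) \<longlonglongrightarrow> 1"
      by simp
    moreover have "\<forall>\<^sub>F k in sequentially. exp (- inverse (?u k)) = exp_flat 1 (?u k)"
      using pos by eventually_elim (simp only: exp_flat_def if_True poly_1 inverse_eq_divide mult_1_left)
    ultimately show ?thesis
      by (rule Lim_transform_eventually)
  qed
  have "(\<lambda>k. bump a b (Suc k) x) \<longlonglongrightarrow> (\<Prod>i\<in>(UNIV::'n set). complex_of_real 1 * complex_of_real 1)"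
    unfolding bump_def using True by (intro tendsto_prod tendsto_mult tendsto_of_real lim) (simp_all add: mem_box_cart)
  then show ?thesis using True by simp
next
  case False
  then have "bump a b (Suc k) x = 0" for k
    using bump_support[of a b k] closure_subset[of "{x. bump a b (Suc k) x \<noteq> 0}"] by blast
  then show ?thesis using False by simp
qed

section \<open>Functionals continuous under bounded pointwise convergence\<close>

definition bdd_supp :: "(real^'n) set \<Rightarrow> (real^'n \<Rightarrow> complex) set" where
  "bdd_supp W = {f \<in> borel_measurable lborel. (\<exists>M. \<forall>x. norm (f x) \<le> M) \<and> (\<forall>x. x \<notin> W \<longrightarrow> f x = 0)}"

text \<open>
  Sequential continuity for uniformly bounded pointwise convergence with common support: weak enough
  to hold for all pairings below by dominated convergence, strong enough to reach every bounded
  measurable function from box indicators.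
\<close>

definition bp_continuous :: "(real^'n) set \<Rightarrow> ((real^'n \<Rightarrow> complex) \<Rightarrow> complex) \<Rightarrow> bool" where
  "bp_continuous W L \<longleftrightarrow>
     (\<forall>F f M. (\<forall>k. F k \<in> bdd_supp W) \<longrightarrow> f \<in> bdd_supp W \<longrightarrow> (\<forall>k x. norm (F k x) \<le> M) \<longrightarrow> (\<forall>x. (\<lambda>k. F k x) \<longlonglongrightarrow> f x) \<longrightarrow>
        (\<lambda>k::nat. L (F k)) \<longlonglongrightarrow> L f)"

definition bp_functional :: "(real^'n) set \<Rightarrow> ((real^'n \<Rightarrow> complex) \<Rightarrow> complex) \<Rightarrow> bool" where
  "bp_functional W L \<longleftrightarrow>
     (\<forall>f\<in>bdd_supp W. \<forall>g\<in>bdd_supp W. \<forall>a b. L (\<lambda>x. a * f x + b * g x) = a * L f + b * L g) \<and>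
     bp_continuous W L"

lemma bp_functionalD:
  assumes "bp_functional W L" "f \<in> bdd_supp W" "g \<in> bdd_supp W"
  shows "L (\<lambda>x. a * f x + b * g x) = a * L f + b * L g"
  using assms by (simp add: bp_functional_def)

lemma bp_functional_limit:
  assumes "bp_functional W L" "\<And>k::nat. F k \<in> bdd_supp W" "f \<in> bdd_supp W"
    "\<And>k x. norm (F k x) \<le> M" "\<And>x. (\<lambda>k. F k x) \<longlonglongrightarrow> f x"
  shows "(\<lambda>k. L (F k)) \<longlonglongrightarrow> L f"
  using assms(1) unfolding bp_functional_def bp_continuous_def using assms(2-) by metis

lemma bp_functional_diff:
  assumes "bp_functional W L" "bp_functional W L'"
  shows "bp_functional W (\<lambda>f. L f - L' f)"
  unfolding bp_functional_def bp_continuous_def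
proof (intro conjI ballI allI impI)
  fix F :: "nat \<Rightarrow> _" and f M
  assume "\<forall>k. F k \<in> bdd_supp W" "f \<in> bdd_supp W" "\<forall>k x. norm (F k x) \<le> M" "\<forall>x. (\<lambda>k. F k x) \<longlonglongrightarrow> f x"
  then show "(\<lambda>k. L (F k) - L' (F k)) \<longlonglongrightarrow> L f - L' f"
    by (intro tendsto_diff bp_functional_limit[OF assms(1)] bp_functional_limit[OF assms(2)]) auto
qed (simp add: bp_functionalD[OF assms(1)] bp_functionalD[OF assms(2)] algebra_simps)

lemma bdd_supp_lincomb:
  assumes "f \<in> bdd_supp W" "g \<in> bdd_supp W"
  shows "(\<lambda>x. a * f x + b * g x) \<in> bdd_supp W"
proof -
  obtain M N where "\<And>x. norm (f x) \<le> M" "\<And>x. norm (g x) \<le> N"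
    using assms by (auto simp: bdd_supp_def)
  then have "norm (a * f x + b * g x) \<le> norm a * M + norm b * N" for x
    by (intro order_trans[OF norm_triangle_ineq] add_mono) (auto simp: norm_mult intro: mult_left_mono)
  then show ?thesis
    using assms by (auto simp: bdd_supp_def)
qed

lemma bdd_supp_restrict:
  assumes "f \<in> bdd_supp W" "A \<in> sets borel"
  shows "(\<lambda>x. indicator A x * f x) \<in> bdd_supp (A \<inter> W)"
proof -
  obtain M where "\<And>x. norm (f x) \<le> M" using assms by (auto simp: bdd_supp_def)
  then have "norm (indicator A x * f x) \<le> M" for x
    using norm_ge_zero[of "f x"] order_trans[OF norm_ge_zero[of "f x"]] by (cases "x \<in> A") auto
  moreover have "(\<lambda>x. indicator A x * f x) \<in> borel_measurable lborel"
    using assms by (auto simp: bdd_supp_def)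
  moreover have "indicator A x * f x = 0" if "x \<notin> A \<inter> W" for x
    using that assms(1) by (auto simp: bdd_supp_def)
  ultimately show ?thesis
    unfolding bdd_supp_def by blast
qed

lemma bdd_supp_mono: "f \<in> bdd_supp V \<Longrightarrow> V \<subseteq> W \<Longrightarrow> f \<in> bdd_supp W"
  by (auto simp: bdd_supp_def)

lemma bdd_supp_sum:
  assumes "\<And>i. i \<in> I \<Longrightarrow> f i \<in> bdd_supp W" "finite I"
  shows "(\<lambda>x. \<Sum>i\<in>I. c i * f i x) \<in> bdd_supp W"
  using assms(2,1)
proof induction
  case empty
  show ?case by (auto simp: bdd_supp_def)
next
  case (insert i I)
  then show ?case
    using bdd_supp_lincomb[of "f i" W "\<lambda>x. \<Sum>i\<in>I. c i * f i x" "c i" 1] by simp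
qed

lemma bp_functional_sum:
  assumes "bp_functional W L" "\<And>i. i \<in> I \<Longrightarrow> f i \<in> bdd_supp W" "finite I"
  shows "L (\<lambda>x. \<Sum>i\<in>I. c i * f i x) = (\<Sum>i\<in>I. c i * L (f i))"
  using assms(3,2)
proof induction
  case empty
  have "(\<lambda>x. 0) \<in> bdd_supp W" by (auto simp: bdd_supp_def)
  from bp_functionalD[OF assms(1) this this, of 0 0] show ?case by simp
next
  case (insert i I)
  then show ?case
    using bp_functionalD[OF assms(1), of "f i" "\<lambda>x. \<Sum>i\<in>I. c i * f i x" "c i" 1]
      bdd_supp_sum[of I f W c] by simp
qed

lemma indicator_bdd_supp: "A \<in> sets borel \<Longrightarrow> A \<subseteq> W \<Longrightarrow> indicator A \<in> bdd_supp W"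
  unfolding bdd_supp_def by (auto intro!: exI[of _ 1] simp: indicator_def)

lemma indicator_disjoint_UN_sums:
  assumes "disjoint_family A"
  shows "(\<lambda>n. \<Sum>i<n. indicator (A i) x :: complex) \<longlonglongrightarrow> indicator (\<Union>i::nat. A i) x"
    and "norm (\<Sum>i<n. indicator (A i) x :: complex) \<le> 1"
proof -
  have eq: "(\<Sum>i<n. indicator (A i) x :: complex) = indicator (\<Union>i<n. A i) x" for n
  proof (induction n)
    case (Suc n)
    have "A n \<inter> (\<Union>i<n. A i) = {}"
    proof -
      have "A n \<inter> A i = {}" if "i < n" for i
        using disjoint_family_onD[OF assms, of n i] that by simp
      then show ?thesis by blast
    qed
    then have "indicator (\<Union>i<Suc n. A i) x = (indicator (\<Union>i<n. A i) x + indicator (A n) x :: complex)"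
      by (auto simp: indicator_def lessThan_Suc)
    then show ?case using Suc by simp
  qed simp
  show "norm (\<Sum>i<n. indicator (A i) x :: complex) \<le> 1"
    unfolding eq by (simp add: indicator_def)
  show "(\<lambda>n. \<Sum>i<n. indicator (A i) x :: complex) \<longlonglongrightarrow> indicator (\<Union>i::nat. A i) x"
    unfolding eq by (rule LIMSEQ_indicator_UN)
qed

lemma bp_functional_disjoint_UN:
  assumes L: "bp_functional W L"
    and "disjoint_family A" "\<And>i. A i \<in> sets borel" "\<And>i::nat. A i \<subseteq> W" "\<And>i. L (indicator (A i)) = 0"
  shows "L (indicator (\<Union>i. A i)) = 0"
proof -
  have ind: "indicator (A i) \<in> bdd_supp W" for i
    by (intro indicator_bdd_supp assms)
  have "L (\<lambda>x. \<Sum>i<n. indicator (A i) x) = 0" for n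
    using bp_functional_sum[OF L ind, of "{..<n}" "\<lambda>_. 1"] assms(5) by simp
  moreover have "(\<lambda>n. L (\<lambda>x. \<Sum>i<n. indicator (A i) x)) \<longlonglongrightarrow> L (indicator (\<Union>i. A i))"
  proof (rule bp_functional_limit[OF L])
    show "(\<lambda>x. \<Sum>i<n. indicator (A i) x) \<in> bdd_supp W" for n
      using bdd_supp_sum[of "{..<n}" "\<lambda>i. indicator (A i)" W "\<lambda>_. 1"] ind by simp
    show "indicator (\<Union>i. A i) \<in> bdd_supp W"
      using assms(3,4) by (intro indicator_bdd_supp) blast+
  qed (rule indicator_disjoint_UN_sums[OF assms(2)])+
  ultimately show ?thesis
    by (simp add: LIMSEQ_const_iff)
qed

text \<open>
  Boxes are stable under intersection and generate the Borel sets, and the sets that the functional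
  does not see inside a fixed box are closed under complements and countable disjoint unions.
\<close>

lemma bp_functional_zero_on_boxes:
  fixes a b :: "real^'n"
  assumes L: "bp_functional W L"
    and boxes: "\<And>c d. box c d \<subseteq> W \<Longrightarrow> L (indicator (box c d)) = 0"
    and "box a b \<subseteq> W" and "A \<in> sets borel"
  shows "L (indicator (A \<inter> box a b)) = 0"
proof -
  let ?G = "range (\<lambda>(a, b). box a b :: (real^'n) set)"
  have "Int_stable ?G" "?G \<subseteq> Pow UNIV"
    by (auto simp: Int_stable_def box_Int_box)
  moreover have "A \<in> sigma_sets UNIV ?G"
    using assms(4) by (simp add: borel_eq_box)
  ultimately show ?thesis
  proof (induction rule: sigma_sets_induct_disjoint)
    case (basic A)
    then obtain c d where "A = box c d" by auto
    then show ?case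
      using assms(3) by (simp only: box_Int_box[of c d a b], intro boxes)
        (auto simp: box_Int_box[of c d a b, symmetric])
  next
    case empty
    have "box a a = {}" by (simp add: box_eq_empty)
    then show ?case using boxes[of a a] by (simp only: Int_empty_left empty_subsetI)
  next
    case (compl A)
    then have [measurable]: "A \<in> sets borel" by (simp add: borel_eq_box)
    have "indicator (box a b) \<in> bdd_supp W" "indicator (A \<inter> box a b) \<in> bdd_supp W"
      using assms(3) by (auto intro!: indicator_bdd_supp)
    from bp_functionalD[OF L this, of 1 "- 1"]
    have "L (\<lambda>x. 1 * indicator (box a b) x + (- 1) * indicator (A \<inter> box a b) x) = 0"
      using compl(2) boxes[OF assms(3)] by (simp only: mult_zero_right add_0)
    moreover have "(\<lambda>x. 1 * indicator (box a b) x + (- 1) * indicator (A \<inter> box a b) x) =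
        (indicator ((UNIV - A) \<inter> box a b) :: _ \<Rightarrow> complex)"
      by (auto simp: fun_eq_iff indicator_def)
    ultimately show ?case by (simp only:)
  next
    case (union A)
    then have "A i \<in> sets borel" for i by (auto simp: borel_eq_box)
    then have "L (indicator (\<Union>i. A i \<inter> box a b)) = 0"
      using union assms(3) by (intro bp_functional_disjoint_UN[OF L])
        (auto simp: disjoint_family_on_def)
    then show ?case by (simp add: Int_UN_distrib2)
  qed
qed

text \<open>
  The passage from test functions to bounded functions.  Bumps give indicators of boxes, Dynkin's
  theorem the Borel subsets of one box, a disjointed countable cover of \<open>W\<close> by boxes the Borel subsets
  of \<open>W\<close>, and simple functions everything else.
\<close>

theorem bp_functional_zero:
  fixes W :: "(real^'n) set"
  assumes L: "bp_functional W L" and W: "open W"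
    and schwartz: "\<And>\<phi>. \<phi> \<in> schwartz \<Longrightarrow> \<phi> \<in> bdd_supp W \<Longrightarrow> closure {x. \<phi> x \<noteq> 0} \<subseteq> W \<Longrightarrow> L \<phi> = 0"
    and f: "f \<in> bdd_supp W"
  shows "L f = 0"
proof -
  have boxes: "L (indicator (box c d)) = 0" if "box c d \<subseteq> W" for c d
  proof -
    have b: "bump c d (Suc k) \<in> bdd_supp W" for k
    proof -
      have "bump c d (Suc k) x = 0" if "x \<notin> W" for x
        using that \<open>box c d \<subseteq> W\<close> bump_support[of c d k] closure_subset[of "{x. bump c d (Suc k) x \<noteq> 0}"]
        by blast
      then show ?thesis
        using norm_bump_le_1[of c d "Suc k"] schwartz_measurable[OF bump_schwartz[of c d "Suc k"]]
        unfolding bdd_supp_def by blast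
    qed
    have "(\<lambda>k. L (bump c d (Suc k))) \<longlonglongrightarrow> L (indicator (box c d))"
      by (rule bp_functional_limit[OF L b indicator_bdd_supp[OF _ that] norm_bump_le_1 bump_tendsto_indicator]) simp
    moreover have "L (bump c d (Suc k)) = 0" for k
      using that bump_support by (intro schwartz b bump_schwartz) blast
    ultimately show ?thesis
      by (simp add: LIMSEQ_const_iff)
  qed
  have borel: "L (indicator A) = 0" if A: "A \<in> sets borel" "A \<subseteq> W" for A
  proof -
    obtain \<D> where D: "countable \<D>" "\<D> \<subseteq> Pow W" "\<And>X. X \<in> \<D> \<Longrightarrow> \<exists>a b. X = box a b" "\<Union>\<D> = W"
      using open_countable_Union_open_box[OF W] by metis
    \<comment> \<open>The empty box guarantees a nonempty family to enumerate.\<close>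
    define P where "P = from_nat_into (insert (box 0 0) \<D>)"
    have P: "range P = insert (box 0 0) \<D>"
      unfolding P_def using D(1) by (intro range_from_nat_into) auto
    have Pbox: "\<exists>a b. P i = box a b \<and> box a b \<subseteq> W" for i
    proof -
      have "P i \<in> insert (box 0 0) \<D>" using P by auto
      then consider "P i = box 0 0" | "P i \<in> \<D>" by auto
      then show ?thesis
      proof cases
        case 1
        have "box 0 (0::real^'n) \<subseteq> W" by (simp add: box_eq_empty)
        then show ?thesis using 1 by metis
      next
        case 2
        then have "P i \<subseteq> W" using D(2) by auto
        then show ?thesis using D(3)[OF 2] by metis
      qed
    qed
    have PW: "(\<Union>i. P i) = W"
      using P D(4) by (simp add: box_eq_empty)
    have Pm: "P i \<in> sets borel" for i
      using Pbox[of i] by auto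
    have "disjointed P i \<in> sets borel" for i
      using sets.range_disjointed_sets[of P borel] Pm by auto
    then have [measurable]: "A \<inter> disjointed P i \<in> sets borel" for i
      using A by auto
    have "L (indicator (\<Union>i. A \<inter> disjointed P i)) = 0"
    proof (rule bp_functional_disjoint_UN[OF L])
      show "disjoint_family (\<lambda>i. A \<inter> disjointed P i)"
        using disjoint_family_disjointed[of P] by (auto simp: disjoint_family_on_def)
      show "L (indicator (A \<inter> disjointed P i)) = 0" for i
      proof -
        obtain a b where ab: "P i = box a b" "box a b \<subseteq> W" using Pbox by blast
        have "(A \<inter> disjointed P i) \<inter> box a b = A \<inter> disjointed P i"
          using disjointed_subset[of P i] ab by auto
        then show ?thesis
          using bp_functional_zero_on_boxes[OF L boxes ab(2), of "A \<inter> disjointed P i"] by simp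
      qed
    qed (use A in auto)
    moreover have "(\<Union>i. A \<inter> disjointed P i) = A"
      using UN_disjointed_eq[of P] PW A(2) by auto
    ultimately show ?thesis by simp
  qed
  have simple: "L h = 0" if h: "simple_function lborel h" "h \<in> bdd_supp W" for h
  proof -
    have fin: "finite (range h)"
      using simple_functionD(1)[OF h(1)] by simp
    have meas: "h -` {y} \<in> sets borel" for y
      using simple_functionD(2)[OF h(1), of "{y}"] by simp
    let ?R = "range h - {0}"
    have sub: "h -` {y} \<subseteq> W" if "y \<in> ?R" for y
      using that h(2) by (auto simp: bdd_supp_def)
    have "h = (\<lambda>x. \<Sum>y\<in>?R. y * indicator (h -` {y}) x)"
    proof
      fix x
      have "(\<Sum>y\<in>?R. y * indicator (h -` {y}) x) = (\<Sum>y\<in>?R. if y = h x then h x else 0)"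
        by (intro sum.cong) (auto simp: indicator_def)
      also have "\<dots> = h x"
        using fin by (auto simp: sum.delta)
      finally show "h x = (\<Sum>y\<in>?R. y * indicator (h -` {y}) x)" ..
    qed
    then have "L h = L (\<lambda>x. \<Sum>y\<in>?R. y * indicator (h -` {y}) x)"
      by simp
    also have "\<dots> = (\<Sum>y\<in>?R. y * L (indicator (h -` {y})))"
      using fin sub meas by (intro bp_functional_sum[OF L]) (auto intro!: indicator_bdd_supp)
    also have "\<dots> = 0"
      using sub meas by (simp add: borel)
    finally show ?thesis .
  qed
  obtain M where M: "\<And>x. norm (f x) \<le> M" using f by (auto simp: bdd_supp_def)
  obtain F where F: "\<And>i. simple_function lborel (F i)" "\<And>x. (\<lambda>i. F i x) \<longlonglongrightarrow> f x"
    "\<And>i x. norm (F i x) \<le> 2 * norm (f x)"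
    using borel_measurable_implies_sequence_metric[of f lborel 0] f by (auto simp: bdd_supp_def)
  have FM: "norm (F i x) \<le> 2 * M" for i x
    using F(3)[of i x] M[of x] by linarith
  have FW: "F i \<in> bdd_supp W" for i
  proof -
    have "F i x = 0" if "x \<notin> W" for x
      using that f F(3)[of i x] by (auto simp: bdd_supp_def)
    then show ?thesis
      using FM borel_measurable_simple_function[OF F(1)[of i]] by (auto simp: bdd_supp_def)
  qed
  have "(\<lambda>i. L (F i)) \<longlonglongrightarrow> L f"
    by (rule bp_functional_limit[OF L FW f FM F(2)])
  then show ?thesis
    using simple[OF F(1) FW] by (simp add: LIMSEQ_const_iff)
qed

section \<open>Lebesgue norms and bounded operators\<close>

lemma bounded_borel_fmeasurable:
  fixes A :: "(real^'n) set"
  assumes "bounded A" "A \<in> sets borel"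
  shows "A \<in> fmeasurable lborel"
  using assms emeasure_bounded_finite[OF assms(1)] by (auto simp: fmeasurable_def)

lemma ball_fmeasurable: "ball z r \<in> fmeasurable lborel" "cball z r \<in> fmeasurable lborel" for z :: "real^'n"
  by (auto intro!: bounded_borel_fmeasurable)

lemma measure_cball_cart:
  "0 \<le> r \<Longrightarrow> measure lborel (cball (z::real^'n) r) = unit_ball_vol CARD('n) * r ^ CARD('n)"
  using content_cball[of r z] by simp

lemma measure_ball_cart:
  "0 \<le> r \<Longrightarrow> measure lborel (ball (z::real^'n) r) = unit_ball_vol CARD('n) * r ^ CARD('n)"
  using content_ball[of r z] by simp

lemma ball_measure_pos: "0 < r \<Longrightarrow> 0 < measure lborel (ball (z::real^'n) r)"
  by (simp add: measure_ball_cart)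

lemma Lp_norm_nonneg: "0 \<le> Lp_norm p f"
  by (simp add: Lp_norm_def)

lemma Lp_measurable: "f \<in> Lp p \<Longrightarrow> f \<in> borel_measurable borel"
  by (simp add: Lp_def)

lemma le_one_plus_powr: "0 \<le> t \<Longrightarrow> 1 \<le> s \<Longrightarrow> t \<le> 1 + t powr s" for t s :: real
proof (cases "t \<le> 1")
  case False
  assume "1 \<le> s"
  then have "t powr 1 \<le> t powr s" using False by (intro powr_mono) auto
  then show ?thesis using False by simp
qed (simp add: add_increasing2)

lemma Lp_set_integrable:
  assumes "h \<in> Lp s" "1 \<le> s" "A \<in> fmeasurable lborel"
  shows "set_integrable lborel A h"
proof -
  have [measurable]: "h \<in> borel_measurable borel" "A \<in> sets borel"
    using assms by (auto simp: Lp_measurable fmeasurable_def)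
  have "integrable lborel (indicator A :: _ \<Rightarrow> real)" "integrable lborel (\<lambda>x. norm (h x) powr s)"
    using assms by (auto simp: fmeasurable_def Lp_def)
  then have "integrable lborel (\<lambda>x. indicator A x + norm (h x) powr s)"
    by (rule Bochner_Integration.integrable_add)
  then show ?thesis
    unfolding set_integrable_def
    by (rule Bochner_Integration.integrable_bound)
      (use assms(2) in \<open>auto simp: indicator_def le_one_plus_powr\<close>)
qed

text \<open>
  Hoelder's inequality against an indicator.  Young's inequality is applied to \<open>|h| / N\<close> and \<open>1\<close>,
  where \<open>N\<^sup>s\<close> is the mean of \<open>|h|\<^sup>s\<close> over \<open>A\<close>, the choice for which the two terms add up to \<open>N |A|\<close>.
\<close>

lemma set_integral_norm_le_Lp_norm:
  assumes "h \<in> Lp s" "1 < s" "A \<in> fmeasurable lborel"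
  shows "(LINT x:A|lborel. norm (h x)) \<le> measure lborel A powr (1 - 1 / s) * Lp_norm s h"
proof -
  have [measurable]: "h \<in> borel_measurable borel" "A \<in> sets borel"
    using assms by (auto simp: Lp_measurable fmeasurable_def)
  have hs: "integrable lborel (\<lambda>x. norm (h x) powr s)"
    using assms by (auto simp: Lp_def)
  have iA: "integrable lborel (indicator A :: _ \<Rightarrow> real)"
    using assms by (auto simp: fmeasurable_def)
  have hA: "integrable lborel (\<lambda>x. indicator A x * norm (h x))"
    using set_integrable_norm[OF Lp_set_integrable[of h s A]] assms by (simp add: set_integrable_def)
  define I where "I = (LINT x|lborel. norm (h x) powr s)"
  define m where "m = measure lborel A"
  have "0 \<le> I" "0 \<le> m" by (auto simp: I_def m_def)
  consider "m = 0" | "I = 0" | "0 < m" "0 < I" using \<open>0 \<le> I\<close> \<open>0 \<le> m\<close> by fastforce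
  then show ?thesis
  proof cases
    case 1
    then have "A \<in> null_sets lborel"
      using assms(3) by (auto simp: m_def null_sets_def fmeasurable_def measure_def enn2real_eq_0_iff)
    then have "AE x in lborel. indicator A x * norm (h x) = 0"
      by (intro eventually_mono[OF AE_not_in]) auto
    then have "(LINT x:A|lborel. norm (h x)) = 0"
      unfolding set_lebesgue_integral_def by (auto intro!: integral_eq_zero_AE)
    then show ?thesis by (simp add: Lp_norm_nonneg)
  next
    case 2
    then have "AE x in lborel. norm (h x) powr s = 0"
      using integral_nonneg_eq_0_iff_AE[OF hs] by (simp add: I_def)
    then have "AE x in lborel. indicator A x * norm (h x) = 0"
      by eventually_elim simp
    then have "(LINT x:A|lborel. norm (h x)) = 0"
      unfolding set_lebesgue_integral_def by (auto intro!: integral_eq_zero_AE)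
    then show ?thesis by (simp add: Lp_norm_nonneg)
  next
    case 3
    define N where "N = (I / m) powr (1 / s)"
    have "0 < N" using 3 by (simp add: N_def)
    have Ns: "N powr s = I / m"
      using 3 assms(2) by (simp add: N_def powr_powr)
    have young: "norm (h x) \<le> norm (h x) powr s * (N / (s * N powr s)) + N * (1 - 1 / s)" for x
    proof -
      have "norm (h x) / N * 1 \<le> (norm (h x) / N) powr s / s + 1 powr (s / (s - 1)) / (s / (s - 1))"
        using assms(2) \<open>0 < N\<close> by (intro Youngs_inequality) (auto simp: field_simps)
      also have "\<dots> = norm (h x) powr s / (s * N powr s) + (1 - 1 / s)"
        using assms(2) \<open>0 < N\<close> by (simp add: powr_divide field_simps)
      finally show ?thesis
        using \<open>0 < N\<close> by (simp add: field_simps)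
    qed
    have "(LINT x:A|lborel. norm (h x)) = (LINT x|lborel. indicator A x * norm (h x))"
      by (simp add: set_lebesgue_integral_def)
    also have "\<dots> \<le> (LINT x|lborel. norm (h x) powr s * (N / (s * N powr s)) + indicator A x * (N * (1 - 1 / s)))"
    proof (rule integral_mono[OF hA])
      show "integrable lborel (\<lambda>x. norm (h x) powr s * (N / (s * N powr s)) + indicator A x * (N * (1 - 1 / s)))"
        using hs iA by (intro Bochner_Integration.integrable_add integrable_mult_left) auto
      show "indicator A x * norm (h x) \<le> norm (h x) powr s * (N / (s * N powr s)) + indicator A x * (N * (1 - 1 / s))" for x
        using young[of x] assms(2) \<open>0 < N\<close> by (cases "x \<in> A") auto
    qed
    also have "\<dots> = I * (N / (s * N powr s)) + m * (N * (1 - 1 / s))"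
      using hs iA by (simp add: I_def m_def Bochner_Integration.integral_add)
    also have "\<dots> = m * N"
      using 3 assms(2) \<open>0 < N\<close> unfolding Ns by (simp add: field_simps)
    also have "\<dots> = m powr (1 - 1 / s) * I powr (1 / s)"
      using 3 by (simp add: N_def powr_divide powr_diff)
    finally show ?thesis by (simp add: m_def I_def Lp_norm_def)
  qed
qed

lemma bdd_supp_powr_bound:
  assumes "f \<in> bdd_supp W" "\<And>x. norm (f x) \<le> M" "0 < p"
  shows "norm (f x) powr p \<le> M powr p * indicator W x"
  using assms by (auto simp: bdd_supp_def indicator_def intro: powr_mono2)

lemma bdd_supp_Lp:
  assumes f: "f \<in> bdd_supp W" and W: "W \<in> fmeasurable lborel" and p: "0 < p"
  shows "f \<in> Lp p"
proof -
  obtain M where M: "\<And>x. norm (f x) \<le> M" using f by (auto simp: bdd_supp_def)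
  have [measurable]: "f \<in> borel_measurable borel" using f by (auto simp: bdd_supp_def)
  have "integrable lborel (\<lambda>x. norm (f x) powr p)"
    by (rule Bochner_Integration.integrable_bound[where f = "\<lambda>x. M powr p * indicator W x"])
      (use W bdd_supp_powr_bound[OF f M p] in \<open>auto simp: fmeasurable_def\<close>)
  then show ?thesis by (simp add: Lp_def)
qed

lemma Lp_norm_bdd_supp_le:
  assumes f: "f \<in> bdd_supp W" and W: "W \<in> fmeasurable lborel" and p: "0 < p"
    and M: "\<And>x. norm (f x) \<le> M"
  shows "Lp_norm p f \<le> M * measure lborel W powr (1 / p)"
proof -
  have "0 \<le> M" using M norm_ge_zero order_trans by blast
  have "(LINT x|lborel. norm (f x) powr p) \<le> (LINT x|lborel. M powr p * indicator W x)"
    using bdd_supp_Lp[OF f W p] W bdd_supp_powr_bound[OF f M p]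
    by (intro integral_mono) (auto simp: fmeasurable_def Lp_def)
  also have "\<dots> = M powr p * measure lborel W" using W by (simp add: fmeasurable_def)
  finally have "Lp_norm p f \<le> (M powr p * measure lborel W) powr (1 / p)"
    unfolding Lp_norm_def using p by (intro powr_mono2) auto
  also have "\<dots> = M * measure lborel W powr (1 / p)"
    using \<open>0 \<le> M\<close> p by (simp add: powr_mult powr_powr)
  finally show ?thesis .
qed

lemma bounded_convergence_Lp:
  assumes F: "\<And>k::nat. F k \<in> bdd_supp W" and f: "f \<in> bdd_supp W"
    and M: "\<And>k x. norm (F k x) \<le> M" and lim: "\<And>x. (\<lambda>k. F k x) \<longlonglongrightarrow> f x"
    and W: "W \<in> fmeasurable lborel" and p: "0 < p"
  shows "(\<lambda>k. Lp_norm p (\<lambda>x. F k x - f x)) \<longlonglongrightarrow> 0"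
proof -
  have [measurable]: "f \<in> borel_measurable borel" "\<And>k. F k \<in> borel_measurable borel"
    using f F by (auto simp: bdd_supp_def)
  have f_le: "norm (f x) \<le> M" for x
    by (rule LIMSEQ_le_const2[OF tendsto_norm[OF lim]]) (use M in auto)
  have diff: "(\<lambda>x. F k x - f x) \<in> bdd_supp W" for k
    using bdd_supp_lincomb[OF F f, of 1 k "-1"] by simp
  have "norm (F k x - f x) \<le> 2 * M" for k x
    using norm_triangle_ineq4[of "F k x" "f x"] M[of k x] f_le[of x] by linarith
  from bdd_supp_powr_bound[OF diff this p]
  have bound: "norm (F k x - f x) powr p \<le> (2 * M) powr p * indicator W x" for k x .
  have "(\<lambda>k. LINT x|lborel. norm (F k x - f x) powr p) \<longlonglongrightarrow> (LINT x::real^'a|lborel. 0)"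
  proof (rule integral_dominated_convergence[where w = "\<lambda>x. (2 * M) powr p * indicator W x"])
    show "integrable lborel (\<lambda>x. (2 * M) powr p * indicator W x)"
      using W by (simp add: fmeasurable_def)
    show "AE x in lborel. (\<lambda>k. norm (F k x - f x) powr p) \<longlonglongrightarrow> 0"
      using tendsto_powr'[OF tendsto_norm_zero[OF LIM_zero[OF lim]] tendsto_const[of p]] p by auto
  qed (use bound in auto)
  then have "(\<lambda>k. (LINT x|lborel. norm (F k x - f x) powr p) powr (1 / p)) \<longlonglongrightarrow> 0 powr (1 / p)"
    using p by (intro tendsto_powr') auto
  then show ?thesis using p by (simp add: Lp_norm_def)
qed

text \<open>
  The data of a bounded extension between Lebesgue spaces, with its constant made explicit and
  nonnegative.  The ranges of the exponents are included because every use depends on them.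
\<close>

definition Lp_bounded ::
    "real \<Rightarrow> real \<Rightarrow> real \<Rightarrow> ((real^'n \<Rightarrow> complex) \<Rightarrow> real^'n \<Rightarrow> complex) \<Rightarrow> bool" where
  "Lp_bounded C p s U \<longleftrightarrow>
     0 \<le> C \<and> 0 < p \<and> 1 < s \<and> (\<forall>f\<in>Lp p. U f \<in> Lp s \<and> Lp_norm s (U f) \<le> C * Lp_norm p f) \<and>
     (\<forall>f\<in>Lp p. \<forall>g\<in>Lp p. \<forall>a b.
        AE x in lborel. U (\<lambda>x. a * f x + b * g x) x = a * U f x + b * U g x)"

lemma extends_LpE:
  assumes "extends_Lp p s T" "0 < p" "1 < s"
  obtains U C where "Lp_bounded C p s U" "\<forall>f\<in>schwartz. represents (U f) (T f)"
proof -
  obtain U C where U: "\<forall>f\<in>Lp p. U f \<in> Lp s"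
     "\<forall>f\<in>Lp p. \<forall>g\<in>Lp p. \<forall>a b.
        AE x in lborel. U (\<lambda>x. a * f x + b * g x) x = a * U f x + b * U g x"
     "\<forall>f\<in>Lp p. Lp_norm s (U f) \<le> C * Lp_norm p f"
     "\<forall>f\<in>schwartz. represents (U f) (T f)"
    using assms(1) by (auto simp: extends_Lp_def)
  have "Lp_norm s (U f) \<le> max 0 C * Lp_norm p f" if "f \<in> Lp p" for f
    using U(3) that by (intro order_trans[OF _ mult_right_mono[of C "max 0 C"]]) (auto simp: Lp_norm_nonneg)
  then have "Lp_bounded (max 0 C) p s U"
    using U(1,2) assms by (simp add: Lp_bounded_def)
  then show thesis using that U(4) by blast
qed

context
  fixes C p s :: real and U :: "(real^'n \<Rightarrow> complex) \<Rightarrow> real^'n \<Rightarrow> complex"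
  assumes U: "Lp_bounded C p s U"
begin

lemma Lp_bounded_in: "f \<in> Lp p \<Longrightarrow> U f \<in> Lp s"
  and Lp_bounded_norm: "f \<in> Lp p \<Longrightarrow> Lp_norm s (U f) \<le> C * Lp_norm p f"
  and Lp_bounded_linear: "f \<in> Lp p \<Longrightarrow> g \<in> Lp p \<Longrightarrow>
    AE x in lborel. U (\<lambda>x. a * f x + b * g x) x = a * U f x + b * U g x"
  and Lp_bounded_pos: "0 \<le> C" "0 < p" "1 < s"
  using U unfolding Lp_bounded_def by auto

lemma Lp_bounded_diff:
  assumes "f \<in> Lp p" "g \<in> Lp p"
  shows "AE x in lborel. U f x - U g x = U (\<lambda>x. f x - g x) x"
  using Lp_bounded_linear[OF assms, of 1 "-1"] by auto

text \<open>By linearity it is enough that the image of a null function has norm zero.\<close>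

lemma Lp_bounded_cong_AE:
  assumes f: "f \<in> Lp p" and g: "g \<in> Lp p" and eq: "AE x in lborel. f x = g x"
  shows "AE x in lborel. U f x = U g x"
proof -
  let ?d = "\<lambda>x. f x - g x"
  have [measurable]: "f \<in> borel_measurable borel" "g \<in> borel_measurable borel"
    using f g by (auto simp: Lp_measurable)
  have d0: "AE x in lborel. norm (?d x) powr p = 0" using eq by eventually_elim simp
  have "integrable lborel (\<lambda>x. norm (?d x) powr p)"
    using d0 by (subst integrable_cong_AE[where g = "\<lambda>_. 0"]) auto
  then have dLp: "?d \<in> Lp p" by (simp add: Lp_def)
  have "Lp_norm p ?d = 0"
    using integral_eq_zero_AE[OF d0] Lp_bounded_pos by (simp add: Lp_norm_def)
  then have "Lp_norm s (U ?d) = 0"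
    using Lp_bounded_norm[OF dLp] Lp_norm_nonneg[of s "U ?d"] by simp
  then have "(LINT x|lborel. norm (U ?d x) powr s) = 0"
    using Lp_bounded_pos by (simp add: Lp_norm_def)
  moreover have "integrable lborel (\<lambda>x. norm (U ?d x) powr s)"
    using Lp_bounded_in[OF dLp] by (simp add: Lp_def)
  ultimately have "AE x in lborel. norm (U ?d x) powr s = 0"
    using integral_nonneg_eq_0_iff_AE[of lborel "\<lambda>x. norm (U ?d x) powr s"] by simp
  then show ?thesis
    using Lp_bounded_diff[OF f g] by eventually_elim auto
qed

lemma Lp_bounded_set_integral:
  assumes f: "f \<in> bdd_supp W" "\<And>x. norm (f x) \<le> M" and W: "W \<in> fmeasurable lborel"
    and A: "A \<in> fmeasurable lborel"
  shows "(LINT x:A|lborel. norm (U f x)) \<le>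
    C * M * measure lborel A powr (1 - 1 / s) * measure lborel W powr (1 / p)"
proof -
  have fp: "f \<in> Lp p" by (rule bdd_supp_Lp[OF f(1) W Lp_bounded_pos(2)])
  have "(LINT x:A|lborel. norm (U f x)) \<le> measure lborel A powr (1 - 1 / s) * Lp_norm s (U f)"
    by (rule set_integral_norm_le_Lp_norm[OF Lp_bounded_in[OF fp] Lp_bounded_pos(3) A])
  also have "\<dots> \<le> measure lborel A powr (1 - 1 / s) * (C * (M * measure lborel W powr (1 / p)))"
    using Lp_norm_bdd_supp_le[OF f(1) W Lp_bounded_pos(2) f(2)] Lp_bounded_norm[OF fp] Lp_bounded_pos(1)
    by (intro mult_left_mono order_trans[OF Lp_bounded_norm[OF fp]]) auto
  finally show ?thesis by (simp add: mult_ac)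
qed

end

lemma norm_mult_bdd_supp_le:
  assumes "g \<in> bdd_supp W" "\<And>x. norm (g x) \<le> N"
  shows "norm (h x * g x) \<le> N * (indicator W x * norm (h x))"
  using assms(1) mult_left_mono[OF assms(2)[of x], of "norm (h x)"]
  by (cases "x \<in> W") (auto simp: norm_mult bdd_supp_def mult.commute[of N])

lemma pairing_integrable:
  assumes h: "h \<in> Lp s" "1 < s" and g: "g \<in> bdd_supp W" and W: "W \<in> fmeasurable lborel"
  shows "integrable lborel (\<lambda>x. h x * g x)"
proof -
  obtain N where N: "\<And>x. norm (g x) \<le> N" using g by (auto simp: bdd_supp_def)
  have [measurable]: "h \<in> borel_measurable borel" "g \<in> borel_measurable borel"
    using h g by (auto simp: Lp_measurable bdd_supp_def)
  have "integrable lborel (\<lambda>x. N * (indicator W x * norm (h x)))"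
    using set_integrable_norm[OF Lp_set_integrable[of h s W]] h W by (simp add: set_integrable_def)
  then show ?thesis
    by (rule Bochner_Integration.integrable_bound)
      (measurable, unfold real_norm_def, intro AE_I2 order_trans[OF norm_mult_bdd_supp_le[OF g N] abs_ge_self])
qed

lemma pairing_le:
  assumes h: "h \<in> Lp s" "1 < s" and g: "g \<in> bdd_supp W" and W: "W \<in> fmeasurable lborel"
    and N: "\<And>x. norm (g x) \<le> N"
  shows "norm (LINT x|lborel. h x * g x) \<le> N * measure lborel W powr (1 - 1 / s) * Lp_norm s h"
proof -
  have "0 \<le> N" using N norm_ge_zero order_trans by blast
  have i: "integrable lborel (\<lambda>x. indicator W x * norm (h x))"
    using set_integrable_norm[OF Lp_set_integrable[of h s W]] h W by (simp add: set_integrable_def)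
  have "norm (LINT x|lborel. h x * g x) \<le> (LINT x|lborel. norm (h x * g x))"
    by (rule integral_norm_bound)
  also have "\<dots> \<le> (LINT x|lborel. N * (indicator W x * norm (h x)))"
    using pairing_integrable[OF h g W] i
    by (intro integral_mono norm_mult_bdd_supp_le[OF g N]) auto
  also have "\<dots> = N * (LINT x:W|lborel. norm (h x))"
    by (simp add: set_lebesgue_integral_def)
  also have "\<dots> \<le> N * (measure lborel W powr (1 - 1 / s) * Lp_norm s h)"
    by (intro mult_left_mono set_integral_norm_le_Lp_norm h W \<open>0 \<le> N\<close>)
  finally show ?thesis by (simp add: mult.assoc)
qed

lemma pairing_bp_functional_right:
  assumes h: "h \<in> Lp s" "1 < s" and W: "W \<in> fmeasurable lborel"
  shows "bp_functional W (\<lambda>g. LINT x|lborel. h x * g x)"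
  unfolding bp_functional_def bp_continuous_def
proof (intro conjI ballI allI impI)
  fix f g a b assume "f \<in> bdd_supp W" "g \<in> bdd_supp W"
  then have "integrable lborel (\<lambda>x. h x * f x)" "integrable lborel (\<lambda>x. h x * g x)"
    using pairing_integrable[OF h _ W] by auto
  then have "(LINT x|lborel. a * (h x * f x) + b * (h x * g x)) = a * (LINT x|lborel. h x * f x) + b * (LINT x|lborel. h x * g x)"
    by (subst Bochner_Integration.integral_add) auto
  then show "(LINT x|lborel. h x * (a * f x + b * g x)) = a * (LINT x|lborel. h x * f x) + b * (LINT x|lborel. h x * g x)"
    by (simp add: algebra_simps)
next
  fix F :: "nat \<Rightarrow> _" and f M
  assume F: "\<forall>k. F k \<in> bdd_supp W" and f: "f \<in> bdd_supp W" and M: "\<forall>k x. norm (F k x) \<le> M"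
    and lim: "\<forall>x. (\<lambda>k. F k x) \<longlonglongrightarrow> f x"
  have [measurable]: "h \<in> borel_measurable borel" "f \<in> borel_measurable borel" "\<And>k. F k \<in> borel_measurable borel"
    using h f F by (auto simp: Lp_measurable bdd_supp_def)
  show "(\<lambda>k. LINT x|lborel. h x * F k x) \<longlonglongrightarrow> (LINT x|lborel. h x * f x)"
  proof (rule integral_dominated_convergence[where w = "\<lambda>x. M * (indicator W x * norm (h x))"])
    show "integrable lborel (\<lambda>x. M * (indicator W x * norm (h x)))"
      using set_integrable_norm[OF Lp_set_integrable[of h s W]] h W by (simp add: set_integrable_def)
    show "AE x in lborel. (\<lambda>k. h x * F k x) \<longlonglongrightarrow> h x * f x"
      using lim by (auto intro!: tendsto_mult)
    show "AE x in lborel. norm (h x * F k x) \<le> M * (indicator W x * norm (h x))" for k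
      using F M by (intro AE_I2 norm_mult_bdd_supp_le) auto
  qed auto
qed

text \<open>
  Bounded convergence on a set of finite measure implies convergence in \<open>L\<^sup>p\<close>, which the operator
  carries over to \<open>L\<^sup>s\<close>, and there the pairing with \<open>g\<close> is continuous.
\<close>

lemma pairing_bp_functional_left:
  assumes U: "Lp_bounded C p s U" and g: "g \<in> bdd_supp W'"
    and W: "W \<in> fmeasurable lborel" and W': "W' \<in> fmeasurable lborel"
  shows "bp_functional W (\<lambda>f. LINT x|lborel. U f x * g x)"
  unfolding bp_functional_def bp_continuous_def
proof (intro conjI ballI allI impI)
  note pos = Lp_bounded_pos[OF U]
  note Lp = bdd_supp_Lp[OF _ W pos(2)]
  have meas: "f \<in> bdd_supp W \<Longrightarrow> U f \<in> borel_measurable borel" for f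
    using Lp_bounded_in[OF U Lp] Lp_measurable by blast
  have [measurable]: "g \<in> borel_measurable borel"
    using g by (auto simp: bdd_supp_def)
  {
    fix f h a b assume f: "f \<in> bdd_supp W" and h: "h \<in> bdd_supp W"
    then have i: "integrable lborel (\<lambda>x. U f x * g x)" "integrable lborel (\<lambda>x. U h x * g x)"
      using pairing_integrable[OF Lp_bounded_in[OF U Lp] pos(3) g W'] by auto
    have "(LINT x|lborel. U (\<lambda>x. a * f x + b * h x) x * g x) = (LINT x|lborel. a * (U f x * g x) + b * (U h x * g x))"
      using Lp_bounded_linear[OF U Lp[OF f] Lp[OF h], of a b] meas[OF f] meas[OF h]
        meas[OF bdd_supp_lincomb[OF f h]]
      by (intro integral_cong_AE) (auto simp: algebra_simps)
    also have "\<dots> = a * (LINT x|lborel. U f x * g x) + b * (LINT x|lborel. U h x * g x)"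
      using i by (subst Bochner_Integration.integral_add) auto
    finally show "(LINT x|lborel. U (\<lambda>x. a * f x + b * h x) x * g x) =
      a * (LINT x|lborel. U f x * g x) + b * (LINT x|lborel. U h x * g x)" .
  }
  fix F :: "nat \<Rightarrow> _" and f M
  assume F: "\<forall>k. F k \<in> bdd_supp W" and f: "f \<in> bdd_supp W" and M: "\<forall>k x. norm (F k x) \<le> M"
    and lim: "\<forall>x. (\<lambda>k. F k x) \<longlonglongrightarrow> f x"
  obtain N where N: "\<And>x. norm (g x) \<le> N" using g by (auto simp: bdd_supp_def)
  have "0 \<le> N" using N norm_ge_zero order_trans by blast
  define B where "B = N * measure lborel W' powr (1 - 1 / s) * C"
  have le: "norm ((LINT x|lborel. U (F k) x * g x) - (LINT x|lborel. U f x * g x)) \<le> B * Lp_norm p (\<lambda>x. F k x - f x)" for k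
  proof -
    have Fk: "F k \<in> bdd_supp W" using F by auto
    have d: "(\<lambda>x. F k x - f x) \<in> bdd_supp W"
      using bdd_supp_lincomb[OF Fk f, of 1 "-1"] by simp
    have "(LINT x|lborel. U (F k) x * g x) - (LINT x|lborel. U f x * g x) = (LINT x|lborel. U (F k) x * g x - U f x * g x)"
      using pairing_integrable[OF Lp_bounded_in[OF U Lp] pos(3) g W'] Fk f
      by (subst Bochner_Integration.integral_diff) auto
    also have "\<dots> = (LINT x|lborel. U (\<lambda>x. F k x - f x) x * g x)"
      using Lp_bounded_diff[OF U Lp[OF Fk] Lp[OF f]] meas[OF Fk] meas[OF f] meas[OF d]
      by (intro integral_cong_AE) (auto simp: left_diff_distrib[symmetric])
    also have "norm \<dots> \<le> N * measure lborel W' powr (1 - 1 / s) * Lp_norm s (U (\<lambda>x. F k x - f x))"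
      by (rule pairing_le[OF Lp_bounded_in[OF U Lp[OF d]] pos(3) g W' N])
    also have "\<dots> \<le> N * measure lborel W' powr (1 - 1 / s) * (C * Lp_norm p (\<lambda>x. F k x - f x))"
      using \<open>0 \<le> N\<close> by (intro mult_left_mono Lp_bounded_norm[OF U Lp[OF d]]) auto
    finally show ?thesis by (simp add: B_def mult_ac)
  qed
  have "(\<lambda>k. B * Lp_norm p (\<lambda>x. F k x - f x)) \<longlonglongrightarrow> B * 0"
    using F f M lim W pos by (intro tendsto_mult tendsto_const bounded_convergence_Lp) auto
  note lim0 = this[unfolded mult_zero_right]
  have "(\<lambda>k. (LINT x|lborel. U (F k) x * g x) - (LINT x|lborel. U f x * g x)) \<longlonglongrightarrow> 0"
    by (rule Lim_null_comparison[OF always_eventually[OF allI[OF le]] lim0])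
  then show "(\<lambda>k. LINT x|lborel. U (F k) x * g x) \<longlonglongrightarrow> (LINT x|lborel. U f x * g x)"
    by (rule LIM_zero_cancel)
qed

text \<open>
  On Schwartz functions this is the definition of the adjoint.  Both sides are continuous in each
  argument separately, so the identity extends in one argument after the other.
\<close>

lemma bdd_supp_transpose:
  fixes T :: "(real^'n) operator"
  assumes U: "Lp_bounded C p s U" "\<forall>f\<in>schwartz. represents (U f) (T f)"
    and V: "Lp_bounded C' p' s' V" "\<forall>f\<in>schwartz. represents (V f) (adjoint_operator T f)"
    and f: "f \<in> bdd_supp W" and g: "g \<in> bdd_supp W'"
    and W: "W \<in> fmeasurable lborel" "open W" and W': "W' \<in> fmeasurable lborel" "open W'"
  shows "(LINT x|lborel. U f x * g x) = (LINT x|lborel. V g x * f x)"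
proof -
  have 1: "(LINT x|lborel. U \<phi> x * \<psi> x) - (LINT x|lborel. V \<psi> x * \<phi> x) = 0"
    if "\<phi> \<in> schwartz" "\<psi> \<in> schwartz" for \<phi> \<psi>
    using bspec[OF U(2) that(1)] bspec[OF V(2) that(2)] that
    by (auto simp: represents_def adjoint_operator_def)
  have VLp: "\<psi> \<in> bdd_supp W' \<Longrightarrow> V \<psi> \<in> Lp s'" for \<psi>
    by (intro Lp_bounded_in[OF V(1)] bdd_supp_Lp[OF _ W'(1)] Lp_bounded_pos[OF V(1)])
  have ULp: "\<psi> \<in> bdd_supp W \<Longrightarrow> U \<psi> \<in> Lp s" for \<psi>
    by (intro Lp_bounded_in[OF U(1)] bdd_supp_Lp[OF _ W(1)] Lp_bounded_pos[OF U(1)])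
  have 2: "(LINT x|lborel. U f x * \<psi> x) - (LINT x|lborel. V \<psi> x * f x) = 0"
    if "\<psi> \<in> schwartz" "\<psi> \<in> bdd_supp W'" for \<psi>
    by (rule bp_functional_zero[OF bp_functional_diff[OF
          pairing_bp_functional_left[OF U(1) that(2) W(1) W'(1)]
          pairing_bp_functional_right[OF VLp[OF that(2)] Lp_bounded_pos(3)[OF V(1)] W(1)]] W(2) _ f])
      (use 1 that in auto)
  have "(LINT x|lborel. U f x * g x) - (LINT x|lborel. V g x * f x) = 0"
    by (rule bp_functional_zero[OF bp_functional_diff[OF
          pairing_bp_functional_right[OF ULp[OF f] Lp_bounded_pos(3)[OF U(1)] W'(1)]
          pairing_bp_functional_left[OF V(1) f W'(1) W(1)]] W'(2) _ g])
      (use 2 in auto)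
  then show ?thesis by simp
qed

section \<open>The kernel away from the support\<close>

lemma norming_function:
  assumes h[measurable]: "h \<in> borel_measurable borel" and W: "W \<in> sets borel"
  obtains g where "g \<in> bdd_supp W" "\<And>x. norm (g x) \<le> 1"
    "\<And>x. h x * g x = of_real (indicator W x * norm (h x))"
proof
  let ?g = "\<lambda>x. if x \<in> W then cnj (h x) / of_real (norm (h x)) else 0"
  have [measurable]: "(\<lambda>x. cnj (h x)) \<in> borel_measurable borel"
    using measurable_compose[OF h borel_measurable_continuous_onI[OF continuous_on_cnj[OF continuous_on_id]]] .
  show n: "norm (?g x) \<le> 1" for x
    by (simp add: norm_divide)
  have "?g \<in> borel_measurable borel"
    using W by measurable
  then show "?g \<in> bdd_supp W"
    unfolding bdd_supp_def using n by (intro CollectI conjI exI[of _ 1] allI impI) auto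
  show "h x * ?g x = of_real (indicator W x * norm (h x))" for x
    using complex_norm_square[of "h x"] by (cases "h x = 0") (auto simp: power2_eq_square field_simps)
qed

text \<open>Test the difference against its own conjugate phase.\<close>

lemma bdd_supp_pairing_eq_imp_AE:
  assumes h: "h \<in> Lp s" "1 < s" and h': "h' \<in> Lp s'" "1 < s'" and W: "W \<in> fmeasurable lborel"
    and eq: "\<And>g. g \<in> bdd_supp W \<Longrightarrow> (LINT x|lborel. h x * g x) = (LINT x|lborel. h' x * g x)"
  shows "AE x in lborel. x \<in> W \<longrightarrow> h x = h' x"
proof -
  have [measurable]: "h \<in> borel_measurable borel" "h' \<in> borel_measurable borel" "W \<in> sets borel"
    using h h' W by (auto simp: Lp_measurable fmeasurable_def)
  obtain g where g: "g \<in> bdd_supp W" "\<And>x. norm (g x) \<le> 1"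
    "\<And>x. (h x - h' x) * g x = of_real (indicator W x * norm (h x - h' x))"
    by (rule norming_function[of "\<lambda>x. h x - h' x" W]) auto
  have i: "integrable lborel (\<lambda>x. h x * g x)" "integrable lborel (\<lambda>x. h' x * g x)"
    using pairing_integrable[OF h g(1) W] pairing_integrable[OF h' g(1) W] by auto
  have i2: "integrable lborel (\<lambda>x. (h x - h' x) * g x)"
    using Bochner_Integration.integrable_diff[OF i] by (simp add: left_diff_distrib)
  then have i3: "integrable lborel (\<lambda>x. indicator W x * norm (h x - h' x))"
    by (simp only: g(3) complex_of_real_integrable_eq)
  have "(LINT x|lborel. (h x - h' x) * g x) = 0"
    using eq[OF g(1)] Bochner_Integration.integral_diff[OF i] by (simp add: left_diff_distrib)
  then have "(LINT x|lborel. indicator W x * norm (h x - h' x)) = 0"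
    by (simp only: g(3) integral_complex_of_real of_real_eq_0_iff)
  then have "AE x in lborel. indicator W x * norm (h x - h' x) = 0"
    using integral_nonneg_eq_0_iff_AE[OF i3] by simp
  then show ?thesis
    by eventually_elim (auto simp: indicator_def)
qed

text \<open>The kernel is continuous off the diagonal, and one point does not affect measurability.\<close>

lemma kernel_measurable_snd:
  assumes "is_kernel K"
  shows "(\<lambda>y. K x y) \<in> borel_measurable borel"
proof -
  have "continuous_on (- {x}) (\<lambda>y. (\<lambda>(x, y). K x y) (x, y))"
    using assms unfolding is_kernel_def
    by (rule continuous_on_compose2) (auto intro!: continuous_intros)
  then have [measurable]: "(\<lambda>y. indicator (- {x}) y *\<^sub>R K x y) \<in> borel_measurable borel"
    by (intro borel_measurable_continuous_on_indicator) auto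
  have "(\<lambda>y. K x y) = (\<lambda>y. if y = x then K x x else indicator (- {x}) y *\<^sub>R K x y)"
    by (auto simp: fun_eq_iff)
  also have "\<dots> \<in> borel_measurable borel"
    by measurable
  finally show ?thesis .
qed

context
  fixes k :: "real^'n \<Rightarrow> real^'n \<Rightarrow> complex" and B :: real and W :: "(real^'n) set"
  assumes k[measurable]: "(\<lambda>(x, y). k x y) \<in> borel_measurable (borel \<Otimes>\<^sub>M borel)"
    and B: "\<And>x y. norm (k x y) \<le> B" and W: "W \<in> fmeasurable lborel"
begin

lemma bounded_kernel_pointwise_le:
  assumes "f \<in> bdd_supp W" "\<And>y. norm (f y) \<le> M"
  shows "norm (k x y * f y) \<le> B * M * indicator W y"
proof -
  have "0 \<le> B" using B norm_ge_zero order_trans by blast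
  then show ?thesis
    using assms(1) mult_mono[OF B[of x y] assms(2)[of y] _ norm_ge_zero]
    by (cases "y \<in> W") (auto simp: norm_mult bdd_supp_def)
qed

lemma integrable_const_indicator: "integrable lborel (\<lambda>y. D * indicator W y :: real)"
  using W by (simp add: fmeasurable_def)

lemma bounded_kernel_integrable:
  assumes "f \<in> bdd_supp W"
  shows "integrable lborel (\<lambda>y. k x y * f y)"
proof -
  obtain M where M: "\<And>y. norm (f y) \<le> M" using assms by (auto simp: bdd_supp_def)
  have [measurable]: "f \<in> borel_measurable borel" using assms by (auto simp: bdd_supp_def)
  show ?thesis
  proof (rule Bochner_Integration.integrable_bound[OF integrable_const_indicator])
    show "AE y in lborel. norm (k x y * f y) \<le> norm (B * M * indicator W y)"
      unfolding real_norm_def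
      by (intro AE_I2 order_trans[OF bounded_kernel_pointwise_le[OF assms M] abs_ge_self])
  qed measurable
qed

lemma bounded_kernel_measurable:
  assumes "f \<in> bdd_supp W"
  shows "(\<lambda>x. LINT y|lborel. k x y * f y) \<in> borel_measurable borel"
proof -
  have [measurable]: "f \<in> borel_measurable borel" using assms by (auto simp: bdd_supp_def)
  show ?thesis by measurable
qed

lemma bounded_kernel_le:
  assumes f: "f \<in> bdd_supp W" and M: "\<And>y. norm (f y) \<le> M"
  shows "norm (LINT y|lborel. k x y * f y) \<le> B * M * measure lborel W"
proof -
  have "norm (LINT y|lborel. k x y * f y) \<le> (LINT y|lborel. norm (k x y * f y))"
    by (rule integral_norm_bound)
  also have "\<dots> \<le> (LINT y|lborel. B * M * indicator W y)"
    using bounded_kernel_integrable[OF f]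
    by (intro integral_mono bounded_kernel_pointwise_le[OF f M] integrable_const_indicator integrable_norm)
  finally show ?thesis using W by (simp add: fmeasurable_def)
qed

lemma bounded_kernel_bp_functional:
  assumes W': "W' \<in> fmeasurable lborel" and g: "g \<in> bdd_supp W'"
  shows "bp_functional W (\<lambda>f. LINT x|lborel. (LINT y|lborel. k x y * f y) * g x)"
  unfolding bp_functional_def bp_continuous_def
proof (intro conjI ballI allI impI)
  obtain N where N: "\<And>x. norm (g x) \<le> N" using g by (auto simp: bdd_supp_def)
  have [measurable]: "g \<in> borel_measurable borel" using g by (auto simp: bdd_supp_def)
  have "0 \<le> N" using N norm_ge_zero order_trans by blast
  have bound: "norm ((LINT y|lborel. k x y * f y) * g x) \<le> B * M * measure lborel W * N * indicator W' x"
    if f: "f \<in> bdd_supp W" "\<And>y. norm (f y) \<le> M" for f M x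
  proof (cases "x \<in> W'")
    case True
    have "0 \<le> B * M * measure lborel W"
      using order_trans[OF norm_ge_zero bounded_kernel_le[OF f]] .
    then show ?thesis
      using True mult_mono[OF bounded_kernel_le[OF f] N[of x] _ norm_ge_zero] by (simp add: norm_mult)
  qed (use g in \<open>auto simp: bdd_supp_def\<close>)
  have iW': "integrable lborel (\<lambda>x. D * indicator W' x)" for D :: real
    using W' by (auto simp: fmeasurable_def)
  have int: "integrable lborel (\<lambda>x. (LINT y|lborel. k x y * f y) * g x)" if f: "f \<in> bdd_supp W" for f
  proof -
    obtain M where M: "\<And>y. norm (f y) \<le> M" using f by (auto simp: bdd_supp_def)
    have [measurable]: "(\<lambda>x. LINT y|lborel. k x y * f y) \<in> borel_measurable borel"
      by (rule bounded_kernel_measurable[OF f])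
    show ?thesis
    proof (rule Bochner_Integration.integrable_bound[OF iW'])
      show "AE x in lborel. norm ((LINT y|lborel. k x y * f y) * g x) \<le> norm (B * M * measure lborel W * N * indicator W' x)"
        unfolding real_norm_def by (intro AE_I2 order_trans[OF bound[OF f M] abs_ge_self])
    qed measurable
  qed
  {
    fix f h a b assume f: "f \<in> bdd_supp W" and h: "h \<in> bdd_supp W"
    have eq: "(LINT y|lborel. k x y * (a * f y + b * h y)) = a * (LINT y|lborel. k x y * f y) + b * (LINT y|lborel. k x y * h y)" for x
    proof -
      have "(LINT y|lborel. k x y * (a * f y + b * h y)) = (LINT y|lborel. a * (k x y * f y) + b * (k x y * h y))"
        by (simp add: algebra_simps)
      also have "\<dots> = a * (LINT y|lborel. k x y * f y) + b * (LINT y|lborel. k x y * h y)"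
        using bounded_kernel_integrable[OF f] bounded_kernel_integrable[OF h]
        by (subst Bochner_Integration.integral_add) auto
      finally show ?thesis .
    qed
    have "(LINT x|lborel. (a * (LINT y|lborel. k x y * f y) + b * (LINT y|lborel. k x y * h y)) * g x) =
      (LINT x|lborel. a * ((LINT y|lborel. k x y * f y) * g x) + b * ((LINT y|lborel. k x y * h y) * g x))"
      by (simp add: algebra_simps)
    also have "\<dots> = a * (LINT x|lborel. (LINT y|lborel. k x y * f y) * g x) + b * (LINT x|lborel. (LINT y|lborel. k x y * h y) * g x)"
      using int[OF f] int[OF h] by (subst Bochner_Integration.integral_add) auto
    finally show "(LINT x|lborel. (LINT y|lborel. k x y * (a * f y + b * h y)) * g x) =
      a * (LINT x|lborel. (LINT y|lborel. k x y * f y) * g x) + b * (LINT x|lborel. (LINT y|lborel. k x y * h y) * g x)"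
      by (simp only: eq)
  }
  fix F :: "nat \<Rightarrow> _" and f M
  assume F: "\<forall>k. F k \<in> bdd_supp W" and f: "f \<in> bdd_supp W" and M: "\<forall>k x. norm (F k x) \<le> M"
    and lim: "\<forall>x. (\<lambda>k. F k x) \<longlonglongrightarrow> f x"
  have [measurable]: "f \<in> borel_measurable borel" "\<And>i. F i \<in> borel_measurable borel"
    using f F by (auto simp: bdd_supp_def)
  have inner: "(\<lambda>i. LINT y|lborel. k x y * F i y) \<longlonglongrightarrow> (LINT y|lborel. k x y * f y)" for x
  proof (rule integral_dominated_convergence[where w = "\<lambda>y. B * M * indicator W y"])
    show "AE y in lborel. (\<lambda>i. k x y * F i y) \<longlonglongrightarrow> k x y * f y"
      using lim by (auto intro!: tendsto_mult)
    show "AE y in lborel. norm (k x y * F i y) \<le> B * M * indicator W y" for i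
      using F M by (intro AE_I2 bounded_kernel_pointwise_le) auto
  qed (measurable, rule integrable_const_indicator)
  show "(\<lambda>i. LINT x|lborel. (LINT y|lborel. k x y * F i y) * g x) \<longlonglongrightarrow> (LINT x|lborel. (LINT y|lborel. k x y * f y) * g x)"
  proof (rule integral_dominated_convergence[where w = "\<lambda>x. B * M * measure lborel W * N * indicator W' x"])
    show "AE x in lborel. (\<lambda>i. (LINT y|lborel. k x y * F i y) * g x) \<longlonglongrightarrow> (LINT y|lborel. k x y * f y) * g x"
      using inner by (auto intro!: tendsto_mult)
    show "AE x in lborel. norm ((LINT y|lborel. k x y * F i y) * g x) \<le> B * M * measure lborel W * N * indicator W' x" for i
      using F M by (intro AE_I2 bound) auto
  qed (measurable, rule iW')
qed

end

text \<open>
  The kernel is bounded on \<open>W' \<times> W\<close> because the closures are compact and disjoint.  Hence both sides,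
  tested against functions supported in \<open>W'\<close>, are continuous under bounded convergence, and the
  kernel representation of \<open>T\<close> on Schwartz functions extends to all bounded functions.
\<close>

lemma far_action:
  fixes T :: "(real^'n) operator"
  assumes U: "Lp_bounded C p s U" "\<forall>f\<in>schwartz. represents (U f) (T f)"
    and K: "is_kernel K" "associated T K"
    and W: "open W" "bounded W" and W': "open W'" "bounded W'" and disj: "closure W \<inter> closure W' = {}"
    and f: "f \<in> bdd_supp W"
  shows "AE x in lborel. x \<in> W' \<longrightarrow> U f x = (LINT y|lborel. K x y * f y)"
    and "x \<in> W' \<Longrightarrow> integrable lborel (\<lambda>y. K x y * f y)"
proof -
  have fin: "W \<in> fmeasurable lborel" "W' \<in> fmeasurable lborel"
    using W W' emeasure_bounded_finite by (auto simp: fmeasurable_def)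
  have cont: "continuous_on (closure W' \<times> closure W) (\<lambda>(x, y). K x y)"
    using K(1) unfolding is_kernel_def by (rule continuous_on_subset) (use disj in auto)
  have "compact ((\<lambda>(x, y). K x y) ` (closure W' \<times> closure W))"
    using W W' by (intro compact_continuous_image[OF cont] compact_Times) (auto simp: compact_closure)
  then obtain B where B: "\<And>x y. x \<in> closure W' \<Longrightarrow> y \<in> closure W \<Longrightarrow> norm (K x y) \<le> B"
    by (force dest!: compact_imp_bounded simp: bounded_iff)
  \<comment> \<open>Cutting off the kernel makes it jointly measurable and bounded on the whole product.\<close>
  define k where "k x y = indicator (W' \<times> W) (x, y) *\<^sub>R K x y" for x y
  have kK: "k x y = K x y" if "x \<in> W'" "y \<in> W" for x y
    using that by (simp add: k_def)
  have k0: "k x y = 0" if "x \<notin> W' \<or> y \<notin> W" for x y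
    using that by (auto simp: k_def)
  have "(\<lambda>z. indicator (W' \<times> W) z *\<^sub>R (\<lambda>(x, y). K x y) z) \<in> borel_measurable borel"
    using W(1) W'(1) cont closure_subset
    by (intro borel_measurable_continuous_on_indicator borel_open open_Times)
      (blast intro: continuous_on_subset)+
  then have k: "(\<lambda>(x, y). k x y) \<in> borel_measurable (borel \<Otimes>\<^sub>M borel)"
    by (simp add: k_def borel_prod case_prod_beta')
  have kB: "norm (k x y) \<le> max B 0" for x y
  proof (cases "x \<in> W' \<and> y \<in> W")
    case True
    then show ?thesis using B[of x y] closure_subset by (auto simp: kK le_max_iff_disj)
  qed (auto simp: k0)
  note kern = bounded_kernel_bp_functional[OF k kB fin(1) fin(2)]
  note pos = Lp_bounded_pos[OF U(1)]
  have ULp: "U \<phi> \<in> Lp s" if "\<phi> \<in> bdd_supp W" for \<phi>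
    by (intro Lp_bounded_in[OF U(1)] bdd_supp_Lp[OF that fin(1)] pos)
  define Kf where "Kf = (\<lambda>\<phi> x. LINT y|lborel. k x y * \<phi> y)"
  have Kf: "Kf \<phi> \<in> Lp 2" if \<phi>: "\<phi> \<in> bdd_supp W" for \<phi>
  proof -
    obtain M where M: "\<And>y. norm (\<phi> y) \<le> M" using \<phi> by (auto simp: bdd_supp_def)
    have "Kf \<phi> \<in> bdd_supp W'"
      using bounded_kernel_le[OF k kB fin(1) \<phi> M] bounded_kernel_measurable[OF k kB fin(1) \<phi>]
      by (auto simp: bdd_supp_def Kf_def k0)
    then show ?thesis by (rule bdd_supp_Lp[OF _ fin(2)]) simp
  qed
  have eq1: "(LINT x|lborel. U \<phi> x * \<psi> x) = (LINT x|lborel. Kf \<phi> x * \<psi> x)"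
    if \<phi>: "\<phi> \<in> schwartz" "\<phi> \<in> bdd_supp W" "closure {x. \<phi> x \<noteq> 0} \<subseteq> W"
      and \<psi>: "\<psi> \<in> schwartz" "\<psi> \<in> bdd_supp W'" "closure {x. \<psi> x \<noteq> 0} \<subseteq> W'" for \<phi> \<psi>
  proof -
    have "closure {x. \<phi> x \<noteq> 0} \<inter> closure {x. \<psi> x \<noteq> 0} = {}"
      using disj \<phi>(3) \<psi>(3) closure_subset[of W] closure_subset[of W'] by blast
    then have "T \<phi> \<psi> = (LINT x|lborel. LINT y|lborel. K x y * \<phi> y * \<psi> x)"
      using K(2) \<phi>(1) \<psi>(1) by (auto simp: associated_def)
    also have "\<dots> = (LINT x|lborel. LINT y|lborel. k x y * \<phi> y * \<psi> x)"
    proof -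
      have "K x y * \<phi> y * \<psi> x = k x y * \<phi> y * \<psi> x" for x y
        using \<phi>(2) \<psi>(2) by (cases "x \<in> W' \<and> y \<in> W") (auto simp: kK bdd_supp_def)
      then show ?thesis by (simp only:)
    qed
    also have "\<dots> = (LINT x|lborel. Kf \<phi> x * \<psi> x)"
      by (simp add: Kf_def)
    finally show ?thesis
      using bspec[OF U(2) \<phi>(1)] \<psi>(1) by (simp add: represents_def)
  qed
  have eq2: "(LINT x|lborel. U f x * \<psi> x) = (LINT x|lborel. Kf f x * \<psi> x)"
    if \<psi>: "\<psi> \<in> schwartz" "\<psi> \<in> bdd_supp W'" "closure {x. \<psi> x \<noteq> 0} \<subseteq> W'" for \<psi>
  proof -
    have "bp_functional W (\<lambda>\<phi>. (LINT x|lborel. U \<phi> x * \<psi> x) - (LINT x|lborel. Kf \<phi> x * \<psi> x))"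
      unfolding Kf_def by (intro bp_functional_diff kern \<psi>(2) pairing_bp_functional_left[OF U(1) \<psi>(2) fin])
    from bp_functional_zero[OF this W(1) _ f] show ?thesis
      using eq1[OF _ _ _ \<psi>] by simp
  qed
  have eq3: "(LINT x|lborel. U f x * g x) = (LINT x|lborel. Kf f x * g x)" if g: "g \<in> bdd_supp W'" for g
  proof -
    have "bp_functional W' (\<lambda>\<psi>. (LINT x|lborel. U f x * \<psi> x) - (LINT x|lborel. Kf f x * \<psi> x))"
      using fin pos f by (intro bp_functional_diff pairing_bp_functional_right[OF ULp] pairing_bp_functional_right[OF Kf]) auto
    from bp_functional_zero[OF this W'(1) _ g] show ?thesis
      using eq2 by simp
  qed
  have kf: "k x y * f y = K x y * f y" if "x \<in> W'" for x y
    using f that by (cases "y \<in> W") (auto simp: kK bdd_supp_def)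
  have "AE x in lborel. x \<in> W' \<longrightarrow> U f x = Kf f x"
    by (rule bdd_supp_pairing_eq_imp_AE[OF ULp[OF f] pos(3) Kf[OF f] _ fin(2) eq3]) auto
  then show "AE x in lborel. x \<in> W' \<longrightarrow> U f x = (LINT y|lborel. K x y * f y)"
    by eventually_elim (simp add: Kf_def kf)
  show "integrable lborel (\<lambda>y. K x y * f y)" if "x \<in> W'"
    using bounded_kernel_integrable[OF k kB fin(1) f, of x] that by (simp add: kf)
qed

text \<open>The constant is the value \<open>\<integral> K(z,y) f(y) dy\<close> of the kernel integral at the centre.\<close>

lemma far_oscillation:
  fixes T :: "(real^'n) operator"
  assumes U: "Lp_bounded C p s U" "\<forall>f\<in>schwartz. represents (U f) (T f)"
    and K: "is_kernel K" "associated T K"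
    and r: "0 < r" "r < S"
    and f: "f \<in> bdd_supp {y. S < norm (y - z) \<and> norm (y - z) < R}" and M: "\<And>y. norm (f y) \<le> M"
    and B: "\<And>x. norm (x - z) < r \<Longrightarrow>
      (\<integral>\<^sup>+y\<in>{y. S < norm (y - z)}. ennreal (norm (K x y - K z y)) \<partial>lborel) \<le> ennreal B" "0 \<le> B"
  obtains \<alpha> where "AE x in lborel. x \<in> ball z r \<longrightarrow> norm (U f x - \<alpha>) \<le> M * B"
proof
  let ?W = "{y. S < norm (y - z) \<and> norm (y - z) < R}"
  have "0 \<le> M" using M norm_ge_zero order_trans by blast
  have W: "open ?W"
    by (intro open_Collect_conj open_Collect_less continuous_intros)
  have Wb: "bounded ?W"
    by (rule bounded_subset[OF bounded_ball[of z R]]) (auto simp: dist_norm norm_minus_commute)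
  have "closure ?W \<subseteq> {y. S \<le> norm (y - z)}"
    by (intro closure_minimal closed_Collect_le continuous_intros) auto
  moreover have "closure (ball z r) = cball z r"
    using r by simp
  ultimately have disj: "closure ?W \<inter> closure (ball z r) = {}"
    using r by (force simp: dist_norm norm_minus_commute)
  note far = far_action[OF U K W Wb open_ball bounded_ball disj f]
  have le: "norm ((LINT y|lborel. K x y * f y) - (LINT y|lborel. K z y * f y)) \<le> M * B" if x: "x \<in> ball z r" for x
  proof -
    have i: "integrable lborel (\<lambda>y. K x y * f y)" "integrable lborel (\<lambda>y. K z y * f y)"
      using far(2) x r by auto
    have [measurable]: "(\<lambda>y. K x y) \<in> borel_measurable borel" "(\<lambda>y. K z y) \<in> borel_measurable borel"
      by (intro kernel_measurable_snd K)+
    have "norm ((LINT y|lborel. K x y * f y) - (LINT y|lborel. K z y * f y)) =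
        norm (LINT y|lborel. K x y * f y - K z y * f y)"
      using i by (subst Bochner_Integration.integral_diff) auto
    then have "ennreal (norm ((LINT y|lborel. K x y * f y) - (LINT y|lborel. K z y * f y))) \<le>
       (\<integral>\<^sup>+y. norm (K x y * f y - K z y * f y) \<partial>lborel)"
      using integral_norm_bound_ennreal[OF Bochner_Integration.integrable_diff[OF i]] by simp
    also have "\<dots> \<le> (\<integral>\<^sup>+y. ennreal M * (ennreal (norm (K x y - K z y)) * indicator {y. S < norm (y - z)} y) \<partial>lborel)"
    proof (rule nn_integral_mono)
      fix y
      have "norm (K x y * f y - K z y * f y) = norm (K x y - K z y) * norm (f y)"
        by (simp add: left_diff_distrib[symmetric] norm_mult)
      then show "ennreal (norm (K x y * f y - K z y * f y)) \<le>
          ennreal M * (ennreal (norm (K x y - K z y)) * indicator {y. S < norm (y - z)} y)"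
        using f M[of y] \<open>0 \<le> M\<close>
        by (cases "S < norm (y - z)")
          (auto simp: bdd_supp_def ennreal_mult[symmetric] mult.commute[of M] intro!: ennreal_leI mult_left_mono)
    qed
    also have "\<dots> = ennreal M * (\<integral>\<^sup>+y\<in>{y. S < norm (y - z)}. ennreal (norm (K x y - K z y)) \<partial>lborel)"
      by (rule nn_integral_cmult) measurable
    also have "\<dots> \<le> ennreal M * ennreal B"
      using x by (intro mult_left_mono B) (auto simp: dist_norm norm_minus_commute)
    finally show ?thesis
      using \<open>0 \<le> M\<close> \<open>0 \<le> B\<close> by (simp add: ennreal_mult[symmetric])
  qed
  show "AE x in lborel. x \<in> ball z r \<longrightarrow> norm (U f x - (LINT y|lborel. K z y * f y)) \<le> M * B"
    using far(1) by eventually_elim (auto intro: le)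
qed

section \<open>Kernel tails\<close>

text \<open>The exterior of a ball is covered by dyadic annuli, and the bounds form a geometric series.\<close>

lemma nn_integral_exterior_le_geometric:
  fixes h :: "real^'n \<Rightarrow> ennreal"
  assumes h[measurable]: "h \<in> borel_measurable borel" and R: "0 < R"
    and \<theta>: "0 \<le> \<theta>" "\<theta> < 1" and D: "0 \<le> D"
    and le: "\<And>j. J \<le> j \<Longrightarrow> (\<integral>\<^sup>+y\<in>annulus j z R. h y \<partial>lborel) \<le> ennreal (D * \<theta> ^ j)"
  shows "(\<integral>\<^sup>+y\<in>{y. 2 ^ J * R < norm (y - z)}. h y \<partial>lborel) \<le> ennreal (D * \<theta> ^ J / (1 - \<theta>))"
proof -
  have [measurable]: "annulus j z R \<in> sets borel" for j
    unfolding annulus_def by measurable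
  have cover: "\<exists>i. y \<in> annulus (J + i) z R" if y: "2 ^ J * R < norm (y - z)" for y
  proof -
    obtain m where m: "norm (y - z) / R < 2 ^ m"
      using real_arch_pow[of 2 "norm (y - z) / R"] by auto
    then have ex: "norm (y - z) \<le> 2 ^ m * R" using R by (simp add: field_simps)
    define l where "l = (LEAST m. norm (y - z) \<le> 2 ^ m * R)"
    have l: "norm (y - z) \<le> 2 ^ l * R"
      unfolding l_def using ex by (rule LeastI)
    have "J < l"
    proof (rule ccontr)
      assume "\<not> J < l"
      then have "2 ^ l * R \<le> 2 ^ J * R" using R by (intro mult_right_mono power_increasing) auto
      then show False using l y by linarith
    qed
    then obtain i where i: "l = Suc (J + i)" using less_iff_Suc_add by auto
    have "\<not> norm (y - z) \<le> 2 ^ (J + i) * R"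
      using not_less_Least[of "J + i" "\<lambda>m. norm (y - z) \<le> 2 ^ m * R"] i by (simp add: l_def)
    then show ?thesis using l i by (intro exI[of _ i]) (auto simp: annulus_def)
  qed
  have "(\<integral>\<^sup>+y\<in>{y. 2 ^ J * R < norm (y - z)}. h y \<partial>lborel) \<le> (\<integral>\<^sup>+y. (\<Sum>i. h y * indicator (annulus (J + i) z R) y) \<partial>lborel)"
  proof (rule nn_integral_mono)
    fix y
    show "h y * indicator {y. 2 ^ J * R < norm (y - z)} y \<le> (\<Sum>i. h y * indicator (annulus (J + i) z R) y)"
    proof (cases "2 ^ J * R < norm (y - z)")
      case True
      then obtain i where i: "y \<in> annulus (J + i) z R" using cover by blast
      have "h y = (\<Sum>j\<in>{i}. h y * indicator (annulus (J + j) z R) y)"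
        using i by simp
      also have "\<dots> \<le> (\<Sum>i. h y * indicator (annulus (J + i) z R) y)"
        by (rule sum_le_suminf) auto
      finally show ?thesis using True by simp
    qed simp
  qed
  also have "\<dots> = (\<Sum>i. \<integral>\<^sup>+y\<in>annulus (J + i) z R. h y \<partial>lborel)"
    by (rule nn_integral_suminf) measurable
  also have "\<dots> \<le> (\<Sum>i. ennreal (D * \<theta> ^ J * \<theta> ^ i))"
    using le by (intro suminf_le) (simp_all add: mult.assoc flip: power_add)
  also have "\<dots> = ennreal (\<Sum>i. D * \<theta> ^ J * \<theta> ^ i)"
    using \<theta> D by (intro suminf_ennreal2 summable_mult summable_geometric) auto
  also have "(\<Sum>i. D * \<theta> ^ J * \<theta> ^ i) = D * \<theta> ^ J / (1 - \<theta>)"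
    using \<theta> by (simp add: suminf_mult summable_geometric suminf_geometric)
  finally show ?thesis .
qed

lemma kernel_difference_le:
  fixes K :: "real^'n \<Rightarrow> real^'n \<Rightarrow> complex"
  shows "(\<integral>\<^sup>+y\<in>A. ennreal (norm (K x y - K z y)) \<partial>lborel) \<le>
    (\<integral>\<^sup>+y\<in>A. ennreal (norm (K y x - K y z) + norm (K x y - K z y)) \<partial>lborel)"
  by (intro nn_integral_mono mult_right_mono ennreal_leI) auto

lemma two_powr_power: "(2::real) powr (- real j * a) = (2 powr (- a)) ^ j"
proof -
  have "(2 powr (- a)) ^ j = (2 powr (- a)) powr real j"
    by (simp add: powr_realpow)
  also have "\<dots> = 2 powr (- real j * a)"
    by (simp only: powr_powr) (simp add: mult.commute)
  finally show ?thesis ..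
qed

text \<open>
  The decay in \<open>J\<close> is kept: it drives the convergence of the truncations on a fixed ball, where the
  radius \<open>R\<close> stays fixed and the supports recede.
\<close>

lemma D1_tail_large:
  fixes K :: "real^'n \<Rightarrow> real^'n \<Rightarrow> complex"
  assumes K: "is_kernel K" "D1 \<delta> \<sigma> K" and \<delta>: "0 < \<delta>"
  obtains B where "0 \<le> B"
    "\<And>z x R J. 1 \<le> J \<Longrightarrow> 1 < R \<Longrightarrow> norm (x - z) < R \<Longrightarrow>
      (\<integral>\<^sup>+y\<in>{y. 2 ^ J * R < norm (y - z)}. ennreal (norm (K x y - K z y)) \<partial>lborel) \<le> ennreal (B * (2 powr (- \<delta>)) ^ J)"
proof -
  have [measurable]: "(\<lambda>y. K x y) \<in> borel_measurable borel" for x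
    by (rule kernel_measurable_snd[OF K(1)])
  obtain C where C: "\<And>z y r j. 1 \<le> j \<Longrightarrow> norm (y - z) < r \<Longrightarrow> 1 < r \<Longrightarrow>
        (\<integral>\<^sup>+x\<in>annulus j z r. ennreal (norm (K x y - K x z) + norm (K y x - K z x)) \<partial>lborel)
        \<le> ennreal (C * 2 powr (- real j * \<delta>))"
    using K(2) unfolding D1_def by blast
  define \<theta> where "\<theta> = 2 powr (- \<delta>)"
  have \<theta>: "0 \<le> \<theta>" "\<theta> < 1" using \<delta> by (auto simp: \<theta>_def powr_less_one)
  show thesis
  proof
    show "0 \<le> max C 0 / (1 - \<theta>)" using \<theta> by simp
    fix z x :: "real^'n" and R :: real and J :: nat assume J: "1 \<le> J" and R: "1 < R" "norm (x - z) < R"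
    have "(\<integral>\<^sup>+y\<in>{y. 2 ^ J * R < norm (y - z)}. ennreal (norm (K x y - K z y)) \<partial>lborel) \<le> ennreal (max C 0 * \<theta> ^ J / (1 - \<theta>))"
    proof (rule nn_integral_exterior_le_geometric)
      fix j assume "J \<le> j"
      then have "1 \<le> j" using J by simp
      have "(\<integral>\<^sup>+y\<in>annulus j z R. ennreal (norm (K x y - K z y)) \<partial>lborel) \<le> ennreal (C * 2 powr (- real j * \<delta>))"
        by (rule order_trans[OF kernel_difference_le C[OF \<open>1 \<le> j\<close> R(2,1)]])
      also have "\<dots> \<le> ennreal (max C 0 * \<theta> ^ j)"
        unfolding two_powr_power \<theta>_def by (intro ennreal_leI mult_right_mono) auto
      finally show "(\<integral>\<^sup>+y\<in>annulus j z R. ennreal (norm (K x y - K z y)) \<partial>lborel) \<le> ennreal (max C 0 * \<theta> ^ j)" .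
    qed (use R \<theta> in auto)
    then show "(\<integral>\<^sup>+y\<in>{y. 2 ^ J * R < norm (y - z)}. ennreal (norm (K x y - K z y)) \<partial>lborel) \<le> ennreal (max C 0 / (1 - \<theta>) * (2 powr (- \<delta>)) ^ J)"
      by (simp add: \<theta>_def)
  qed
qed

text \<open>
  With \<open>e = \<delta> (1/\<rho> - 1/\<sigma>) \<ge> 0\<close> the annulus factor is at most a constant times \<open>2\<^bsup>je\<^esup> r\<^bsup>\<rho>e\<^esup>\<close>.  Since
  \<open>r < 1\<close> the power of \<open>r\<close> is at most one, and \<open>2\<^bsup>je\<^esup> 2\<^bsup>-j\<delta>/\<rho>\<^esup> = 2\<^bsup>-j\<delta>/\<sigma>\<^esup>\<close> is summable in \<open>j\<close>.
\<close>

lemma D1_tail_small: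
  fixes K :: "real^'n \<Rightarrow> real^'n \<Rightarrow> complex"
  assumes K: "is_kernel K" "D1 \<delta> \<sigma> K" and \<delta>: "0 < \<delta>" and \<rho>: "0 < \<rho>" "\<rho> \<le> \<sigma>"
  obtains B where "0 \<le> B"
    "\<And>z x r. 0 < r \<Longrightarrow> r < 1 \<Longrightarrow> norm (x - z) < r \<Longrightarrow>
      (\<integral>\<^sup>+y\<in>{y. 2 * r powr \<rho> < norm (y - z)}. ennreal (norm (K x y - K z y)) \<partial>lborel) \<le> ennreal B"
proof -
  have [measurable]: "(\<lambda>y. K x y) \<in> borel_measurable borel" for x
    by (rule kernel_measurable_snd[OF K(1)])
  have "\<exists>C. \<forall>z y r. \<forall>j\<ge>1. norm (y - z) < r \<and> r < 1 \<longrightarrow>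
        (\<integral>\<^sup>+x\<in>annulus j z (r powr \<rho>). ennreal (norm (K x y - K x z) + norm (K y x - K z x)) \<partial>lborel)
        \<le> ennreal (C * measure lborel (annulus j z (r powr \<rho>)) powr (\<delta> / CARD('n) * (1 / \<rho> - 1 / \<sigma>))
                     * 2 powr (- real j * \<delta> / \<rho>))"
    by (rule conjunct2[OF K(2)[unfolded D1_def], rule_format, OF conjI[OF \<rho>]])
  then obtain C where C: "\<forall>z y r. \<forall>j\<ge>1. norm (y - z) < r \<and> r < 1 \<longrightarrow>
        (\<integral>\<^sup>+x\<in>annulus j z (r powr \<rho>). ennreal (norm (K x y - K x z) + norm (K y x - K z x)) \<partial>lborel)
        \<le> ennreal (C * measure lborel (annulus j z (r powr \<rho>)) powr (\<delta> / CARD('n) * (1 / \<rho> - 1 / \<sigma>))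
                     * 2 powr (- real j * \<delta> / \<rho>))" ..
  define \<theta> where "\<theta> = 2 powr (- (\<delta> / \<sigma>))"
  have \<theta>: "0 \<le> \<theta>" "\<theta> < 1" using \<delta> \<rho> by (auto simp: \<theta>_def powr_less_one)
  define e where "e = \<delta> * (1 / \<rho> - 1 / \<sigma>)"
  have "1 / \<sigma> \<le> 1 / \<rho>" using \<rho> by (simp add: frac_le)
  then have e0: "0 \<le> e" using \<delta> by (simp add: e_def)
  define \<omega> where "\<omega> = unit_ball_vol (real CARD('n))"
  have \<omega>: "0 < \<omega>" by (simp add: \<omega>_def)
  define D where "D = max C 0 * (\<omega> powr (e / CARD('n)) * 2 powr e)"
  have D: "0 \<le> D" by (simp add: D_def)
  show thesis
  proof
    show "0 \<le> D * \<theta> ^ 1 / (1 - \<theta>)" using \<theta> D by simp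
    fix z x :: "real^'n" and r :: real assume r: "0 < r" "r < 1" "norm (x - z) < r"
    have "(\<integral>\<^sup>+y\<in>{y. 2 ^ 1 * r powr \<rho> < norm (y - z)}. ennreal (norm (K x y - K z y)) \<partial>lborel) \<le> ennreal (D * \<theta> ^ 1 / (1 - \<theta>))"
    proof (rule nn_integral_exterior_le_geometric)
      fix j :: nat assume j: "1 \<le> j"
      let ?m = "measure lborel (annulus j z (r powr \<rho>))"
      have "annulus j z (r powr \<rho>) \<subseteq> cball z (2 ^ (j + 1) * r powr \<rho>)"
        by (auto simp: annulus_def dist_norm norm_minus_commute)
      moreover have "annulus j z (r powr \<rho>) \<in> sets lborel"
        unfolding annulus_def by measurable
      ultimately have "?m \<le> measure lborel (cball z (2 ^ (j + 1) * r powr \<rho>))"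
        by (intro measure_mono_fmeasurable) (auto intro: bounded_borel_fmeasurable)
      also have "\<dots> = \<omega> * (2 ^ (j + 1) * r powr \<rho>) ^ CARD('n)"
        unfolding \<omega>_def by (rule measure_cball_cart) simp
      finally have m: "?m \<le> \<omega> * (2 ^ (j + 1) * r powr \<rho>) ^ CARD('n)" .
      have "?m powr (e / CARD('n)) \<le> (\<omega> * (2 ^ (j + 1) * r powr \<rho>) ^ CARD('n)) powr (e / CARD('n))"
        using m e0 by (intro powr_mono2) auto
      also have "\<dots> = \<omega> powr (e / CARD('n)) * (2 ^ (j + 1) * r powr \<rho>) powr e"
      proof -
        have "((2 ^ (j + 1) * r powr \<rho>) ^ CARD('n)) powr (e / CARD('n)) = (2 ^ (j + 1) * r powr \<rho>) powr e"
          using r by (subst powr_realpow[symmetric]) (simp_all add: powr_powr)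
        then show ?thesis using \<omega> r by (subst powr_mult) auto
      qed
      also have "(2 ^ (j + 1) * r powr \<rho>) powr e = 2 powr (real (j + 1) * e) * r powr (\<rho> * e)"
      proof -
        have p: "(2::real) ^ (j + 1) = 2 powr real (j + 1)"
          by (rule powr_realpow[symmetric]) simp
        show ?thesis unfolding p by (simp add: powr_mult powr_powr)
      qed
      also have "r powr (\<rho> * e) \<le> 1"
        using r \<rho> e0 by (intro powr_le1) auto
      finally have m2: "?m powr (e / CARD('n)) \<le> \<omega> powr (e / CARD('n)) * 2 powr (real (j + 1) * e)"
        using \<omega> by (simp add: mult_left_mono)
      have "?m powr (e / CARD('n)) * 2 powr (- real j * \<delta> / \<rho>) \<le>
          \<omega> powr (e / CARD('n)) * 2 powr (real (j + 1) * e) * 2 powr (- real j * \<delta> / \<rho>)"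
        by (intro mult_right_mono m2) auto
      also have "\<dots> = \<omega> powr (e / CARD('n)) * 2 powr e * 2 powr (- real j * (\<delta> / \<sigma>))"
      proof -
        have "real (j + 1) * e + (- real j * \<delta> / \<rho>) = e + (- real j * (\<delta> / \<sigma>))"
          by (simp add: e_def algebra_simps)
        then show ?thesis
          by (simp only: mult.assoc powr_add[symmetric])
      qed
      also have "2 powr (- real j * (\<delta> / \<sigma>)) = \<theta> ^ j"
        by (simp only: two_powr_power \<theta>_def)
      finally have "C * ?m powr (e / CARD('n)) * 2 powr (- real j * \<delta> / \<rho>) \<le> D * \<theta> ^ j"
        unfolding D_def
        by (simp only: mult.assoc) (rule mult_mono, auto)
      moreover have "\<delta> / CARD('n) * (1 / \<rho> - 1 / \<sigma>) = e / CARD('n)"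
        by (simp add: e_def)
      ultimately have "(\<integral>\<^sup>+y\<in>annulus j z (r powr \<rho>). ennreal (norm (K y x - K y z) + norm (K x y - K z y)) \<partial>lborel)
          \<le> ennreal (D * \<theta> ^ j)"
        using order_trans[OF C[rule_format, OF j conjI[OF r(3,2)]] ennreal_leI] by simp
      then show "(\<integral>\<^sup>+y\<in>annulus j z (r powr \<rho>). ennreal (norm (K x y - K z y)) \<partial>lborel) \<le> ennreal (D * \<theta> ^ j)"
        by (rule order_trans[OF kernel_difference_le])
    qed (use r \<theta> D in auto)
    then show "(\<integral>\<^sup>+y\<in>{y. 2 * r powr \<rho> < norm (y - z)}. ennreal (norm (K x y - K z y)) \<partial>lborel) \<le> ennreal (D * \<theta> ^ 1 / (1 - \<theta>))"
      by simp
  qed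
qed

section \<open>Uniform oscillation of images of truncated functions\<close>

text \<open>
  The parameter \<open>S\<close> separates the near part, whose image is bounded in \<open>L\<^sup>1\<close> on the ball, from the
  far part, whose image is nearly constant there.
\<close>

lemma oscillation_near_far:
  fixes T :: "(real^'n) operator"
  assumes U: "Lp_bounded C p s U" "\<forall>f\<in>schwartz. represents (U f) (T f)"
    and K: "is_kernel K" "associated T K"
    and r: "0 < r" "r < S"
    and f: "f \<in> bdd_supp (ball 0 N)" and M: "\<And>y. norm (f y) \<le> M"
    and B: "\<And>x. norm (x - z) < r \<Longrightarrow>
      (\<integral>\<^sup>+y\<in>{y. S < norm (y - z)}. ennreal (norm (K x y - K z y)) \<partial>lborel) \<le> ennreal B" "0 \<le> B"
    and near: "\<And>g. g \<in> bdd_supp (cball z S) \<Longrightarrow> (\<And>y. norm (g y) \<le> M) \<Longrightarrow>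
      (LINT x:ball z r|lborel. norm (U g x)) \<le> E"
  shows "\<exists>\<alpha>. (LINT x:ball z r|lborel. norm (U f x - \<alpha>)) \<le> E + M * B * measure lborel (ball z r)"
proof -
  let ?W = "{y. S < norm (y - z) \<and> norm (y - z) < N + norm z}"
  define f1 where "f1 = (\<lambda>y. indicator (cball z S) y * f y)"
  define f2 where "f2 = (\<lambda>y. indicator (- cball z S) y * f y)"
  note pos = Lp_bounded_pos[OF U(1)]
  have f1: "f1 \<in> bdd_supp (cball z S)"
    using bdd_supp_restrict[OF f, of "cball z S"] unfolding f1_def by (rule bdd_supp_mono) auto
  have sub: "- cball z S \<inter> ball 0 N \<subseteq> ?W"
  proof
    fix y assume "y \<in> - cball z S \<inter> ball 0 N"
    then show "y \<in> ?W"
      using norm_triangle_ineq4[of y z] by (auto simp: dist_norm norm_minus_commute)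
  qed
  have f2: "f2 \<in> bdd_supp ?W"
    using bdd_supp_restrict[OF f, of "- cball z S"] unfolding f2_def by (rule bdd_supp_mono[OF _ sub]) auto
  have M1: "norm (f1 y) \<le> M" "norm (f2 y) \<le> M" for y
    using M[of y] order_trans[OF norm_ge_zero M[of y]] by (auto simp: f1_def f2_def indicator_def)
  obtain \<alpha> where \<alpha>: "AE x in lborel. x \<in> ball z r \<longrightarrow> norm (U f2 x - \<alpha>) \<le> M * B"
    using far_oscillation[OF U K r f2 M1(2) B] by blast
  have "bounded ?W"
    by (rule bounded_subset[OF bounded_ball[of z "N + norm z"]]) (auto simp: dist_norm norm_minus_commute)
  moreover have "?W \<in> sets borel"
    by measurable
  ultimately have W: "?W \<in> fmeasurable lborel"
    by (rule bounded_borel_fmeasurable)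
  have Lp: "f1 \<in> Lp p" "f2 \<in> Lp p" "f \<in> Lp p"
    using bdd_supp_Lp[OF f1 ball_fmeasurable(2) pos(2)] bdd_supp_Lp[OF f2 W pos(2)]
      bdd_supp_Lp[OF f ball_fmeasurable(1) pos(2)] by auto
  have split: "f = (\<lambda>y. 1 * f1 y + 1 * f2 y)"
    by (auto simp: f1_def f2_def indicator_def)
  have "AE x in lborel. U f x = U f1 x + U f2 x"
    using Lp_bounded_linear[OF U(1) Lp(1,2), of 1 1] split by simp
  then have le: "AE x in lborel. indicator (ball z r) x * norm (U f x - \<alpha>) \<le>
      indicator (ball z r) x * norm (U f1 x) + M * B * indicator (ball z r) x"
    using \<alpha>
  proof eventually_elim
    case (elim x)
    then show ?case
      using norm_triangle_ineq[of "U f1 x" "U f2 x - \<alpha>"] by (auto simp: indicator_def algebra_simps)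
  qed
  have iUf: "set_integrable lborel (ball z r) (U g)" if "g \<in> Lp p" for g
    using Lp_set_integrable[OF Lp_bounded_in[OF U(1) that] _ ball_fmeasurable(1)] pos(3) by auto
  have "set_integrable lborel (ball z r) (\<lambda>x. U f x - \<alpha>)"
    using iUf[OF Lp(3)] ball_fmeasurable(1)[of z r]
    by (intro set_integral_diff) (auto simp: set_integrable_def fmeasurable_def)
  from set_integrable_norm[OF this]
  have i1: "integrable lborel (\<lambda>x. indicator (ball z r) x * norm (U f x - \<alpha>))"
    by (simp add: set_integrable_def)
  have i2: "integrable lborel (\<lambda>x. indicator (ball z r) x * norm (U f1 x))"
    using set_integrable_norm[OF iUf[OF Lp(1)]] by (simp add: set_integrable_def)
  have i3: "integrable lborel (\<lambda>x. M * B * indicator (ball z r) x)"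
    using ball_fmeasurable(1)[of z r] by (simp add: fmeasurable_def)
  have "(LINT x:ball z r|lborel. norm (U f x - \<alpha>)) \<le>
      (LINT x|lborel. indicator (ball z r) x * norm (U f1 x) + M * B * indicator (ball z r) x)"
    unfolding set_lebesgue_integral_def real_scaleR_def
    by (intro integral_mono_AE i1 Bochner_Integration.integrable_add i2 i3 le)
  also have "\<dots> = (LINT x:ball z r|lborel. norm (U f1 x)) + M * B * measure lborel (ball z r)"
    using i2 i3 by (subst Bochner_Integration.integral_add) (auto simp: set_lebesgue_integral_def)
  also have "\<dots> \<le> E + M * B * measure lborel (ball z r)"
    using near[OF f1 M1(1)] by simp
  finally show ?thesis by blast
qed

text \<open>For comparable radii the \<open>L\<^sup>2\<close> bound and the Cauchy-Schwarz inequality suffice.\<close>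

lemma near_large:
  fixes U :: "(real^'n \<Rightarrow> complex) \<Rightarrow> real^'n \<Rightarrow> complex"
  assumes U: "Lp_bounded C 2 2 U" and r: "0 < r"
    and g: "g \<in> bdd_supp (cball z (4 * r))" "\<And>y. norm (g y) \<le> M"
  shows "(LINT x:ball z r|lborel. norm (U g x)) \<le> C * 2 ^ CARD('n) * M * measure lborel (ball z r)"
proof -
  let ?b = "measure lborel (ball z r)"
  have c: "measure lborel (cball z (4 * r)) = (2 ^ CARD('n))\<^sup>2 * ?b"
  proof -
    have "(4::real) ^ CARD('n) = (2 ^ CARD('n))\<^sup>2"
      by (simp add: power2_eq_square flip: power_mult_distrib)
    then show ?thesis
      using r by (simp add: measure_cball_cart measure_ball_cart power_mult_distrib)
  qed
  have "(LINT x:ball z r|lborel. norm (U g x)) \<le>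
      C * M * ?b powr (1 - 1 / 2) * measure lborel (cball z (4 * r)) powr (1 / 2)"
    by (rule Lp_bounded_set_integral[OF U g ball_fmeasurable(2,1)])
  also have "\<dots> = C * M * (?b powr (1 / 2) * ?b powr (1 / 2) * (((2 ^ CARD('n))\<^sup>2) powr (1 / 2)))"
    unfolding c by (subst powr_mult) auto
  also have "?b powr (1 / 2) * ?b powr (1 / 2) = ?b"
    by (simp add: powr_add[symmetric])
  also have "((2 ^ CARD('n))\<^sup>2) powr (1 / 2) = (2 ^ CARD('n) :: real)"
    by (simp add: powr_half_sqrt)
  finally show ?thesis by (simp add: mult_ac)
qed

text \<open>
  For \<open>\<rho> < 1\<close> the near ball is so large that the \<open>L\<^sup>2\<close> bound would lose a power of \<open>r\<close>.  Instead the
  image is tested against its conjugate phase on \<open>B(z,r)\<close>, to which the adjoint is applied.  The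
  condition on \<open>\<rho>\<close> makes the powers of \<open>r\<close> from the two balls multiply to \<open>r\<^sup>n\<close>.
\<close>

lemma near_small:
  fixes T :: "(real^'n) operator"
  assumes U: "Lp_bounded C p s U" "\<forall>f\<in>schwartz. represents (U f) (T f)"
    and V: "Lp_bounded C' q t V" "\<forall>f\<in>schwartz. represents (V f) (adjoint_operator T f)"
    and \<rho>: "\<rho> * (1 - 1 / t) = 1 - 1 / q" and r: "0 < r"
    and g: "g \<in> bdd_supp (cball z (2 * r powr \<rho>))" "\<And>y. norm (g y) \<le> M"
  shows "(LINT x:ball z r|lborel. norm (U g x)) \<le>
    C' * (2 ^ CARD('n)) powr (1 - 1 / t) * unit_ball_vol (real CARD('n)) powr (1 / q - 1 / t) * M * measure lborel (ball z r)"
proof -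
  note pos = Lp_bounded_pos[OF V(1)] and Upos = Lp_bounded_pos[OF U(1)]
  let ?b = "measure lborel (ball z r)"
  let ?S = "2 * r powr \<rho>"
  let ?n = "real CARD('n)"
  let ?\<omega> = "unit_ball_vol ?n"
  have \<omega>: "0 < ?\<omega>" by simp
  have UgLp: "U g \<in> Lp s"
    by (rule Lp_bounded_in[OF U(1) bdd_supp_Lp[OF g(1) ball_fmeasurable(2) Upos(2)]])
  obtain \<phi> where \<phi>: "\<phi> \<in> bdd_supp (ball z r)" "\<And>x. norm (\<phi> x) \<le> 1"
      "\<And>x. U g x * \<phi> x = of_real (indicator (ball z r) x * norm (U g x))"
    using norming_function[of "U g" "ball z r"] Lp_measurable[OF UgLp] by auto
  have g': "g \<in> bdd_supp (ball z (?S + 1))"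
    by (rule bdd_supp_mono[OF g(1)]) auto
  have \<phi>Lp: "\<phi> \<in> Lp q" by (rule bdd_supp_Lp[OF \<phi>(1) ball_fmeasurable(1) pos(2)])
  have "complex_of_real (LINT x:ball z r|lborel. norm (U g x)) = (LINT x|lborel. U g x * \<phi> x)"
    by (simp only: \<phi>(3) set_lebesgue_integral_def real_scaleR_def integral_complex_of_real)
  also have "\<dots> = (LINT x|lborel. V \<phi> x * g x)"
    by (rule bdd_supp_transpose[OF U V g' \<phi>(1) ball_fmeasurable(1) open_ball ball_fmeasurable(1) open_ball])
  finally have "norm (complex_of_real (LINT x:ball z r|lborel. norm (U g x))) = norm (LINT x|lborel. V \<phi> x * g x)"
    by simp
  then have "(LINT x:ball z r|lborel. norm (U g x)) \<le> norm (LINT x|lborel. V \<phi> x * g x)"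
    by (simp only: norm_of_real)
  also have "\<dots> \<le> M * measure lborel (cball z ?S) powr (1 - 1 / t) * Lp_norm t (V \<phi>)"
    by (rule pairing_le[OF Lp_bounded_in[OF V(1) \<phi>Lp] pos(3) g(1) ball_fmeasurable(2) g(2)])
  also have "\<dots> \<le> M * measure lborel (cball z ?S) powr (1 - 1 / t) * (C' * (1 * ?b powr (1 / q)))"
    using Lp_norm_bdd_supp_le[OF \<phi>(1) ball_fmeasurable(1) pos(2) \<phi>(2)] pos(1) order_trans[OF norm_ge_zero g(2)]
    by (intro mult_left_mono order_trans[OF Lp_bounded_norm[OF V(1) \<phi>Lp]]) auto
  also have "\<dots> = M * C' * ((2 ^ CARD('n)) powr (1 - 1 / t) * ?\<omega> powr (1 / q - 1 / t) * ?b)"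
  proof -
    have b: "?b = ?\<omega> * r powr ?n"
      using r by (simp add: measure_ball_cart powr_realpow)
    have "measure lborel (cball z ?S) = ?\<omega> * (2 ^ CARD('n) * (r powr \<rho>) ^ CARD('n))"
      by (simp add: measure_cball_cart power_mult_distrib)
    also have "(r powr \<rho>) ^ CARD('n) = r powr (\<rho> * ?n)"
      using r by (simp add: powr_realpow[symmetric] powr_powr)
    finally have c: "measure lborel (cball z ?S) = ?\<omega> * (2 ^ CARD('n) * r powr (\<rho> * ?n))" .
    have "measure lborel (cball z ?S) powr (1 - 1 / t) * ?b powr (1 / q) =
      (2 ^ CARD('n)) powr (1 - 1 / t) * (?\<omega> powr (1 - 1 / t) * ?\<omega> powr (1 / q)) *
        (r powr (\<rho> * ?n * (1 - 1 / t)) * r powr (?n * (1 / q)))"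
      unfolding b c using \<omega> by (simp add: powr_mult powr_powr)
    also have "?\<omega> powr (1 - 1 / t) * ?\<omega> powr (1 / q) = ?\<omega> powr (1 / q - 1 / t) * ?\<omega>"
      using \<omega> by (simp add: powr_add[symmetric] powr_mult_base algebra_simps flip: powr_one)
    also have "r powr (\<rho> * ?n * (1 - 1 / t)) * r powr (?n * (1 / q)) = r powr ?n"
    proof -
      have "\<rho> * ?n * (1 - 1 / t) + ?n * (1 / q) = ?n * (\<rho> * (1 - 1 / t) + 1 / q)"
        by (simp add: algebra_simps)
      also have "\<dots> = ?n" by (simp add: \<rho>)
      finally show ?thesis by (simp add: powr_add[symmetric])
    qed
    finally show ?thesis by (simp add: b mult_ac)
  qed
  finally show ?thesis by (simp add: mult_ac)
qed

text \<open>
  The radii \<open>r \<ge> 1\<close> use the tail bound with \<open>2r > 1\<close> in place of \<open>r\<close>, which covers \<open>r = 1\<close> as well.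
\<close>

lemma uniform_oscillation:
  fixes T :: "(real^'n) operator"
  assumes U: "Lp_bounded C 2 2 U" "\<forall>f\<in>schwartz. represents (U f) (T f)"
    and V: "Lp_bounded C' q t V" "\<forall>f\<in>schwartz. represents (V f) (adjoint_operator T f)"
    and K: "is_kernel K" "associated T K" "D1 \<delta> \<sigma> K" and \<delta>: "0 < \<delta>"
    and \<rho>: "\<rho> * (1 - 1 / t) = 1 - 1 / q" "0 < \<rho>" "\<rho> \<le> \<sigma>" "\<sigma> \<le> 1"
  obtains A where "0 \<le> A"
    "\<And>f N M z r. f \<in> bdd_supp (ball 0 N) \<Longrightarrow> (\<And>y. norm (f y) \<le> M) \<Longrightarrow> 0 < r \<Longrightarrow>
      \<exists>\<alpha>. (LINT x:ball z r|lborel. norm (U f x - \<alpha>)) \<le> A * M * measure lborel (ball z r)"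
proof -
  obtain B1 where B1: "0 \<le> B1"
    "\<And>z x R J. 1 \<le> J \<Longrightarrow> 1 < R \<Longrightarrow> norm (x - z) < R \<Longrightarrow>
      (\<integral>\<^sup>+y\<in>{y. 2 ^ J * R < norm (y - z)}. ennreal (norm (K x y - K z y)) \<partial>lborel) \<le> ennreal (B1 * (2 powr (- \<delta>)) ^ J)"
    using D1_tail_large[OF K(1,3) \<delta>] by blast
  obtain B2 where B2: "0 \<le> B2"
    "\<And>z x r. 0 < r \<Longrightarrow> r < 1 \<Longrightarrow> norm (x - z) < r \<Longrightarrow>
      (\<integral>\<^sup>+y\<in>{y. 2 * r powr \<rho> < norm (y - z)}. ennreal (norm (K x y - K z y)) \<partial>lborel) \<le> ennreal B2"
    using D1_tail_small[OF K(1,3) \<delta> \<rho>(2,3)] by blast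
  define A1 where "A1 = C * 2 ^ CARD('n) + B1 * 2 powr (- \<delta>)"
  define A2 where "A2 = C' * (2 ^ CARD('n)) powr (1 - 1 / t) * unit_ball_vol (real CARD('n)) powr (1 / q - 1 / t) + B2"
  have A0: "0 \<le> A1" "0 \<le> A2"
    using B1(1) B2(1) Lp_bounded_pos(1)[OF U(1)] Lp_bounded_pos(1)[OF V(1)] by (auto simp: A1_def A2_def)
  show thesis
  proof
    show "0 \<le> max A1 A2" using A0 by simp
    fix f :: "real^'n \<Rightarrow> complex" and N M r :: real and z :: "real^'n"
    assume f: "f \<in> bdd_supp (ball 0 N)" and M: "\<And>y. norm (f y) \<le> M" and r: "0 < r"
    let ?b = "measure lborel (ball z r)"
    have "0 \<le> M" using M norm_ge_zero order_trans by blast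
    have weaken: "\<exists>\<alpha>. (LINT x:ball z r|lborel. norm (U f x - \<alpha>)) \<le> max A1 A2 * M * ?b"
      if "\<exists>\<alpha>. (LINT x:ball z r|lborel. norm (U f x - \<alpha>)) \<le> A * M * ?b" "A \<le> max A1 A2" for A
    proof -
      have "A * M * ?b \<le> max A1 A2 * M * ?b"
        using that(2) \<open>0 \<le> M\<close> by (intro mult_right_mono) auto
      then show ?thesis using that(1) order_trans by blast
    qed
    show "\<exists>\<alpha>. (LINT x:ball z r|lborel. norm (U f x - \<alpha>)) \<le> max A1 A2 * M * ?b"
    proof (cases "1 \<le> r")
      case True
      have "\<exists>\<alpha>. (LINT x:ball z r|lborel. norm (U f x - \<alpha>)) \<le>
          C * 2 ^ CARD('n) * M * ?b + M * (B1 * (2 powr (- \<delta>)) ^ 1) * ?b"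
      proof (rule oscillation_near_far[OF U K(1,2) r _ f M])
        show "r < 4 * r" using r by simp
        show "(\<integral>\<^sup>+y\<in>{y. 4 * r < norm (y - z)}. ennreal (norm (K x y - K z y)) \<partial>lborel) \<le> ennreal (B1 * (2 powr (- \<delta>)) ^ 1)"
          if "norm (x - z) < r" for x
          using B1(2)[of 1 "2 * r" x z] that True by simp
      qed (use B1(1) near_large[OF U(1) r] in auto)
      then have "\<exists>\<alpha>. (LINT x:ball z r|lborel. norm (U f x - \<alpha>)) \<le> A1 * M * ?b"
        by (simp add: A1_def algebra_simps)
      then show ?thesis by (rule weaken) simp
    next
      case False
      have "\<exists>\<alpha>. (LINT x:ball z r|lborel. norm (U f x - \<alpha>)) \<le>
          C' * (2 ^ CARD('n)) powr (1 - 1 / t) * unit_ball_vol (real CARD('n)) powr (1 / q - 1 / t) * M * ?b + M * B2 * ?b"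
      proof (rule oscillation_near_far[OF U K(1,2) r _ f M])
        have "r powr 1 \<le> r powr \<rho>"
          using False r \<rho> by (intro powr_mono') auto
        then show "r < 2 * r powr \<rho>" using r by simp
      qed (use B2 False r near_small[OF U V \<rho>(1) r] in auto)
      then have "\<exists>\<alpha>. (LINT x:ball z r|lborel. norm (U f x - \<alpha>)) \<le> A2 * M * ?b"
        by (simp add: A2_def algebra_simps)
      then show ?thesis by (rule weaken) simp
    qed
  qed
qed

section \<open>Essentially bounded functions, Schwartz functions and averages\<close>

lemma Linf_AE_le:
  assumes "f \<in> Linf"
  shows "AE x in lborel. norm (f x) \<le> Linf_norm f" and "0 \<le> Linf_norm f"
proof -
  let ?e = "esssup lborel (\<lambda>x. ereal (norm (f x)))"
  have [measurable]: "f \<in> borel_measurable borel" and fin: "?e < \<infinity>"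
    using assms by (auto simp: Linf_def)
  have ae: "AE x in lborel. ereal (norm (f x)) \<le> ?e"
    by (rule esssup_AE)
  have "0 \<le> ?e"
  proof -
    have "esssup lborel (\<lambda>x::real^'a. 0 :: ereal) \<le> ?e"
      by (intro esssup_mono) auto
    then show ?thesis by (simp add: esssup_const)
  qed
  then obtain M where M: "?e = ereal M" "0 \<le> M"
    using fin by (cases ?e) auto
  then have "Linf_norm f = M" by (simp add: Linf_norm_def)
  then show "AE x in lborel. norm (f x) \<le> Linf_norm f" "0 \<le> Linf_norm f"
    using ae M by auto
qed

lemma LinfI:
  assumes "f \<in> borel_measurable borel" "\<And>x. norm (f x) \<le> M"
  shows "f \<in> Linf"
proof -
  have "esssup lborel (\<lambda>x. ereal (norm (f x))) \<le> ereal M"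
    using assms by (intro esssup_I) auto
  then show ?thesis
    using assms by (auto simp: Linf_def)
qed

text \<open>The estimates above want pointwise bounds, so the null set where \<open>f\<close> is too large is removed.\<close>

lemma Linf_bounded_representative:
  assumes "f \<in> Linf"
  obtains f' where "f' \<in> borel_measurable borel" "\<And>x. norm (f' x) \<le> Linf_norm f" "AE x in lborel. f x = f' x"
proof
  have [measurable]: "f \<in> borel_measurable borel"
    using assms by (auto simp: Linf_def)
  let ?f' = "\<lambda>x. if norm (f x) \<le> Linf_norm f then f x else 0"
  show "?f' \<in> borel_measurable borel" by measurable
  show "norm (?f' x) \<le> Linf_norm f" for x using Linf_AE_le(2)[OF assms] by simp
  show "AE x in lborel. f x = ?f' x"
    using Linf_AE_le(1)[OF assms] by eventually_elim simp
qed

lemma schwartz_Linf: "f \<in> schwartz \<Longrightarrow> f \<in> Linf"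
proof -
  assume f: "f \<in> schwartz"
  then have "\<forall>N ds. bdd_above (range (\<lambda>x. (1 + norm x) ^ N * norm (partial_derivatives ds f x)))"
    by (simp add: schwartz_def)
  from this[rule_format, of 0 "[]"]
  have "bdd_above (range (\<lambda>x. norm (f x)))" by simp
  then obtain M where "\<And>x. norm (f x) \<le> M" by (auto simp: bdd_above_def)
  then show ?thesis using schwartz_measurable[OF f] by (intro LinfI) auto
qed

text \<open>
  Decay of order \<open>n + 2\<close> gives \<open>|f|\<^sup>2 \<le> D\<^sup>2 (k+1)\<^bsup>-n-2\<^esup>\<close> on the shell where \<open>|x|\<close> has integer part \<open>k\<close>, and
  the measure of the shell is at most a constant times \<open>(k+1)\<^sup>n\<close>.
\<close>

lemma schwartz_L2:
  fixes f :: "real^'n \<Rightarrow> complex"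
  assumes f: "f \<in> schwartz"
  shows "f \<in> Lp 2"
proof -
  let ?n = "CARD('n)"
  have [measurable]: "f \<in> borel_measurable borel" using schwartz_measurable[OF f] by simp
  have "\<forall>N ds. bdd_above (range (\<lambda>x. (1 + norm x) ^ N * norm (partial_derivatives ds f x)))"
    using f by (simp add: schwartz_def)
  from this[rule_format, of "?n + 2" "[]"]
  have "bdd_above (range (\<lambda>x. (1 + norm x) ^ (?n + 2) * norm (f x)))" by simp
  then obtain D where D: "\<And>x. (1 + norm x) ^ (?n + 2) * norm (f x) \<le> D" by (auto simp: bdd_above_def)
  have "0 \<le> (1 + norm (0 :: real^'n)) ^ (?n + 2) * norm (f 0)" by simp
  then have D0: "0 \<le> D" using D[of 0] by linarith
  define \<omega> where "\<omega> = unit_ball_vol (real ?n)"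
  have \<omega>: "0 \<le> \<omega>" by (simp add: \<omega>_def)
  have fle: "norm (f x) \<le> D / (1 + norm x) ^ (?n + 2)" for x
  proof -
    have "0 < (1 + norm x) ^ (?n + 2)" by (intro zero_less_power add_pos_nonneg) auto
    then show ?thesis using D[of x] by (subst pos_le_divide_eq) (auto simp only: mult.commute)
  qed
  have point: "ennreal (norm (norm (f x) powr 2)) \<le> (\<Sum>k. ennreal (D\<^sup>2 / real (Suc k) ^ (?n + 2)) * indicator (ball 0 (real (Suc k))) x)" for x
  proof -
    define k where "k = nat \<lfloor>norm x\<rfloor>"
    have k: "real k \<le> norm x" "norm x < real (Suc k)"
      using floor_correct[of "norm x"] zero_le_floor[of "norm x"] by (simp_all add: k_def, linarith)
    have "norm (f x) \<le> D / real (Suc k) ^ (?n + 2)"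
    proof (rule order_trans[OF fle], rule divide_left_mono)
      show "real (Suc k) ^ (?n + 2) \<le> (1 + norm x) ^ (?n + 2)"
        using k by (intro power_mono) auto
      show "0 < (1 + norm x) ^ (?n + 2) * real (Suc k) ^ (?n + 2)"
        by (intro mult_pos_pos zero_less_power add_pos_nonneg) auto
    qed (rule D0)
    then have "norm (f x) powr 2 \<le> (D / real (Suc k) ^ (?n + 2))\<^sup>2"
      by (simp add: power_mono)
    also have "\<dots> = D\<^sup>2 / (real (Suc k) ^ (?n + 2) * real (Suc k) ^ (?n + 2))"
      by (simp only: power2_eq_square times_divide_times_eq)
    also have "\<dots> \<le> D\<^sup>2 / (1 * real (Suc k) ^ (?n + 2))"
      by (intro divide_left_mono mult_right_mono one_le_power mult_pos_pos) auto
    finally have "ennreal (norm (norm (f x) powr 2)) \<le> ennreal (D\<^sup>2 / real (Suc k) ^ (?n + 2)) * indicator (ball 0 (real (Suc k))) x"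
      using k by (simp add: ennreal_leI del: of_nat_Suc)
    also have "\<dots> \<le> (\<Sum>k. ennreal (D\<^sup>2 / real (Suc k) ^ (?n + 2)) * indicator (ball 0 (real (Suc k))) x)"
      (is "?F k \<le> suminf ?F")
    proof -
      have "F k \<le> suminf F" for F :: "nat \<Rightarrow> ennreal"
        using sum_le_suminf[of F "{k}"] by simp
      then show "?F k \<le> suminf ?F" .
    qed
    finally show ?thesis .
  qed
  have "(\<integral>\<^sup>+x. ennreal (norm (norm (f x) powr 2)) \<partial>lborel) \<le>
      (\<integral>\<^sup>+x. (\<Sum>k. ennreal (D\<^sup>2 / real (Suc k) ^ (?n + 2)) * indicator (ball (0::real^'n) (real (Suc k))) x) \<partial>lborel)"
    by (intro nn_integral_mono point)
  also have "\<dots> = (\<Sum>k. ennreal (D\<^sup>2 / real (Suc k) ^ (?n + 2)) * emeasure lborel (ball (0::real^'n) (real (Suc k))))"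
    by (subst nn_integral_suminf) (auto simp: nn_integral_cmult_indicator intro!: borel_measurable_times_ennreal borel_measurable_indicator)
  also have "\<dots> = (\<Sum>k. ennreal (D\<^sup>2 * \<omega> * inverse (real (Suc k) ^ 2)))"
  proof (rule suminf_cong)
    fix k
    have "emeasure lborel (ball (0::real^'n) (real (Suc k))) = ennreal (\<omega> * real (Suc k) ^ ?n)"
      using emeasure_ball[of "real (Suc k)" "0::real^'n"] by (simp add: \<omega>_def)
    then have "ennreal (D\<^sup>2 / real (Suc k) ^ (?n + 2)) * emeasure lborel (ball (0::real^'n) (real (Suc k))) =
        ennreal (D\<^sup>2 / real (Suc k) ^ (?n + 2) * (\<omega> * real (Suc k) ^ ?n))"
      using \<omega> by (simp only:) (subst ennreal_mult, auto)
    also have "D\<^sup>2 / real (Suc k) ^ (?n + 2) * (\<omega> * real (Suc k) ^ ?n) = D\<^sup>2 * \<omega> * inverse (real (Suc k) ^ 2)"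
      by (simp add: power_add power2_eq_square field_simps del: of_nat_Suc)
    finally show "ennreal (D\<^sup>2 / real (Suc k) ^ (?n + 2)) * emeasure lborel (ball (0::real^'n) (real (Suc k))) =
       ennreal (D\<^sup>2 * \<omega> * inverse (real (Suc k) ^ 2))" .
  qed
  also have "\<dots> < \<infinity>"
  proof -
    have "summable (\<lambda>k. D\<^sup>2 * \<omega> * inverse (real (Suc k) ^ 2))"
      using summable_Suc_iff[of "\<lambda>k. inverse (real k ^ 2)"] inverse_power_summable[of 2, where 'a = real]
      by (intro summable_mult) simp
    then show ?thesis
      using \<omega> by (subst suminf_ennreal2) auto
  qed
  finally have "integrable lborel (\<lambda>x. norm (f x) powr 2)"
    by (intro integrableI_bounded) auto
  then show ?thesis by (simp add: Lp_def)
qed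

lemma average_const:
  "0 < r \<Longrightarrow> average (ball (z::real^'n) r) (\<lambda>x. c) = c"
  using ball_measure_pos[of r z] emeasure_bounded_finite[of "ball z r"]
  by (simp add: average_def set_lebesgue_integral_def scaleR_conv_of_real)

lemma average_cong_AE:
  fixes z :: "real^'n"
  assumes "f \<in> borel_measurable borel" "g \<in> borel_measurable borel" "AE x in lborel. x \<in> ball z r \<longrightarrow> f x = g x"
  shows "average (ball z r) f = average (ball z r) g"
proof -
  have [measurable]: "f \<in> borel_measurable borel" "g \<in> borel_measurable borel" using assms by auto
  have "(LINT x:ball z r|lborel. f x) = (LINT x:ball z r|lborel. g x)"
    unfolding set_lebesgue_integral_def using assms(3) by (intro integral_cong_AE) (auto simp: indicator_def)
  then show ?thesis by (simp add: average_def)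
qed

lemma average_lincomb:
  assumes "set_integrable lborel B f" "set_integrable lborel B g"
  shows "average B (\<lambda>x. a * f x + b * g x) = a * average B f + b * average B g"
  using assms by (simp add: average_def set_integral_add add_divide_distrib)

lemma average_diff_le:
  assumes "set_integrable lborel B f" "set_integrable lborel B g"
  shows "norm (average B f - average B g) \<le> (LINT x:B|lborel. norm (f x - g x)) / measure lborel B"
proof -
  have "average B f - average B g = (LINT x:B|lborel. f x - g x) / of_real (measure lborel B)"
    using assms by (simp add: average_def set_integral_diff diff_divide_distrib)
  also have "norm \<dots> \<le> (LINT x:B|lborel. norm (f x - g x)) / measure lborel B"
    using set_integral_norm_bound[OF set_integral_diff(1)[OF assms]]
    by (simp add: norm_divide divide_right_mono)
  finally show ?thesis .
qed

lemma set_integrable_const_ball: "set_integrable lborel (ball (z::real^'n) r) (\<lambda>x. c :: complex)"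
  using ball_fmeasurable(1)[of z r] by (auto simp: set_integrable_def fmeasurable_def)

lemma set_integral_ball_le_const:
  fixes z :: "real^'n"
  assumes "set_integrable lborel (ball z r) h" "AE x in lborel. x \<in> ball z r \<longrightarrow> norm (h x) \<le> D"
  shows "(LINT x:ball z r|lborel. norm (h x :: complex)) \<le> D * measure lborel (ball z r)"
proof -
  have i: "integrable lborel (\<lambda>x. D * indicator (ball z r) x)"
    using ball_fmeasurable(1)[of z r] by (simp add: fmeasurable_def)
  have "(LINT x:ball z r|lborel. norm (h x)) \<le> (LINT x|lborel. D * indicator (ball z r) x)"
    unfolding set_lebesgue_integral_def
  proof (rule integral_mono_AE)
    show "integrable lborel (\<lambda>x. indicat_real (ball z r) x *\<^sub>R norm (h x))"
      using set_integrable_norm[OF assms(1)] by (simp add: set_integrable_def)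
    show "AE x in lborel. indicat_real (ball z r) x *\<^sub>R norm (h x) \<le> D * indicat_real (ball z r) x"
      using assms(2) by eventually_elim (auto simp: indicator_def)
  qed (rule i)
  then show ?thesis using ball_fmeasurable(1)[of z r] by (simp add: fmeasurable_def)
qed

text \<open>Replacing an arbitrary constant by the average costs a factor of two.\<close>

lemma mean_oscillation_le:
  fixes z :: "real^'n"
  assumes r: "0 < r" and h: "set_integrable lborel (ball z r) h"
    and le: "(LINT x:ball z r|lborel. norm (h x - \<alpha>)) \<le> D * measure lborel (ball z r)"
  shows "mean_oscillation (ball z r) h \<le> 2 * D"
proof -
  let ?B = "ball z r" let ?a = "average ?B h"
  have pos: "0 < measure lborel ?B" by (rule ball_measure_pos[OF r])
  note c = set_integrable_const_ball[of z r]
  have i: "set_integrable lborel ?B (\<lambda>x. norm (h x - \<alpha>))" "set_integrable lborel ?B (\<lambda>x. norm (h x - ?a))"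
      "set_integrable lborel ?B (\<lambda>x. norm (\<alpha> - ?a))"
    by (intro set_integrable_norm set_integral_diff h c)+
  have "norm (\<alpha> - ?a) \<le> (LINT x:?B|lborel. norm (h x - \<alpha>)) / measure lborel ?B"
    using average_diff_le[OF h c, of \<alpha>] r by (simp add: average_const norm_minus_commute)
  also have "\<dots> \<le> D" using le pos by (simp add: divide_le_eq)
  finally have a: "norm (\<alpha> - ?a) \<le> D" .
  have "(LINT x:?B|lborel. norm (h x - ?a)) \<le> (LINT x:?B|lborel. norm (h x - \<alpha>) + norm (\<alpha> - ?a))"
    by (intro set_integral_mono set_integral_add i order_trans[OF _ norm_triangle_ineq]) simp
  also have "\<dots> = (LINT x:?B|lborel. norm (h x - \<alpha>)) + norm (\<alpha> - ?a) * measure lborel ?B"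
    using i ball_fmeasurable(1)[of z r]
    by (subst set_integral_add) (auto simp: set_lebesgue_integral_def fmeasurable_def)
  also have "\<dots> \<le> D * measure lborel ?B + D * measure lborel ?B"
    using le a pos by (intro add_mono mult_right_mono) auto
  finally show ?thesis
    using pos by (simp add: mean_oscillation_def divide_le_eq)
qed

section \<open>The extension to essentially bounded functions\<close>

definition truncate_ball :: "nat \<Rightarrow> (real^'n \<Rightarrow> complex) \<Rightarrow> real^'n \<Rightarrow> complex" where
  "truncate_ball m f = (\<lambda>y. indicator (ball 0 (real m)) y * f y)"

lemma truncate_ball_measurable:
  "f \<in> borel_measurable borel \<Longrightarrow> truncate_ball m f \<in> borel_measurable borel"
  unfolding truncate_ball_def by (intro borel_measurable_times borel_measurable_indicator) auto

lemma truncate_ball_bdd_supp: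
  assumes "f \<in> borel_measurable borel" "\<And>x. norm (f x) \<le> M"
  shows "truncate_ball m f \<in> bdd_supp (ball 0 (real m))" and "norm (truncate_ball m f x) \<le> M"
proof -
  have "f \<in> bdd_supp UNIV" using assms by (auto simp: bdd_supp_def)
  from bdd_supp_restrict[OF this, of "ball 0 (real m)"]
  show "truncate_ball m f \<in> bdd_supp (ball 0 (real m))" by (simp add: truncate_ball_def)
  show "norm (truncate_ball m f x) \<le> M"
    using assms(2)[of x] order_trans[OF norm_ge_zero assms(2)[of x]]
    by (auto simp: truncate_ball_def indicator_def)
qed

lemma Lp_cong_AE:
  assumes "g \<in> Lp p" "f \<in> borel_measurable borel" "AE x in lborel. f x = g x"
  shows "f \<in> Lp p"
proof -
  have [measurable]: "f \<in> borel_measurable borel" "g \<in> borel_measurable borel"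
    using assms by (auto simp: Lp_def)
  have "integrable lborel (\<lambda>x. norm (f x) powr p) \<longleftrightarrow> integrable lborel (\<lambda>x. norm (g x) powr p)"
    using assms(3) by (intro integrable_cong_AE) auto
  then show ?thesis using assms by (simp add: Lp_def)
qed

lemma truncate_ball_Lp:
  assumes "f \<in> Linf" "0 < p"
  shows "truncate_ball m f \<in> Lp p"
proof -
  obtain f' where f': "f' \<in> borel_measurable borel" "\<And>x. norm (f' x) \<le> Linf_norm f" "AE x in lborel. f x = f' x"
    using Linf_bounded_representative[OF assms(1)] by blast
  have [measurable]: "f \<in> borel_measurable borel" using assms by (auto simp: Linf_def)
  show ?thesis
  proof (rule Lp_cong_AE)
    show "truncate_ball m f' \<in> Lp p"
      by (rule bdd_supp_Lp[OF truncate_ball_bdd_supp(1)[OF f'(1,2)] ball_fmeasurable(1) assms(2)])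
    show "AE x in lborel. truncate_ball m f x = truncate_ball m f' x"
      using f'(3) by eventually_elim (simp add: truncate_ball_def)
    show "truncate_ball m f \<in> borel_measurable borel"
      by (rule truncate_ball_measurable) measurable
  qed
qed

lemma truncate_ball_tendsto_L2:
  fixes f :: "real^'n \<Rightarrow> complex"
  assumes f: "f \<in> Lp 2"
  shows "(\<lambda>m. Lp_norm 2 (\<lambda>x. truncate_ball m f x - f x)) \<longlonglongrightarrow> 0"
proof -
  have [measurable]: "f \<in> borel_measurable borel" using f by (simp add: Lp_def)
  have "(\<lambda>m. LINT x|lborel. norm (truncate_ball m f x - f x) powr 2) \<longlonglongrightarrow> (LINT x::real^'n|lborel. 0)"
  proof (rule integral_dominated_convergence[where w = "\<lambda>x. norm (f x) powr 2"])
    show "AE x in lborel. (\<lambda>m. norm (truncate_ball m f x - f x) powr 2) \<longlonglongrightarrow> 0"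
    proof (rule AE_I2)
      fix x :: "real^'n"
      obtain m0 where "norm x < real m0" using reals_Archimedean2 by blast
      then have "\<forall>\<^sub>F m in sequentially. norm (truncate_ball m f x - f x) powr 2 = 0"
        by (intro eventually_sequentiallyI[of m0]) (auto simp: truncate_ball_def)
      then show "(\<lambda>m. norm (truncate_ball m f x - f x) powr 2) \<longlonglongrightarrow> 0"
        by (rule tendsto_eventually)
    qed
    show "AE x in lborel. norm (norm (truncate_ball m f x - f x) powr 2) \<le> norm (f x) powr 2" for m
      by (auto simp: truncate_ball_def indicator_def)
    show "(\<lambda>x. norm (truncate_ball m f x - f x) powr 2) \<in> borel_measurable lborel" for m
      using truncate_ball_measurable[of f m] by measurable
  qed (use f in \<open>auto simp: Lp_def\<close>)
  then have "(\<lambda>m. (LINT x|lborel. norm (truncate_ball m f x - f x) powr 2) powr (1 / 2)) \<longlonglongrightarrow> 0 powr (1 / 2)"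
    by (intro tendsto_powr') auto
  then show ?thesis by (simp add: Lp_norm_def)
qed

text \<open>
  The images of the truncations need not converge: the tail of \<open>f\<close> contributes a constant that may
  diverge.  Subtracting the average over one fixed ball removes it.
\<close>

definition normalized_truncation ::
    "((real^'n \<Rightarrow> complex) \<Rightarrow> real^'n \<Rightarrow> complex) \<Rightarrow> (real^'n \<Rightarrow> complex) \<Rightarrow> nat \<Rightarrow> real^'n \<Rightarrow> complex" where
  "normalized_truncation U f m x = U (truncate_ball m f) x - average (ball 0 1) (U (truncate_ball m f))"

text \<open>Where the limit does not exist, on a null set, its value is arbitrary.\<close>

definition bmo_extension ::
    "((real^'n \<Rightarrow> complex) \<Rightarrow> real^'n \<Rightarrow> complex) \<Rightarrow> (real^'n \<Rightarrow> complex) \<Rightarrow> real^'n \<Rightarrow> complex" where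
  "bmo_extension U f x = lim (\<lambda>m. normalized_truncation U f m x)"

text \<open>
  The construction needs only two estimates: geometric decay of the kernel tails (constant \<open>B\<close>, with
  \<open>\<theta> = 2\<^bsup>-\<delta>\<^esup>\<close> in the application) and the uniform bound on oscillations (constant \<open>A\<close>).
\<close>

context
  fixes T :: "(real^'n) operator" and U :: "(real^'n \<Rightarrow> complex) \<Rightarrow> real^'n \<Rightarrow> complex"
    and K :: "real^'n \<Rightarrow> real^'n \<Rightarrow> complex" and C B \<theta> A :: real
  assumes U: "Lp_bounded C 2 2 U" "\<forall>f\<in>schwartz. represents (U f) (T f)"
    and K: "is_kernel K" "associated T K"
    and B: "0 \<le> B" and \<theta>: "0 \<le> \<theta>" "\<theta> < 1"
    and tail: "\<And>z x R J. 1 \<le> J \<Longrightarrow> 1 < R \<Longrightarrow> norm (x - z) < R \<Longrightarrow>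
      (\<integral>\<^sup>+y\<in>{y. 2 ^ J * R < norm (y - z)}. ennreal (norm (K x y - K z y)) \<partial>lborel) \<le> ennreal (B * \<theta> ^ J)"
    and A: "0 \<le> A"
    and osc: "\<And>f N M z r. f \<in> bdd_supp (ball 0 N) \<Longrightarrow> (\<And>y. norm (f y) \<le> M) \<Longrightarrow> 0 < r \<Longrightarrow>
      \<exists>\<alpha>. (LINT x:ball z r|lborel. norm (U f x - \<alpha>)) \<le> A * M * measure lborel (ball z r)"
begin

abbreviation (input) "trunc_image f m \<equiv> U (truncate_ball m f)"

lemma trunc_Lp: "f \<in> Linf \<Longrightarrow> truncate_ball m f \<in> Lp 2"
  by (rule truncate_ball_Lp) auto

lemma U_measurable: "f \<in> Lp 2 \<Longrightarrow> U f \<in> borel_measurable borel"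
  using Lp_bounded_in[OF U(1)] Lp_measurable by blast

lemma U_set_integrable: "f \<in> Lp 2 \<Longrightarrow> set_integrable lborel (ball z r) (U f)"
  by (rule Lp_set_integrable[OF Lp_bounded_in[OF U(1)] _ ball_fmeasurable(1)]) auto

lemma trunc_image_cong_AE:
  assumes "f \<in> Linf" "f' \<in> Linf" "AE x in lborel. f x = f' x"
  shows "AE x in lborel. trunc_image f m x = trunc_image f' m x"
proof (rule Lp_bounded_cong_AE[OF U(1) trunc_Lp[OF assms(1)] trunc_Lp[OF assms(2)]])
  show "AE x in lborel. truncate_ball m f x = truncate_ball m f' x"
    using assms(3) by eventually_elim (simp add: truncate_ball_def)
qed

lemma normalized_truncation_measurable:
  "f \<in> Linf \<Longrightarrow> normalized_truncation U f m \<in> borel_measurable borel"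
  using U_measurable[OF trunc_Lp] unfolding normalized_truncation_def[abs_def] by measurable

text \<open>
  The difference of two truncations is supported outside \<open>B(0, 2\<^sup>J k)\<close>, so its image is within the
  tail bound of a constant \<open>\<alpha>\<close> on \<open>B(0,k)\<close>.  The average over the unit ball is within the same
  distance of \<open>\<alpha>\<close>, whence the factor two.
\<close>

lemma normalized_truncation_cauchy:
  assumes f: "f \<in> Linf" and k: "2 \<le> k" and J: "1 \<le> J" and m: "2 ^ J * k + 1 \<le> m" "m \<le> m'"
  shows "AE x in lborel. x \<in> ball 0 (real k) \<longrightarrow>
    norm (normalized_truncation U f m' x - normalized_truncation U f m x) \<le> 2 * (Linf_norm f * (B * \<theta> ^ J))"
proof -
  let ?D = "Linf_norm f * (B * \<theta> ^ J)"
  obtain g where g: "g \<in> borel_measurable borel" "\<And>x. norm (g x) \<le> Linf_norm f" "AE x in lborel. f x = g x"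
    using Linf_bounded_representative[OF f] by blast
  have gL: "g \<in> Linf" by (rule LinfI[OF g(1,2)])
  define d where "d = (\<lambda>y. truncate_ball m' g y - truncate_ball m g y)"
  have "real (2 ^ J * k + 1) \<le> real m" using m(1) by (simp only: of_nat_le_iff)
  then have Sm: "2 ^ J * real k < real m" by simp
  have dM: "norm (d y) \<le> Linf_norm f" for y
    using g(2)[of y] order_trans[OF norm_ge_zero g(2)[of y]] m(2)
    by (auto simp: d_def truncate_ball_def indicator_def)
  have "d y = 0" if "\<not> (2 ^ J * real k < norm (y - 0) \<and> norm (y - 0) < real m')" for y
    using that Sm m(2) by (auto simp: d_def truncate_ball_def indicator_def)
  moreover have "d \<in> borel_measurable borel"
    unfolding d_def by (intro borel_measurable_diff truncate_ball_measurable g(1))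
  ultimately have d: "d \<in> bdd_supp {y. 2 ^ J * real k < norm (y - 0) \<and> norm (y - 0) < real m'}"
    using dM by (auto simp: bdd_supp_def)
  have pow: "(2::real) \<le> 2 ^ J"
    using power_increasing[OF J, of "2::real"] by simp
  have kJ: "0 < real k" "real k < 2 ^ J * real k" "1 < real k"
    using k mult_right_mono[OF pow, of "real k"] by auto
  have tail': "(\<integral>\<^sup>+y\<in>{y. 2 ^ J * real k < norm (y - 0)}. ennreal (norm (K x y - K 0 y)) \<partial>lborel) \<le> ennreal (B * \<theta> ^ J)"
    if "norm (x - 0) < real k" for x
    using tail[OF J kJ(3) that] .
  have "0 \<le> B * \<theta> ^ J" using B \<theta> by simp
  from far_oscillation[OF U K kJ(1,2) d dM tail' this]
  obtain \<alpha> where \<alpha>: "AE x in lborel. x \<in> ball 0 (real k) \<longrightarrow> norm (U d x - \<alpha>) \<le> ?D"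
    by blast
  have Ud: "AE x in lborel. trunc_image f m' x - trunc_image f m x = U d x"
    using trunc_image_cong_AE[OF f gL g(3), of m'] trunc_image_cong_AE[OF f gL g(3), of m]
      Lp_bounded_diff[OF U(1) trunc_Lp[OF gL] trunc_Lp[OF gL], of m' m]
    unfolding d_def by eventually_elim simp
  let ?c = "\<lambda>m. average (ball 0 1) (trunc_image f m)"
  let ?e = "\<lambda>x. trunc_image f m' x - trunc_image f m x"
  have int: "set_integrable lborel (ball z r) (trunc_image f m)" for z r m
    by (rule U_set_integrable[OF trunc_Lp[OF f]])
  have close: "AE x in lborel. x \<in> ball 0 (real k) \<longrightarrow> norm (?e x - \<alpha>) \<le> ?D"
    using \<alpha> Ud by eventually_elim simp
  have "norm (?c m' - ?c m - \<alpha>) \<le> ?D"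
  proof -
    have e: "set_integrable lborel (ball 0 1) ?e"
      by (intro set_integral_diff int)
    have "?c m' - ?c m = average (ball 0 1) ?e"
      using average_lincomb[OF int[of 0 1 m'] int[of 0 1 m], of 1 "-1"] by simp
    then have "norm (?c m' - ?c m - \<alpha>) = norm (average (ball 0 1) ?e - average (ball (0::real^'n) 1) (\<lambda>x. \<alpha>))"
      by (simp add: average_const)
    also have "\<dots> \<le> (LINT x:ball 0 1|lborel. norm (?e x - \<alpha>)) / measure lborel (ball (0::real^'n) 1)"
      by (rule average_diff_le[OF e set_integrable_const_ball])
    also have "\<dots> \<le> ?D"
    proof -
      have "AE x in lborel. x \<in> ball 0 1 \<longrightarrow> norm (?e x - \<alpha>) \<le> ?D"
        using close by eventually_elim (use kJ in auto)
      from set_integral_ball_le_const[OF set_integral_diff(1)[OF e set_integrable_const_ball] this]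
      show ?thesis using ball_measure_pos[of 1 "0::real^'n"] by (simp add: divide_le_eq)
    qed
    finally show ?thesis .
  qed
  note c = this
  show ?thesis
    using close
  proof eventually_elim
    case (elim x)
    show ?case
    proof
      assume "x \<in> ball 0 (real k)"
      then have "norm (?e x - \<alpha>) \<le> ?D" using elim by blast
      moreover have "normalized_truncation U f m' x - normalized_truncation U f m x = (?e x - \<alpha>) - (?c m' - ?c m - \<alpha>)"
        by (simp add: normalized_truncation_def)
      ultimately show "norm (normalized_truncation U f m' x - normalized_truncation U f m x) \<le> 2 * ?D"
        using c norm_triangle_ineq4[of "?e x - \<alpha>" "?c m' - ?c m - \<alpha>"] by simp
    qed
  qed
qed

lemma bmo_extension_limit:
  assumes f: "f \<in> Linf"
  shows "AE x in lborel. (\<lambda>m. normalized_truncation U f m x) \<longlonglongrightarrow> bmo_extension U f x \<and>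
    (\<forall>k J m. 2 \<le> k \<longrightarrow> 1 \<le> J \<longrightarrow> 2 ^ J * k + 1 \<le> m \<longrightarrow> x \<in> ball 0 (real k) \<longrightarrow>
      norm (bmo_extension U f x - normalized_truncation U f m x) \<le> 2 * (Linf_norm f * (B * \<theta> ^ J)))"
proof -
  let ?h = "normalized_truncation U f"
  let ?D = "\<lambda>J. 2 * (Linf_norm f * (B * \<theta> ^ J))"
  have "AE x in lborel. 2 \<le> k \<longrightarrow> 1 \<le> J \<longrightarrow> 2 ^ J * k + 1 \<le> m \<longrightarrow> m \<le> m' \<longrightarrow>
      x \<in> ball 0 (real k) \<longrightarrow> norm (?h m' x - ?h m x) \<le> ?D J" for k J m m'
    using normalized_truncation_cauchy[OF f, of k J m m'] by auto
  then have "AE x in lborel. \<forall>k J m m'. 2 \<le> k \<longrightarrow> 1 \<le> J \<longrightarrow> 2 ^ J * k + 1 \<le> m \<longrightarrow> m \<le> m' \<longrightarrow>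
      x \<in> ball 0 (real k) \<longrightarrow> norm (?h m' x - ?h m x) \<le> ?D J"
    by (simp only: AE_all_countable) blast
  then show ?thesis
  proof eventually_elim
    case (elim x)
    have D0: "?D \<longlonglongrightarrow> 2 * (Linf_norm f * (B * 0))"
      using \<theta> by (intro tendsto_intros LIMSEQ_realpow_zero)
    have "Cauchy (\<lambda>m. ?h m x)"
    proof (rule metric_CauchyI)
      fix e :: real assume "0 < e"
      then have "\<forall>\<^sub>F J in sequentially. ?D J < e"
        using D0 by (intro order_tendstoD(2)[of _ 0]) auto
      then obtain J0 where J0: "\<And>J. J0 \<le> J \<Longrightarrow> ?D J < e"
        by (auto simp: eventually_sequentially)
      define J where "J = max 1 J0"
      obtain k0 where k0: "norm x < real k0" using reals_Archimedean2 by blast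
      define k where "k = k0 + 2"
      have x: "x \<in> ball 0 (real k)" using k0 by (simp add: k_def)
      have le: "norm (?h m' x - ?h m x) \<le> ?D J" if "2 ^ J * k + 1 \<le> m" "m \<le> m'" for m m'
        using elim[rule_format, of k J m m'] x that by (simp add: k_def J_def)
      have lt: "?D J < e" using J0[of J] by (simp add: J_def)
      show "\<exists>M. \<forall>m\<ge>M. \<forall>n\<ge>M. dist (?h m x) (?h n x) < e"
      proof (intro exI allI impI)
        fix m n assume mn: "2 ^ J * k + 1 \<le> m" "2 ^ J * k + 1 \<le> n"
        show "dist (?h m x) (?h n x) < e"
          using le[OF mn(1), of n] le[OF mn(2), of m] lt
          by (cases "m \<le> n") (auto simp: dist_norm norm_minus_commute)
      qed
    qed
    then have "convergent (\<lambda>m. ?h m x)" by (rule Cauchy_convergent)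
    then have lim: "(\<lambda>m. ?h m x) \<longlonglongrightarrow> bmo_extension U f x"
      by (simp add: bmo_extension_def convergent_LIMSEQ_iff)
    moreover have "norm (bmo_extension U f x - ?h m x) \<le> ?D J"
      if "2 \<le> k" "1 \<le> J" "2 ^ J * k + 1 \<le> m" "x \<in> ball 0 (real k)" for k J m
    proof (rule LIMSEQ_le_const2)
      show "(\<lambda>m'. norm (?h m' x - ?h m x)) \<longlonglongrightarrow> norm (bmo_extension U f x - ?h m x)"
        by (intro tendsto_intros lim)
      show "\<exists>N. \<forall>m'\<ge>N. norm (?h m' x - ?h m x) \<le> ?D J"
        using elim that by blast
    qed
    ultimately show ?case by blast
  qed
qed

lemma bmo_extension_measurable:
  assumes "f \<in> Linf"
  shows "bmo_extension U f \<in> borel_measurable borel"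
  unfolding bmo_extension_def[abs_def]
  by (rule borel_measurable_lim_metric[OF normalized_truncation_measurable[OF assms]])

text \<open>
  On a given ball the extension stays within a fixed multiple of the norm of \<open>f\<close> from a single normalized
  truncation, so the oscillation bound for truncations carries over without a limit argument.
\<close>

lemma bmo_extension_oscillation:
  assumes f: "f \<in> Linf" and r: "0 < r"
  shows "set_integrable lborel (ball z r) (bmo_extension U f)"
    and "mean_oscillation (ball z r) (bmo_extension U f) \<le> 2 * (A + 2 * (B * \<theta>)) * Linf_norm f"
proof -
  let ?E = "bmo_extension U f" and ?M = "Linf_norm f" and ?B = "ball z r"
  obtain k0 where k0: "norm z + r < real k0" using reals_Archimedean2 by blast
  define k where "k = k0 + 2"
  define m where "m = 2 ^ 1 * k + 1"
  have sub: "?B \<subseteq> ball 0 (real k)"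
  proof
    fix x assume "x \<in> ?B"
    then have "norm (x - z) < r" by (simp add: dist_norm norm_minus_commute)
    then show "x \<in> ball 0 (real k)"
      using norm_triangle_ineq[of "x - z" z] k0 by (simp add: k_def)
  qed
  obtain g where g: "g \<in> borel_measurable borel" "\<And>x. norm (g x) \<le> ?M" "AE x in lborel. f x = g x"
    using Linf_bounded_representative[OF f] by blast
  have gL: "g \<in> Linf" by (rule LinfI[OF g(1,2)])
  note gb = truncate_ball_bdd_supp[OF g(1,2)]
  obtain \<alpha> where \<alpha>: "(LINT x:?B|lborel. norm (trunc_image g m x - \<alpha>)) \<le> A * ?M * measure lborel ?B"
    using osc[OF gb r] by blast
  define c where "c = average (ball 0 1) (trunc_image f m)"
  let ?w = "\<lambda>x. ?E x - (trunc_image g m x - c)"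
  have [measurable]: "?B \<in> sets borel" "?E \<in> borel_measurable borel" "trunc_image g m \<in> borel_measurable borel"
    using bmo_extension_measurable[OF f] U_measurable[OF trunc_Lp[OF gL]] by auto
  have w: "AE x in lborel. x \<in> ?B \<longrightarrow> norm (?w x) \<le> 2 * (?M * (B * \<theta>))"
    using bmo_extension_limit[OF f] trunc_image_cong_AE[OF f gL g(3), of m]
  proof eventually_elim
    case (elim x)
    have "norm (?E x - normalized_truncation U f m x) \<le> 2 * (?M * (B * \<theta> ^ 1))" if "x \<in> ball 0 (real k)"
      using elim(1)[THEN conjunct2, rule_format, of k 1 m] that by (simp add: k_def m_def)
    then show ?case
      using sub elim(2) by (auto simp: normalized_truncation_def c_def)
  qed
  have iw: "set_integrable lborel ?B ?w"
  proof -
    have "integrable lborel (\<lambda>x. 2 * (?M * (B * \<theta>)) * indicator ?B x)"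
      using ball_fmeasurable(1)[of z r] by (simp add: fmeasurable_def)
    then show ?thesis
      unfolding set_integrable_def
    proof (rule Bochner_Integration.integrable_bound)
      show "AE x in lborel. norm (indicat_real ?B x *\<^sub>R ?w x) \<le> norm (2 * (?M * (B * \<theta>)) * indicat_real ?B x)"
        using w by eventually_elim (auto simp: indicator_def intro: order_trans[OF _ abs_ge_self])
    qed measurable
  qed
  note ig = U_set_integrable[OF trunc_Lp[OF gL], of z r m]
  note const = set_integrable_const_ball[of z r]
  have E: "?E = (\<lambda>x. ?w x + (trunc_image g m x - c))" by (simp add: fun_eq_iff)
  have "set_integrable lborel ?B (\<lambda>x. ?w x + (trunc_image g m x - c))"
    by (intro set_integral_add iw set_integral_diff ig const)
  then show iE: "set_integrable lborel ?B ?E" using E by simp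
  have i1: "set_integrable lborel ?B (\<lambda>x. norm (trunc_image g m x - \<alpha>))"
    by (intro set_integrable_norm set_integral_diff ig const)
  have "(LINT x:?B|lborel. norm (?E x - (\<alpha> - c))) \<le> (LINT x:?B|lborel. norm (?w x) + norm (trunc_image g m x - \<alpha>))"
  proof (rule set_integral_mono)
    show "set_integrable lborel ?B (\<lambda>x. norm (?E x - (\<alpha> - c)))"
      by (intro set_integrable_norm set_integral_diff iE const)
    show "set_integrable lborel ?B (\<lambda>x. norm (?w x) + norm (trunc_image g m x - \<alpha>))"
      by (intro set_integral_add set_integrable_norm iw i1)
    show "norm (?E x - (\<alpha> - c)) \<le> norm (?w x) + norm (trunc_image g m x - \<alpha>)" for x
      using norm_triangle_ineq[of "?w x" "trunc_image g m x - \<alpha>"] by (simp add: algebra_simps)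
  qed
  also have "\<dots> = (LINT x:?B|lborel. norm (?w x)) + (LINT x:?B|lborel. norm (trunc_image g m x - \<alpha>))"
    by (intro set_integral_add set_integrable_norm iw i1)
  also have "\<dots> \<le> 2 * (?M * (B * \<theta>)) * measure lborel ?B + A * ?M * measure lborel ?B"
    by (intro add_mono \<alpha> set_integral_ball_le_const iw w)
  also have "\<dots> = ((A + 2 * (B * \<theta>)) * ?M) * measure lborel ?B"
    by (simp add: algebra_simps)
  finally have "mean_oscillation ?B ?E \<le> 2 * ((A + 2 * (B * \<theta>)) * ?M)"
    by (rule mean_oscillation_le[OF r iE])
  then show "mean_oscillation ?B ?E \<le> 2 * (A + 2 * (B * \<theta>)) * ?M"
    by (simp only: mult.assoc)
qed

lemma bmo_extension_linear:
  assumes f: "f \<in> Linf" and g: "g \<in> Linf"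
  shows "AE x in lborel. bmo_extension U (\<lambda>x. a * f x + b * g x) x = a * bmo_extension U f x + b * bmo_extension U g x"
proof -
  let ?s = "\<lambda>x. a * f x + b * g x"
  have trunc: "truncate_ball m ?s = (\<lambda>x. a * truncate_ball m f x + b * truncate_ball m g x)" for m
    by (simp add: truncate_ball_def fun_eq_iff algebra_simps)
  have lin: "AE x in lborel. trunc_image ?s m x = a * trunc_image f m x + b * trunc_image g m x" for m
    unfolding trunc by (rule Lp_bounded_linear[OF U(1) trunc_Lp[OF f] trunc_Lp[OF g]])
  have sum_Lp: "(\<lambda>x. a * f x + b * g x) \<in> Lp 2" if "f \<in> bdd_supp (ball 0 N)" "g \<in> bdd_supp (ball 0 N)" for f g and N :: real
    by (rule bdd_supp_Lp[OF bdd_supp_lincomb[OF that] ball_fmeasurable(1)]) simp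
  obtain f' where f': "f' \<in> borel_measurable borel" "\<And>x. norm (f' x) \<le> Linf_norm f" "AE x in lborel. f x = f' x"
    using Linf_bounded_representative[OF f] by blast
  obtain g' where g': "g' \<in> borel_measurable borel" "\<And>x. norm (g' x) \<le> Linf_norm g" "AE x in lborel. g x = g' x"
    using Linf_bounded_representative[OF g] by blast
  have meas: "trunc_image ?s m \<in> borel_measurable borel" for m
  proof (rule U_measurable, rule Lp_cong_AE)
    show "(\<lambda>x. a * truncate_ball m f' x + b * truncate_ball m g' x) \<in> Lp 2"
      by (rule sum_Lp[OF truncate_ball_bdd_supp(1)[OF f'(1,2)] truncate_ball_bdd_supp(1)[OF g'(1,2)]])
    show "truncate_ball m ?s \<in> borel_measurable borel"
      using f g by (intro truncate_ball_measurable) (auto simp: Linf_def)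
    show "AE x in lborel. truncate_ball m ?s x = a * truncate_ball m f' x + b * truncate_ball m g' x"
      using f'(3) g'(3) by eventually_elim (simp add: truncate_ball_def algebra_simps)
  qed
  have avg: "average (ball 0 1) (trunc_image ?s m) = a * average (ball 0 1) (trunc_image f m) + b * average (ball 0 1) (trunc_image g m)" for m
  proof -
    have "average (ball 0 1) (trunc_image ?s m) = average (ball 0 1) (\<lambda>x. a * trunc_image f m x + b * trunc_image g m x)"
      using lin[of m] U_measurable[OF trunc_Lp[OF f], of m] U_measurable[OF trunc_Lp[OF g], of m]
      by (intro average_cong_AE meas) auto
    then show ?thesis
      using average_lincomb[OF U_set_integrable[OF trunc_Lp[OF f]] U_set_integrable[OF trunc_Lp[OF g]]] by simp
  qed
  have "AE x in lborel. \<forall>m. trunc_image ?s m x = a * trunc_image f m x + b * trunc_image g m x"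
    using lin by (simp only: AE_all_countable) blast
  then show ?thesis
    using bmo_extension_limit[OF f] bmo_extension_limit[OF g]
  proof eventually_elim
    case (elim x)
    have "normalized_truncation U ?s m x = a * normalized_truncation U f m x + b * normalized_truncation U g m x" for m
      using elim(1) by (simp add: normalized_truncation_def avg algebra_simps)
    then have "(\<lambda>m. normalized_truncation U ?s m x) \<longlonglongrightarrow> a * bmo_extension U f x + b * bmo_extension U g x"
      using elim(2,3) by (simp only:) (intro tendsto_intros, auto)
    then show ?case unfolding bmo_extension_def[of U ?s] by (rule limI)
  qed
qed

text \<open>
  For a Schwartz function the truncations converge in \<open>L\<^sup>2\<close>, hence so do their images, and the subtracted
  averages converge to the average of \<open>U f\<close>.  A subsequence converges almost everywhere, which
  identifies the extension with \<open>U f\<close> minus that average.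
\<close>

lemma bmo_extension_schwartz:
  assumes f: "f \<in> schwartz"
  shows "\<exists>c. represents (\<lambda>x. bmo_extension U f x + c) (T f)"
proof -
  have fL: "f \<in> Linf" and f2: "f \<in> Lp 2" using f by (auto intro: schwartz_Linf schwartz_L2)
  let ?c = "\<lambda>m. average (ball 0 1) (trunc_image f m)"
  define c where "c = average (ball 0 1) (U f)"
  let ?e = "\<lambda>m x. norm (trunc_image f m x - U f x)"
  have ie: "set_integrable lborel (ball z r) (?e m)" for z r m
    by (intro set_integrable_norm set_integral_diff U_set_integrable trunc_Lp fL f2)
  have L1: "(\<lambda>m. LINT x:ball z r|lborel. ?e m x) \<longlonglongrightarrow> 0" for z r
  proof (rule tendsto_sandwich[OF _ _ tendsto_const])
    let ?b = "measure lborel (ball z r) powr (1 - 1 / 2)"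
    show "(\<lambda>m. ?b * (C * Lp_norm 2 (\<lambda>x. truncate_ball m f x - f x))) \<longlonglongrightarrow> 0"
      using tendsto_mult_left[OF tendsto_mult_left[OF truncate_ball_tendsto_L2[OF f2], of C], of ?b] by simp
    show "\<forall>\<^sub>F m in sequentially. 0 \<le> (LINT x:ball z r|lborel. ?e m x)"
      by (auto simp: set_lebesgue_integral_def intro!: always_eventually integral_nonneg_AE)
    show "\<forall>\<^sub>F m in sequentially. (LINT x:ball z r|lborel. ?e m x) \<le> ?b * (C * Lp_norm 2 (\<lambda>x. truncate_ball m f x - f x))"
    proof (intro always_eventually allI)
      fix m
      let ?d = "\<lambda>x. truncate_ball m f x - f x"
      have d: "?d \<in> Lp 2"
      proof -
        have [measurable]: "f \<in> borel_measurable borel" "truncate_ball m f \<in> borel_measurable borel"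
          using Lp_measurable[OF f2] truncate_ball_measurable by auto
        have "integrable lborel (\<lambda>x. norm (?d x) powr 2)"
        proof (rule Bochner_Integration.integrable_bound)
          show "integrable lborel (\<lambda>x. norm (f x) powr 2)" using f2 by (simp add: Lp_def)
          show "AE x in lborel. norm (norm (?d x) powr 2) \<le> norm (norm (f x) powr 2)"
            by (auto simp: truncate_ball_def indicator_def)
        qed measurable
        then show ?thesis by (simp add: Lp_def)
      qed
      have [measurable]: "ball z r \<in> sets borel" by simp
      have [measurable]: "trunc_image f m \<in> borel_measurable borel" "U f \<in> borel_measurable borel" "U ?d \<in> borel_measurable borel"
        by (intro U_measurable trunc_Lp fL f2 d)+
      have "(LINT x:ball z r|lborel. ?e m x) = (LINT x:ball z r|lborel. norm (U ?d x))"
        unfolding set_lebesgue_integral_def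
        using Lp_bounded_diff[OF U(1) trunc_Lp[OF fL] f2, of m] by (intro integral_cong_AE) auto
      also have "\<dots> \<le> ?b * Lp_norm 2 (U ?d)"
        by (rule set_integral_norm_le_Lp_norm[OF Lp_bounded_in[OF U(1) d] _ ball_fmeasurable(1)]) simp
      also have "\<dots> \<le> ?b * (C * Lp_norm 2 ?d)"
        by (intro mult_left_mono Lp_bounded_norm[OF U(1) d]) auto
      finally show "(LINT x:ball z r|lborel. ?e m x) \<le> ?b * (C * Lp_norm 2 ?d)" .
    qed
  qed
  have clim: "?c \<longlonglongrightarrow> c"
  proof -
    have "(\<lambda>m. (LINT x:ball 0 1|lborel. ?e m x) / measure lborel (ball (0::real^'n) 1)) \<longlonglongrightarrow> 0 / measure lborel (ball (0::real^'n) 1)"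
      using ball_measure_pos[of 1 "0::real^'n"] by (intro tendsto_divide L1) auto
    then have lim0: "(\<lambda>m. (LINT x:ball 0 1|lborel. ?e m x) / measure lborel (ball (0::real^'n) 1)) \<longlonglongrightarrow> 0"
      by simp
    have "norm (?c m - c) \<le> (LINT x:ball 0 1|lborel. ?e m x) / measure lborel (ball (0::real^'n) 1)" for m
      unfolding c_def by (intro average_diff_le U_set_integrable trunc_Lp fL f2)
    from Lim_null_comparison[OF always_eventually[OF allI[OF this]] lim0]
    show ?thesis by (rule LIM_zero_cancel)
  qed
  have on_ball: "AE x in lborel. x \<in> ball 0 (real k) \<longrightarrow> bmo_extension U f x + c = U f x" for k
  proof -
    have "(\<lambda>m. LINT x|lborel. norm (indicator (ball 0 (real k)) x *\<^sub>R ?e m x)) \<longlonglongrightarrow> 0"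
      using L1[of 0 "real k"] by (simp add: set_lebesgue_integral_def)
    from tendsto_L1_AE_subseq[OF _ this]
    obtain s where s: "strict_mono s" "AE x in lborel. (\<lambda>n. indicator (ball 0 (real k)) x *\<^sub>R ?e (s n) x) \<longlonglongrightarrow> 0"
      using ie[of 0 "real k"] by (auto simp: set_integrable_def)
    show ?thesis
      using s(2) bmo_extension_limit[OF fL]
    proof eventually_elim
      case (elim x)
      show ?case
      proof
        assume x: "x \<in> ball 0 (real k)"
        then have "(\<lambda>n. ?e (s n) x) \<longlonglongrightarrow> 0" using elim(1) by simp
        then have "(\<lambda>n. trunc_image f (s n) x - U f x) \<longlonglongrightarrow> 0"
          by (rule tendsto_norm_zero_cancel)
        then have 1: "(\<lambda>n. trunc_image f (s n) x) \<longlonglongrightarrow> U f x"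
          by (rule LIM_zero_cancel)
        have "(\<lambda>n. normalized_truncation U f (s n) x) \<longlonglongrightarrow> bmo_extension U f x"
          using LIMSEQ_subseq_LIMSEQ[OF conjunct1[OF elim(2)] s(1)] by (simp add: o_def)
        moreover have "(\<lambda>n. ?c (s n)) \<longlonglongrightarrow> c"
          using LIMSEQ_subseq_LIMSEQ[OF clim s(1)] by (simp add: o_def)
        ultimately have "(\<lambda>n. normalized_truncation U f (s n) x + ?c (s n)) \<longlonglongrightarrow> bmo_extension U f x + c"
          by (rule tendsto_add)
        then have "(\<lambda>n. trunc_image f (s n) x) \<longlonglongrightarrow> bmo_extension U f x + c"
          by (simp add: normalized_truncation_def)
        then show "bmo_extension U f x + c = U f x"
          using 1 by (rule LIMSEQ_unique)
      qed
    qed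
  qed
  have eq: "AE x in lborel. bmo_extension U f x + c = U f x"
  proof -
    have "AE x in lborel. \<forall>k. x \<in> ball 0 (real k) \<longrightarrow> bmo_extension U f x + c = U f x"
      using on_ball by (simp only: AE_all_countable) blast
    then show ?thesis
    proof eventually_elim
      case (elim x)
      obtain k where "norm x < real k" using reals_Archimedean2 by blast
      then show ?case using elim by auto
    qed
  qed
  have "represents (\<lambda>x. bmo_extension U f x + c) (T f)"
    unfolding represents_def
  proof
    fix \<phi> :: "real^'n \<Rightarrow> complex" assume \<phi>: "\<phi> \<in> schwartz"
    have [measurable]: "bmo_extension U f \<in> borel_measurable borel" "U f \<in> borel_measurable borel" "\<phi> \<in> borel_measurable borel"
      using bmo_extension_measurable[OF fL] U_measurable[OF f2] schwartz_measurable[OF \<phi>] by auto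
    have ae: "AE x in lborel. (bmo_extension U f x + c) * \<phi> x = U f x * \<phi> x"
      using eq by eventually_elim simp
    have "integrable lborel (\<lambda>x. U f x * \<phi> x)" "T f \<phi> = (LINT x|lborel. U f x * \<phi> x)"
      using U(2) f \<phi> by (auto simp: represents_def)
    moreover have "integrable lborel (\<lambda>x. (bmo_extension U f x + c) * \<phi> x) \<longleftrightarrow> integrable lborel (\<lambda>x. U f x * \<phi> x)"
      by (intro integrable_cong_AE ae) measurable
    moreover have "(LINT x|lborel. (bmo_extension U f x + c) * \<phi> x) = (LINT x|lborel. U f x * \<phi> x)"
      by (intro integral_cong_AE ae) measurable
    ultimately show "integrable lborel (\<lambda>x. (bmo_extension U f x + c) * \<phi> x) \<and>
        T f \<phi> = (LINT x|lborel. (bmo_extension U f x + c) * \<phi> x)"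
      by simp
  qed
  then show ?thesis ..
qed

lemma bmo_extension_extends: "extends_Linf_BMO T"
  unfolding extends_Linf_BMO_def
proof (intro exI[of _ "bmo_extension U"] conjI ballI allI)
  let ?Q = "2 * (A + 2 * (B * \<theta>))"
  have bdd: "bdd_above {mean_oscillation (ball z r) (bmo_extension U f) | z r. 0 < r}" if "f \<in> Linf" for f
    using bmo_extension_oscillation(2)[OF that] by (intro bdd_aboveI[of _ "?Q * Linf_norm f"]) auto
  show "bmo_extension U f \<in> BMO" if "f \<in> Linf" for f
    using bmo_extension_measurable[OF that] bmo_extension_oscillation(1)[OF that] bdd[OF that]
    by (simp add: BMO_def)
  show "\<exists>Q. \<forall>f\<in>Linf. BMO_norm (bmo_extension U f) \<le> Q * Linf_norm f"
  proof (intro exI ballI)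
    fix f :: "real^'n \<Rightarrow> complex" assume f: "f \<in> Linf"
    have "{mean_oscillation (ball z r) (bmo_extension U f) | z r. 0 < r} \<noteq> {}"
      by (auto intro!: exI[of _ 1])
    then show "BMO_norm (bmo_extension U f) \<le> ?Q * Linf_norm f"
      unfolding BMO_norm_def by (rule cSup_least) (use bmo_extension_oscillation(2)[OF f] in auto)
  qed
  show "\<exists>c. AE x in lborel. bmo_extension U (\<lambda>x. a * f x + b * g x) x = a * bmo_extension U f x + b * bmo_extension U g x + c"
    if "f \<in> Linf" "g \<in> Linf" for f g a b
    using bmo_extension_linear[OF that] by (intro exI[of _ 0]) simp
  show "\<exists>c. represents (\<lambda>x. bmo_extension U f x + c) (T f)" if "f \<in> schwartz" for f
    by (rule bmo_extension_schwartz[OF that])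
qed

end

theorem theorem1p2:
  fixes T :: "(real^'n \<Rightarrow> complex) \<Rightarrow> (real^'n \<Rightarrow> complex) \<Rightarrow> complex"
    and K :: "real^'n \<Rightarrow> real^'n \<Rightarrow> complex"
    and \<delta> \<sigma> \<beta> s\<^sub>2 q :: real
  assumes "\<delta> > 0" and "0 < \<sigma>" and "\<sigma> \<le> 1"
    and "schwartz_operator T"
    and "extends_Lp 2 2 T"
    and "is_kernel K" and "associated T K" and "D1 \<delta> \<sigma> K"
    and "1 < s\<^sub>2"
    and "CARD('n) * (1 - \<sigma>) * (1 - 1 / s\<^sub>2) \<le> \<beta>" and "\<beta> < CARD('n) * (1 - 1 / s\<^sub>2)"
    and "1 / q = 1 / s\<^sub>2 + \<beta> / CARD('n)"
    and "extends_Lp q s\<^sub>2 T" and "extends_Lp q s\<^sub>2 (adjoint_operator T)"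
  shows "extends_Linf_BMO T"
proof -
  define a where "a = 1 - 1 / s\<^sub>2"
  define b where "b = \<beta> / CARD('n)"
  have n: "0 < real CARD('n)" by simp
  have a: "0 < a" using assms(9) by (simp add: a_def)
  have lo: "(1 - \<sigma>) * a \<le> b" and hi: "b < a"
    using assms(10,11) n by (simp_all add: a_def b_def pos_le_divide_eq pos_divide_less_eq mult_ac)
  have "0 \<le> (1 - \<sigma>) * a" using a assms(3) by simp
  then have b: "0 \<le> b" using lo by linarith
  have q: "1 / q = 1 - a + b" using assms(12) by (simp add: a_def b_def)
  have "0 < 1 / q" using q b assms(9) by (simp add: a_def add_pos_nonneg)
  then have "0 < q" by simp
  \<comment> \<open>The exponent that balances the near part over small balls; it is at most \<open>\<sigma>\<close> by the lower
      bound on \<open>\<beta>\<close>, and positive by the upper bound.\<close>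
  define \<rho> where "\<rho> = (a - b) / a"
  have "\<rho> * a = 1 - 1 / q"
    unfolding q using a by (simp add: \<rho>_def)
  moreover have "a - b \<le> \<sigma> * a" using lo by (simp add: algebra_simps)
  ultimately have \<rho>: "\<rho> * (1 - 1 / s\<^sub>2) = 1 - 1 / q" "0 < \<rho>" "\<rho> \<le> \<sigma>"
    using a hi by (simp_all add: \<rho>_def a_def[symmetric] pos_divide_le_eq)
  obtain U C where U: "Lp_bounded C 2 2 U" "\<forall>f\<in>schwartz. represents (U f) (T f)"
    by (rule extends_LpE[OF assms(5)]) auto
  obtain V C' where V: "Lp_bounded C' q s\<^sub>2 V" "\<forall>f\<in>schwartz. represents (V f) (adjoint_operator T f)"
    by (rule extends_LpE[OF assms(14) \<open>0 < q\<close> assms(9)])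
  obtain B where B: "0 \<le> B"
    "\<And>z x R J. 1 \<le> J \<Longrightarrow> 1 < R \<Longrightarrow> norm (x - z) < R \<Longrightarrow>
      (\<integral>\<^sup>+y\<in>{y. 2 ^ J * R < norm (y - z)}. ennreal (norm (K x y - K z y)) \<partial>lborel) \<le> ennreal (B * (2 powr (- \<delta>)) ^ J)"
    using D1_tail_large[OF assms(6,8,1)] by blast
  obtain A where A: "0 \<le> A"
    "\<And>f N M z r. f \<in> bdd_supp (ball 0 N) \<Longrightarrow> (\<And>y. norm (f y) \<le> M) \<Longrightarrow> 0 < r \<Longrightarrow>
      \<exists>\<alpha>. (LINT x:ball z r|lborel. norm (U f x - \<alpha>)) \<le> A * M * measure lborel (ball z r)"
    using uniform_oscillation[OF U V assms(6,7,8,1) \<rho> assms(3)] by blast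
  show ?thesis
    by (rule bmo_extension_extends[OF U assms(6,7) B(1) _ _ B(2) A])
      (use assms(1) in \<open>auto simp: powr_less_one\<close>)
qed

end
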